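(* Let $n\ge1$, $0<\sigma<1$, and let $$1\le p<\begin{cases}1+\frac{4}{n-1} & n\le2,\\[2pt] 1+\frac{4n}{n^2+n-4} & n\ge3.\end{cases}$$ For every sufficiently large $\eta>1$ and every $C>1$ there exist $\alpha_0>0$ (sufficiently small with respect to $p$ and $C$), $\gamma\in(1,\eta)$ with $\gamma-1$ sufficiently small, and a constant $K>0$, all independent of $t_*$, $V$ and $\phi$, such that the following holds. Let $t_*>0$ and $0<\alpha\le\alpha_0$, let $V\in C^1(\overline{\mathcal{R}^\sigma_\eta(t_* )})$ satisfy $$C^{-1}\le V\le C,\qquad |\nabla V|\le\alpha t_*^{-1},$$ and let $\phi\in C^2(\overline{\mathcal{R}^\sigma_\eta(t_* )})$ be a (real-valued) solution of $$\Box\phi+V|\phi|^{p-1}\phi=0.$$ Then $$\int_{\mathcal{R}^\sigma_\gamma(t_* )}|\phi|^{p+1}\le K\,t_*\int_{\mathcal{K}^\sigma_\eta(t_* )}\left[|\nabla\phi|^2+|\phi|^{p+1}+t_*^{-2}|\phi|^2\right].$$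
   Context: $\Box:=-\partial_t^2+\Delta_x$ is the wave operator on $\mathbb{R}^{n+1}=\mathbb{R}_t\times\mathbb{R}^n_x$. For a $C^1$ function $\phi$, $|\nabla\phi|^2:=(\partial_t\phi)^2+\sum_{i=1}^n(\partial_{x^i}\phi)^2$. For $n=1$, $\frac{4}{n-1}$ is read as $+\infty$. For $0<\sigma<1$, $\mathcal{C}^\sigma:=\{(t,x)\mid |x|<\sigma t\}$, with boundary $\partial\mathcal{C}^\sigma=\{|x|=\sigma t\}$. For $t_*>0$ and $\gamma>1$, $\mathcal{R}^\sigma_\gamma(t_* ):=\{\gamma^{-1}t_*<t<\gamma t_*\}\cap\mathcal{C}^\sigma$. For $t_*>0$ and $\eta>1$, $\mathcal{K}^\sigma_\eta(t_* ):=\partial\mathcal{C}^\sigma\cap\{\eta^{-1}t_*<t<\eta t_*\}$. Integrals over $\mathcal{R}^\sigma_\gamma(t_* )$ are with respect to Lebesgue measure on $\mathbb{R}^{n+1}$; integrals over $\mathcal{K}^\sigma_\eta(t_* )$ are with respect to the hypersurface measure induced by the Minkowski metric (a constant multiple, depending on $\sigma$, of the Euclidean surface measure). The constants $\alpha_0,\gamma,K$ may depend on $n,p,\sigma,\eta,C$. *)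

theory Defs
  imports "HOL-Analysis.Analysis"
begin

text \<open>
  Space-time is \<open>real \<times> (real ^ 'n)\<close>, a point being \<open>(t, x)\<close>; the space dimension \<open>n\<close> is \<open>CARD('n)\<close>.
\<close>

definition max_exponent :: "nat \<Rightarrow> ereal" where
  "max_exponent n =
     (if n = 1 then \<infinity>
      else if n = 2 then ereal (1 + 4 / (real n - 1))
      else ereal (1 + 4 * real n / ((real n)\<^sup>2 + real n - 4)))"


definition cone :: "real \<Rightarrow> (real \<times> (real ^ 'n)) set" where
  "cone \<sigma> = {(t, x). norm x < \<sigma> * t}"

definition cone_boundary :: "real \<Rightarrow> (real \<times> (real ^ 'n)) set" where
  "cone_boundary \<sigma> = {(t, x). norm x = \<sigma> * t}"

definition cone_region :: "real \<Rightarrow> real \<Rightarrow> real \<Rightarrow> (real \<times> (real ^ 'n)) set" where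
  "cone_region \<sigma> \<gamma> tstar = {(t, x). inverse \<gamma> * tstar < t \<and> t < \<gamma> * tstar} \<inter> cone \<sigma>"

definition cone_shell :: "real \<Rightarrow> real \<Rightarrow> real \<Rightarrow> (real \<times> (real ^ 'n)) set" where
  "cone_shell \<sigma> \<eta> tstar = cone_boundary \<sigma> \<inter> {(t, x). inverse \<eta> * tstar < t \<and> t < \<eta> * tstar}"


text \<open>
  All derivatives are taken within a set \<open>S\<close>, so that they make sense up to the boundary. In the
  theorem \<open>S\<close> is the closure of a truncated cone, i.e. a convex set with nonempty interior; there the
  derivative within \<open>S\<close> is unique at every point of \<open>S\<close>, and \<open>C1_on\<close> and \<open>C2_on\<close> amount to the
  derivatives in the interior existing and extending continuously to \<open>S\<close>.
\<close>

definition dderiv ::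
  "'a::euclidean_space set \<Rightarrow> 'a \<Rightarrow> ('a \<Rightarrow> real) \<Rightarrow> 'a \<Rightarrow> real" where
  "dderiv S v f z = frechet_derivative f (at z within S) v"

definition C1_on :: "'a::euclidean_space set \<Rightarrow> ('a \<Rightarrow> real) \<Rightarrow> bool" where
  "C1_on S f \<longleftrightarrow> f differentiable_on S \<and> (\<forall>v. continuous_on S (dderiv S v f))"

definition C2_on :: "'a::euclidean_space set \<Rightarrow> ('a \<Rightarrow> real) \<Rightarrow> bool" where
  "C2_on S f \<longleftrightarrow> C1_on S f \<and> (\<forall>v. C1_on S (dderiv S v f))"

definition dt ::
  "(real \<times> (real ^ 'n)) set \<Rightarrow> (real \<times> (real ^ 'n) \<Rightarrow> real) \<Rightarrow> real \<times> (real ^ 'n) \<Rightarrow> real" where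
  "dt S = dderiv S (1, 0)"

definition dx ::
  "(real \<times> (real ^ 'n)) set \<Rightarrow> 'n \<Rightarrow> (real \<times> (real ^ 'n) \<Rightarrow> real) \<Rightarrow> real \<times> (real ^ 'n) \<Rightarrow> real" where
  "dx S i = dderiv S (0, axis i 1)"

definition grad_norm ::
  "(real \<times> (real ^ 'n)) set \<Rightarrow> (real \<times> (real ^ 'n) \<Rightarrow> real) \<Rightarrow> real \<times> (real ^ 'n) \<Rightarrow> real" where
  "grad_norm S f z = sqrt ((dt S f z)\<^sup>2 + (\<Sum>i\<in>UNIV. (dx S i f z)\<^sup>2))"

definition wave_op ::
  "(real \<times> (real ^ 'n)) set \<Rightarrow> (real \<times> (real ^ 'n) \<Rightarrow> real) \<Rightarrow> real \<times> (real ^ 'n) \<Rightarrow> real" where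
  "wave_op S f z = - dt S (dt S f) z + (\<Sum>i\<in>UNIV. dx S i (dx S i f) z)"


definition minkowski :: "real \<times> (real ^ 'n) \<Rightarrow> real \<times> (real ^ 'n) \<Rightarrow> real" where
  "minkowski u v = - (fst u * fst v) + snd u \<bullet> snd v"

text \<open>
  For an immersion \<open>F\<close> of an open set of \<open>real ^ 'n\<close> into space-time, \<open>induced_metric F x\<close> is the matrix
  of the pull-back of the Minkowski metric at \<open>x\<close>. If \<open>F\<close> is injective on \<open>U\<close>, then
  \<open>induced_measure F U\<close> is the induced hypersurface measure on \<open>F ` U\<close>, with volume density
  \<open>sqrt \<bar>det g\<bar>\<close> in the coordinates \<open>x\<close>, viewed as a measure on space-time.
\<close>

definition induced_metric ::
  "(real ^ 'n \<Rightarrow> real \<times> (real ^ 'n)) \<Rightarrow> real ^ 'n \<Rightarrow> real ^ 'n ^ 'n" where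
  "induced_metric F x =
     (\<chi> i j. minkowski (frechet_derivative F (at x) (axis i 1))
                       (frechet_derivative F (at x) (axis j 1)))"

definition induced_measure ::
  "(real ^ 'n \<Rightarrow> real \<times> (real ^ 'n)) \<Rightarrow> (real ^ 'n) set \<Rightarrow> (real \<times> (real ^ 'n)) measure" where
  "induced_measure F U =
     distr (density lborel (\<lambda>x. ennreal (sqrt \<bar>det (induced_metric F x)\<bar>) * indicator U x)) borel F"

text \<open>
  The boundary of the cone without its vertex is parametrised globally as the graph of
  \<open>t = norm x / \<sigma>\<close> over the punctured space.
\<close>

definition cone_measure :: "real \<Rightarrow> (real \<times> (real ^ 'n)) measure" where
  "cone_measure \<sigma> = induced_measure (\<lambda>x. (norm x / \<sigma>, x)) (- {0})"

end

theory Submission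
  imports Defs
begin

text \<open>
  The proof is a multiplier argument centred at a point \<open>(T, x0)\<close> outside the cone, with
  \<open>\<sigma> * T < norm x0 < T\<close> and \<open>T\<close> the time \<open>t\<^sub>*\<close>. Let \<open>q = (norm (x - x0))^2 - (t - T)^2\<close> and
  let \<open>Z\<close> be the scaling field of that point. The part of the cone where \<open>q > 0\<close> is bounded in time,
  contains the region over which \<open>\<phi>\<close> is to be estimated, and is bounded by a piece of the lateral
  boundary and a piece of the null cone \<open>q = 0\<close>. Multiplying the equation by
  \<open>q powr b * (Z \<phi> + c * \<phi>)\<close> with \<open>c = (n - 1) / 2 + b\<close> produces a current whose divergence is
  \<open>2 * b * q powr (b - 1) * (Z \<phi> + c * \<phi>)^2 + \<kappa> * q powr b * V * \<bar>\<phi>\<bar> powr (p + 1)\<close> up to a term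
  containing \<open>Z V\<close>, and \<open>\<kappa> > 0\<close> for small \<open>b > 0\<close> as soon as \<open>p < 1 + 4 / (n - 1)\<close>. Nothing is lost
  on the null cone, where the weight vanishes. On the lateral boundary the only term that is not
  bounded pointwise by the right-hand side is \<open>q powr (b - 1) * \<phi>^2\<close>; a Hardy type inequality controls
  it, since the timelike lateral boundary is transversal to the null cone. As \<open>q powr b\<close> is not smooth
  at \<open>q = 0\<close>, it is replaced by \<open>q powr (b + 2) / (q + e)^2\<close>, and \<open>e\<close> tends to 0 at the end.
\<close>

section \<open>The divergence theorem on a cone\<close>

text \<open>The estimate may use data on the lateral boundary only, so no term on a time slice is
  allowed, and this dictates the apex. As \<open>norm x0 < T\<close>, the vertex of the cone lies in
  the timelike past of the apex and has \<open>q < 0\<close>; as \<sigma> < 1, the far future of the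
  cone has \<open>q < 0\<close> too; as \<open>norm x0 > \<sigma> * T\<close>, the whole slice of
  the cone at time \<open>T\<close> has \<open>q > 0\<close>. The scaling field is conformally
  Killing. The zeroth order coefficient \<open>c\<close> is chosen to cancel the multiple of the
  gradient Lagrangian that its deformation leaves behind; of the quadratic terms only a perfect
  square survives. The exponent \<open>b\<close> must be positive for the weight to vanish on the
  null cone, but \<open>\<kappa>\<close> equals
  \<open>(n + 1) / (p + 1) - (n - 1) / 2 - b * (1 - 2 / (p + 1))\<close>, so \<open>b\<close> has to
  be small. Then \<open>q powr (b - 1)\<close> is in general unbounded near the null cone, which is
  the source of the difficulty on the boundary and of the need to regularise.\<close>

lemma lborel_integral_translate:
  fixes h :: "'a::euclidean_space \<Rightarrow> real"
  assumes "h \<in> borel_measurable borel"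
  shows "(LINT z|lborel. h (z + v)) = (LINT z|lborel. h z)"
proof -
  have "(LINT z|lborel. h z) = (LINT z|distr lborel borel ((+) v). h z)" by (simp add: lborel_distr_plus)
  also have "\<dots> = (LINT z|lborel. h (v + z))" using assms by (subst integral_distr) auto
  finally show ?thesis by (simp add: add.commute)
qed

lemma integrable_bounded_support:
  fixes h :: "'a::euclidean_space \<Rightarrow> real"
  assumes [measurable]: "h \<in> borel_measurable borel"
    and b: "\<And>z. \<bar>h z\<bar> \<le> B" and s: "\<And>z. norm z > R \<Longrightarrow> h z = 0"
  shows "integrable lborel h"
proof (rule Bochner_Integration.integrable_bound)
  show "integrable lborel (\<lambda>z. B * indicator (cball 0 R) z :: real)"
    by (intro integrable_mult_right integrable_real_indicator)
       (auto simp: emeasure_lborel_cball_finite[simplified])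
  show "AE z in lborel. norm (h z) \<le> norm (B * indicator (cball 0 R) z :: real)"
    using b s by (auto simp: indicator_def abs_le_iff not_le intro!: AE_I2 order_trans[OF _ abs_ge_self])
qed auto

text \<open>Derivatives are nowhere assumed to be measurable; measurability comes from writing them
  as limits of countably many difference quotients.\<close>

lemma difference_quotient_LIMSEQ:
  fixes f :: "real \<Rightarrow> real"
  assumes "(f has_real_derivative d) (at x)"
  shows "(\<lambda>k. (f (x + inverse (real (Suc k))) - f x) / inverse (real (Suc k))) \<longlonglongrightarrow> d"
proof -
  have "filterlim (\<lambda>k. inverse (real (Suc k))) (at 0) sequentially"
    using LIMSEQ_inverse_real_of_nat by (auto simp: filterlim_at)
  then show ?thesis using assms unfolding DERIV_def by (rule filterlim_compose[rotated])
qed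

text \<open>The integral of a difference quotient vanishes by translation invariance of Lebesgue measure.\<close>
lemma integral_directional_derivative_eq_0:
  fixes h h' :: "'a::euclidean_space \<Rightarrow> real"
  assumes hm[measurable]: "h \<in> borel_measurable borel"
    and supp: "\<And>z. norm z > R \<Longrightarrow> h z = 0" and v: "v \<noteq> 0"
    and lip: "\<And>z r. \<bar>h (z + r *\<^sub>R v) - h z\<bar> \<le> L * \<bar>r\<bar>"
    and N: "N \<in> null_sets lborel"
    and der: "\<And>z. z \<notin> N \<Longrightarrow> ((\<lambda>r. h (z + r *\<^sub>R v)) has_real_derivative h' z) (at 0)"
  shows "integrable lborel (\<lambda>z. indicator (- N) z * h' z)"
    and "(LINT z|lborel. indicator (- N) z * h' z) = 0"
proof -
  define r where "r k = inverse (real (Suc k))" for k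
  define d where "d k z = (h (z + r k *\<^sub>R v) - h z) / r k" for k z
  have r: "0 < r k" "r k \<le> 1" for k by (auto simp: r_def field_simps)
  have L0: "0 \<le> L" using lip[of 0 1] by auto
  \<comment> \<open>A step \<open>s *\<^sub>R v\<close> from any point of the ball of radius
    \<open>R\<close> leaves that ball, so the Lipschitz bound along \<open>v\<close> also bounds
    \<open>h\<close> itself.\<close>
  define s where "s = (2 * \<bar>R\<bar> + 1) / norm v"
  have bd: "\<bar>h z\<bar> \<le> L * \<bar>s\<bar>" for z
  proof (cases "norm z > R")
    case False
    have "norm (s *\<^sub>R v) = 2 * \<bar>R\<bar> + 1" using v by (simp add: s_def)
    then have "norm (z + s *\<^sub>R v) > R" using norm_triangle_ineq4[of "z + s *\<^sub>R v" z] False by simp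
    then show ?thesis using lip[of z s] supp by simp
  qed (use supp L0 in simp)
  have inth: "integrable lborel h" by (rule integrable_bounded_support[OF hm bd supp])
  have htm[measurable]: "(\<lambda>z. h (z + u)) \<in> borel_measurable borel" for u
    by (rule measurable_compose[OF _ hm]) auto
  have inth2: "integrable lborel (\<lambda>z. h (z + u))" for u
  proof (rule integrable_bounded_support[OF htm bd])
    fix z :: 'a assume "norm z > R + norm u"
    moreover have "norm z \<le> norm (z + u) + norm u" by (metis add_diff_cancel_right' norm_triangle_ineq4)
    ultimately show "h (z + u) = 0" by (intro supp) auto
  qed
  have dint: "integrable lborel (d k)" for k
    unfolding d_def by (intro integrable_divide Bochner_Integration.integrable_diff inth inth2)
  have d0: "(LINT z|lborel. d k z) = 0" for k
    unfolding d_def by (simp add: inth inth2 lborel_integral_translate[OF hm])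
  have dm[measurable]: "d k \<in> borel_measurable borel" for k using dint[of k] by simp
  have Nm[measurable]: "N \<in> sets borel" using N by (auto simp: null_sets_def)
  have dlim: "(\<lambda>k. d k z) \<longlonglongrightarrow> h' z" if "z \<notin> N" for z
    using difference_quotient_LIMSEQ[OF der[OF that]] by (simp add: d_def r_def)
  have lim: "(\<lambda>k. indicator (-N) z * d k z) \<longlonglongrightarrow> indicator (-N) z * h' z" for z
    using dlim[of z] by (auto simp: indicator_def)
  have meas: "(\<lambda>z. indicator (-N) z * h' z) \<in> borel_measurable lborel"
    by (rule borel_measurable_LIMSEQ_real[OF lim]) measurable
  have bnd: "AE z in lborel. norm (indicator (-N) z * d k z) \<le> L * indicator (cball 0 (R + norm v)) z" for k
  proof (rule AE_I2)
    fix z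
    show "norm (indicator (-N) z * d k z) \<le> L * indicator (cball 0 (R + norm v)) z"
    proof (cases "norm z \<le> R + norm v")
      case True
      have "\<bar>d k z\<bar> \<le> L" using lip[of z "r k"] r(1)[of k] unfolding d_def by (simp add: divide_le_eq)
      then show ?thesis using True L0 by (auto simp: indicator_def)
    next
      case False
      have "norm z \<le> norm (z + r k *\<^sub>R v) + r k * norm v"
        using norm_triangle_ineq4[of "z + r k *\<^sub>R v" "r k *\<^sub>R v"] r[of k] by simp
      moreover have "r k * norm v \<le> norm v" using r[of k] by (simp add: mult_left_le_one_le)
      ultimately have "norm (z + r k *\<^sub>R v) > R" using False by simp
      moreover have "norm z > R" using False by (smt (verit) norm_ge_zero)
      ultimately have "d k z = 0" unfolding d_def using supp by simp
      then show ?thesis using L0 by (auto simp: indicator_def)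
    qed
  qed
  have wint: "integrable lborel (\<lambda>z::'a. L * indicator (cball 0 (R + norm v)) z :: real)"
    by (intro integrable_mult_right integrable_real_indicator) (auto simp: emeasure_lborel_cball_finite[simplified])
  have m1: "(\<lambda>z. indicator (-N) z * d k z) \<in> borel_measurable lborel" for k by measurable
  show "integrable lborel (\<lambda>z. indicator (- N) z * h' z)"
    by (rule integrable_dominated_convergence[OF meas m1 wint AE_I2[OF lim] bnd])
  have "(\<lambda>k. LINT z|lborel. indicator (-N) z * d k z) \<longlonglongrightarrow> (LINT z|lborel. indicator (- N) z * h' z)"
    by (rule integral_dominated_convergence[OF meas m1 wint AE_I2[OF lim] bnd])
  moreover have "(LINT z|lborel. indicator (-N) z * d k z) = (LINT z|lborel. d k z)" for k
  proof (rule integral_cong_AE)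
    show "AE z in lborel. indicator (-N) z * d k z = d k z"
      using AE_not_in[OF N] by eventually_elim auto
  qed auto
  ultimately show "(LINT z|lborel. indicator (- N) z * h' z) = 0"
    using d0 LIMSEQ_unique[OF _ tendsto_const] by fastforce
qed

text \<open>For fixed \<open>x\<close> the shear is a translation in time, so Tonelli reduces the
  claim to translation invariance on the line.\<close>

lemma distr_shear_lborel:
  fixes g :: "'a::euclidean_space \<Rightarrow> real"
  assumes g[measurable]: "g \<in> borel_measurable borel"
  shows "distr lborel borel (\<lambda>z. (fst z + g (snd z), snd z)) = lborel"
proof (rule measure_eqI)
  let ?s = "\<lambda>z::real \<times> 'a. (fst z + g (snd z), snd z)"
  have "?s \<in> borel \<Otimes>\<^sub>M borel \<rightarrow>\<^sub>M borel \<Otimes>\<^sub>M borel" by measurable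
  then have sm: "?s \<in> borel_measurable borel" by (simp add: borel_prod)
  then have sm'[measurable]: "?s \<in> measurable (lborel \<Otimes>\<^sub>M lborel) (lborel \<Otimes>\<^sub>M lborel)"
    by (simp add: lborel_prod)
  fix A assume "A \<in> sets (distr lborel borel ?s)"
  then have A: "A \<in> sets borel" by simp
  then have Am[measurable]: "A \<in> sets (lborel \<Otimes>\<^sub>M lborel)" by (simp only: lborel_prod sets_lborel)
  have "emeasure (distr lborel borel ?s) A = (\<integral>\<^sup>+ z. indicator A z \<partial>distr lborel borel ?s)"
    using A by simp
  also have "\<dots> = (\<integral>\<^sup>+ z. indicator A (?s z) \<partial>lborel)"
    using A sm by (subst nn_integral_distr) auto
  also have "\<dots> = (\<integral>\<^sup>+ z. indicator A (?s z) \<partial>(lborel \<Otimes>\<^sub>M lborel))"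
    by (simp add: lborel_prod)
  also have "\<dots> = (\<integral>\<^sup>+ x. (\<integral>\<^sup>+ t. indicator A (t + g x, x) \<partial>lborel) \<partial>lborel)"
    by (subst lborel_pair.nn_integral_snd[symmetric]) auto
  also have "\<dots> = (\<integral>\<^sup>+ x. (\<integral>\<^sup>+ t. indicator A (t, x) \<partial>lborel) \<partial>lborel)"
  proof (rule nn_integral_cong)
    fix x
    show "(\<integral>\<^sup>+ t. indicator A (t + g x, x) \<partial>lborel) = (\<integral>\<^sup>+ t. indicator A (t, x) \<partial>lborel)"
      using nn_integral_real_affine[of "\<lambda>t. indicator A (t, x)" 1 "g x"] by (simp add: add.commute)
  qed
  also have "\<dots> = (\<integral>\<^sup>+ z. indicator A z \<partial>(lborel \<Otimes>\<^sub>M lborel))"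
    by (subst lborel_pair.nn_integral_snd[symmetric]) auto
  also have "\<dots> = emeasure lborel A" using A by (simp add: lborel_prod)
  finally show "emeasure (distr lborel borel ?s) A = emeasure lborel A" .
qed simp

text \<open>Fubini and the fundamental theorem of calculus in \<open>s\<close>. Forward difference
  quotients stay inside the half-space, so they give both the measurability of \<open>w'\<close> and
  its bound by \<open>L\<close> without any regularity of \<open>w'\<close>.\<close>

lemma integral_halfspace_derivative:
  fixes w w' :: "real \<times> 'a::euclidean_space \<Rightarrow> real"
  assumes wm[measurable]: "w \<in> borel_measurable borel"
    and lip: "\<And>s s' x. 0 \<le> s \<Longrightarrow> 0 \<le> s' \<Longrightarrow> \<bar>w (s, x) - w (s', x)\<bar> \<le> L * \<bar>s - s'\<bar>"
    and supp: "\<And>s x. 0 \<le> s \<Longrightarrow> norm (s, x) > R \<Longrightarrow> w (s, x) = 0"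
    and der: "\<And>s x. 0 < s \<Longrightarrow> ((\<lambda>s. w (s, x)) has_real_derivative w' (s, x)) (at s)"
  shows "integrable lborel (\<lambda>z. indicator {0<..} (fst z) * w' z)"
    and "(LINT z|lborel. indicator {0<..} (fst z) * w' z) = - (LINT x|lborel. w (0, x))"
proof -
  define r where "r k = inverse (real (Suc k))" for k
  define f where "f z = indicator {0<..} (fst z) * w' z" for z :: "real \<times> 'a"
  have r: "0 < r k" for k by (auto simp: r_def)
  have lim: "(\<lambda>k. indicator {0<..} (fst z) * ((w (fst z + r k, snd z) - w z) / r k)) \<longlonglongrightarrow> f z" for z
  proof (cases "0 < fst z")
    case True
    from difference_quotient_LIMSEQ[OF der[OF True, of "snd z"]]
    have "(\<lambda>k. (w (fst z + r k, snd z) - w (fst z, snd z)) / r k) \<longlonglongrightarrow> w' (fst z, snd z)"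
      by (simp add: r_def)
    then show ?thesis using True by (simp add: f_def)
  qed (simp add: f_def)
  have fm[measurable]: "f \<in> borel_measurable borel"
  proof (rule borel_measurable_LIMSEQ_real[OF lim])
    fix k
    have "(\<lambda>z::real \<times> 'a. (fst z + r k, snd z)) \<in> borel_measurable borel"
      by (intro borel_measurable_continuous_onI continuous_intros)
    from measurable_compose[OF this wm]
    have [measurable]: "(\<lambda>z. w (fst z + r k, snd z)) \<in> borel_measurable borel" .
    have [measurable]: "(fst :: real \<times> 'a \<Rightarrow> real) \<in> borel_measurable borel"
      by (intro borel_measurable_continuous_onI continuous_intros)
    show "(\<lambda>z. indicator {0<..} (fst z) * ((w (fst z + r k, snd z) - w z) / r k)) \<in> borel_measurable borel"
      by measurable
  qed
  have L0: "0 \<le> L" using lip[of 0 1 undefined] by auto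
  have fb: "\<bar>f z\<bar> \<le> L" for z
  proof (rule LIMSEQ_le_const2[OF tendsto_rabs[OF lim]], rule exI[of _ 0], intro allI impI)
    fix k
    have "\<bar>w (fst z + r k, snd z) - w z\<bar> \<le> L * r k" if "0 < fst z"
      using lip[of "fst z + r k" "fst z" "snd z"] r[of k] that by simp
    then show "\<bar>indicator {0<..} (fst z) * ((w (fst z + r k, snd z) - w z) / r k)\<bar> \<le> L"
      using r[of k] L0 by (auto simp: indicator_def abs_mult divide_le_eq)
  qed
  have f0: "f z = 0" if "norm z > R" for z
  proof (cases "0 < fst z")
    case True
    have ev: "\<forall>\<^sub>F s in nhds (fst z). 0 < s \<and> R < norm (s, snd z)"
    proof (intro eventually_conj)
      show "\<forall>\<^sub>F s in nhds (fst z). 0 < s"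
        using eventually_nhds_in_open[of "{0<..}" "fst z"] True by simp
      have "open ((\<lambda>s. norm (s, snd z)) -` {R<..})"
        by (intro open_vimage continuous_intros open_greaterThan)
      from eventually_nhds_in_open[OF this, of "fst z"]
      show "\<forall>\<^sub>F s in nhds (fst z). R < norm (s, snd z)" using that by simp
    qed
    then have "\<forall>\<^sub>F s in nhds (fst z). w (s, snd z) = 0"
      by eventually_elim (auto intro: supp)
    then have "((\<lambda>s. w (s, snd z)) has_real_derivative 0) (at (fst z))"
      by (simp add: DERIV_cong_ev[OF refl _ refl])
    with der[OF True, of "snd z"] have "w' z = 0" by (simp add: DERIV_unique)
    then show ?thesis by (simp add: f_def)
  qed (simp add: f_def)
  show int: "integrable lborel (\<lambda>z. indicator {0<..} (fst z) * w' z)"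
    using integrable_bounded_support[OF fm fb f0] by (simp add: f_def)
  have intf: "integrable (lborel \<Otimes>\<^sub>M lborel) f" using int by (simp add: f_def[abs_def] lborel_prod)
  have sec: "(LINT s|lborel. f (s, x)) = - w (0, x)" for x
  proof -
    define b where "b = \<bar>R\<bar> + 1"
    have b: "0 \<le> b" "norm (s, x) > R" if "b \<le> \<bar>s\<bar>" for s
      using that norm_fst_le[of s x] by (auto simp: b_def)
    have b0: "0 \<le> b" by (simp add: b_def)
    have m: "(\<lambda>s. f (s, x)) \<in> borel_measurable borel"
      by (rule measurable_compose[OF _ fm]) (intro borel_measurable_continuous_onI continuous_intros)
    have "integrable lborel (\<lambda>s. f (s, x))"
      by (rule integrable_bounded_support[OF m fb, of b]) (auto intro!: f0 b)
    then have 1: "((\<lambda>s. f (s, x)) has_integral (LINT s|lborel. f (s, x))) UNIV"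
      by (rule has_integral_integral_lborel)
    have "((\<lambda>s. w' (s, x)) has_integral (w (b, x) - w (0, x))) {0..b}"
    proof (rule fundamental_theorem_of_calculus_interior)
      have "L-lipschitz_on {0..b} (\<lambda>s. w (s, x))"
        using L0 lip by (intro lipschitz_onI) (auto simp: dist_real_def)
      then show "continuous_on {0..b} (\<lambda>s. w (s, x))" by (rule lipschitz_on_continuous_on)
    qed (use der b0 in \<open>auto simp: has_real_derivative_iff_has_vector_derivative[symmetric]\<close>)
    then have "((\<lambda>s. f (s, x)) has_integral (w (b, x) - w (0, x))) {0..b}"
      by (rule has_integral_spike[where S="{0}", rotated 2]) (auto simp: f_def)
    then have "((\<lambda>s. f (s, x)) has_integral (w (b, x) - w (0, x))) UNIV"
    proof (rule has_integral_on_superset)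
      fix s assume "s \<notin> {0..b}"
      then show "f (s, x) = 0"
        using f0[OF b(2), of s] by (cases "s < 0") (auto simp: f_def)
    qed auto
    moreover have "w (b, x) = 0" using b(2)[of b] b0 by (intro supp) auto
    ultimately show ?thesis using has_integral_unique[OF 1] by simp
  qed
  have "(LINT z|lborel. f z) = (LINT z|(lborel \<Otimes>\<^sub>M lborel). f z)" by (simp add: lborel_prod)
  also have "\<dots> = (LINT x|lborel. LINT s|lborel. f (s, x))"
    using lborel_pair.integral_snd[of "\<lambda>s x. f (s, x)"] intf by simp
  also have "\<dots> = - (LINT x|lborel. w (0, x))" by (simp add: sec)
  finally show "(LINT z|lborel. indicator {0<..} (fst z) * w' z) = - (LINT x|lborel. w (0, x))"
    by (simp add: f_def)
qed

text \<open>Serves to show that a divergence is measurable when its derivatives are only known to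
  exist.\<close>

lemma borel_measurable_directional_derivative:
  fixes h :: "'a::euclidean_space \<Rightarrow> real"
  assumes hm: "h \<in> borel_measurable borel" and C: "open C"
    and d: "\<And>z. z \<in> C \<Longrightarrow> (h has_derivative D z) (at z)"
  shows "(\<lambda>z. indicator C z * D z v) \<in> borel_measurable borel"
proof -
  define r where "r k = inverse (real (Suc k))" for k
  have r: "0 < r k" for k by (auto simp: r_def)
  have [measurable]: "C \<in> sets borel" using C by simp
  show ?thesis
  proof (rule borel_measurable_LIMSEQ_real)
    fix k
    have "(\<lambda>z. h (z + r k *\<^sub>R v)) \<in> borel_measurable borel"
      by (rule measurable_compose[OF _ hm]) auto
    then show "(\<lambda>z. indicator C z * ((h (z + r k *\<^sub>R v) - h z) / r k)) \<in> borel_measurable borel"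
      using hm by measurable
  next
    fix z
    show "(\<lambda>k. indicator C z * ((h (z + r k *\<^sub>R v) - h z) / r k)) \<longlonglongrightarrow> indicator C z * D z v"
    proof (cases "z \<in> C")
      case True
      have "((\<lambda>s. h (z + s *\<^sub>R v)) has_derivative (\<lambda>s. D z (s *\<^sub>R v))) (at 0)"
        by (rule has_derivative_compose[of "\<lambda>s. z + s *\<^sub>R v" "\<lambda>s. s *\<^sub>R v" 0 UNIV h])
           (use d[OF True] in \<open>auto intro!: derivative_eq_intros\<close>)
      then have "((\<lambda>s. h (z + s *\<^sub>R v)) has_real_derivative D z v) (at 0)"
        using linear_cmul[OF has_derivative_linear[OF d[OF True]]]
        by (simp add: has_field_derivative_def mult.commute[of _ "D z v"])
      then have "(\<lambda>k. (h (z + r k *\<^sub>R v) - h z) / r k) \<longlonglongrightarrow> D z v"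
        using difference_quotient_LIMSEQ by (fastforce simp: r_def)
      then show ?thesis using True by simp
    qed simp
  qed
qed

lemma norm_has_derivative_sgn:
  fixes x :: "'a::real_inner"
  assumes "x \<noteq> 0"
  shows "(norm has_derivative (\<lambda>h. h \<bullet> sgn x)) (at x)"
  using has_derivative_norm[OF assms] by simp

text \<open>The shear \<open>s = t - norm x / \<sigma>\<close> flattens the lateral boundary to
  \<open>s = 0\<close> and preserves Lebesgue measure, so the flux appears directly as an integral
  over the graph parameter \<open>x\<close>. The fields need only be Lipschitz up to the boundary,
  which is all that a weight vanishing on the null cone and a \<phi> that is twice differentiable up
  to the boundary provide.\<close>

theorem cone_divergence:
  fixes W0 :: "real \<times> (real ^ 'n::finite) \<Rightarrow> real" and W :: "real \<times> (real ^ 'n) \<Rightarrow> real ^ 'n"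
  assumes \<sigma>: "0 < \<sigma>"
    and l0: "L0-lipschitz_on {(t, x). norm x \<le> \<sigma> * t} W0"
    and l1: "L1-lipschitz_on {(t, x). norm x \<le> \<sigma> * t} W"
    and supp: "\<And>t x. norm x \<le> \<sigma> * t \<Longrightarrow> R \<le> t \<Longrightarrow> W0 (t, x) = 0 \<and> W (t, x) = 0"
    and d0: "\<And>z. z \<in> cone \<sigma> \<Longrightarrow> (W0 has_derivative D0 z) (at z)"
    and d1: "\<And>z. z \<in> cone \<sigma> \<Longrightarrow> (W has_derivative D1 z) (at z)"
    and dv: "\<And>z. z \<in> cone \<sigma> \<Longrightarrow> dv z = D0 z (1, 0) + (\<Sum>i\<in>UNIV. D1 z (0, axis i 1) $ i)"
  shows "set_integrable lborel (cone \<sigma>) dv"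
    and "(LINT z:cone \<sigma>|lborel. dv z)
      = (LINT x|lborel. (W (norm x / \<sigma>, x) \<bullet> sgn x) / \<sigma> - W0 (norm x / \<sigma>, x))"
proof -
  let ?K = "{(t, x). norm x \<le> \<sigma> * t} :: (real \<times> (real ^ 'n)) set"
  define sh :: "real \<times> (real ^ 'n) \<Rightarrow> real \<times> (real ^ 'n)"
    where "sh z = (fst z + norm (snd z) / \<sigma>, snd z)" for z
  define H :: "(real \<times> (real ^ 'n)) set" where "H = {z. 0 < fst z}"
  have shK: "sh (s, x) \<in> ?K" if "0 \<le> s" for s x
    using that \<sigma> by (simp add: sh_def distrib_left)
  have shK': "sh z \<in> ?K" if "0 \<le> fst z" for z
    using shK[OF that, of "snd z"] by simp
  have shC: "sh (s, x) \<in> cone \<sigma>" if "0 < s" for s x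
    using that \<sigma> by (simp add: sh_def cone_def distrib_left)
  have shC': "sh z \<in> cone \<sigma> \<longleftrightarrow> z \<in> H" for z
    using \<sigma> by (auto simp: sh_def cone_def distrib_left H_def zero_less_mult_iff)
  have shcont: "continuous_on A sh" for A unfolding sh_def using \<sigma> by (intro continuous_intros) auto
  have shlip: "norm (sh (s, x) - sh (s', y)) \<le> \<bar>s - s'\<bar> + (1 / \<sigma> + 1) * norm (x - y)" for s s' x y
  proof -
    have "\<bar>norm x / \<sigma> - norm y / \<sigma>\<bar> \<le> norm (x - y) / \<sigma>"
      using \<sigma> norm_triangle_ineq3[of x y] by (simp add: diff_divide_distrib[symmetric] divide_right_mono)
    moreover have "norm (sh (s, x) - sh (s', y)) \<le> \<bar>s + norm x / \<sigma> - (s' + norm y / \<sigma>)\<bar> + norm (x - y)"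
      using norm_Pair_le[of "s + norm x / \<sigma> - (s' + norm y / \<sigma>)" "x - y"] by (simp add: sh_def)
    ultimately show ?thesis by (simp add: distrib_right)
  qed
  define R' where "R' = (1 + \<sigma>) * \<bar>R\<bar>"
  have supp': "W0 (sh (s, x)) = 0 \<and> W (sh (s, x)) = 0" if "0 \<le> s" "norm (s, x) > R'" for s x
  proof -
    have "norm (s, x) \<le> s + norm x" using norm_Pair_le[of s x] that by simp
    also have "\<dots> \<le> (1 + \<sigma>) * (s + norm x / \<sigma>)" using \<sigma> that by (simp add: field_simps)
    finally have "(1 + \<sigma>) * \<bar>R\<bar> < (1 + \<sigma>) * (s + norm x / \<sigma>)" using that by (simp add: R'_def)
    then have "\<bar>R\<bar> < s + norm x / \<sigma>" using \<sigma> by simp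
    then show ?thesis using shK[OF that(1), of x] by (simp add: sh_def supp)
  qed
  have L0: "0 \<le> L0" "0 \<le> L1" using l0 l1 lipschitz_on_nonneg by auto
  have lip: "norm (f (sh (s, x)) - f (sh (s', y))) \<le> L * (\<bar>s - s'\<bar> + (1 / \<sigma> + 1) * norm (x - y))"
    if f: "L-lipschitz_on ?K f" and s: "0 \<le> s" "0 \<le> s'"
    for f :: "_ \<Rightarrow> 'c::real_normed_vector" and L s s' x y
  proof -
    have "norm (f (sh (s, x)) - f (sh (s', y))) \<le> L * norm (sh (s, x) - sh (s', y))"
      using lipschitz_onD[OF f shK[OF s(1)] shK[OF s(2)]] by (simp add: dist_norm)
    also have "\<dots> \<le> L * (\<bar>s - s'\<bar> + (1 / \<sigma> + 1) * norm (x - y))"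
      using shlip lipschitz_on_nonneg[OF f] by (intro mult_left_mono)
    finally show ?thesis .
  qed
  note lipW = lip[OF l1] and lipW0 = lip[OF l0]
  have Wcont: "continuous_on {z. 0 \<le> fst z} (\<lambda>z. W (sh z))"
    by (rule continuous_on_compose2[OF lipschitz_on_continuous_on[OF l1] shcont]) (rule image_subsetI, rule shK', simp)
  have W0cont: "continuous_on {z. 0 \<le> fst z} (\<lambda>z. W0 (sh z))"
    by (rule continuous_on_compose2[OF lipschitz_on_continuous_on[OF l0] shcont]) (rule image_subsetI, rule shK', simp)
  have Hm: "H \<in> sets borel" unfolding H_def by (intro borel_open open_Collect_less continuous_intros)
  have Hc: "{z::real \<times> (real ^ 'n). 0 \<le> fst z} \<in> sets borel"
    by (intro borel_closed closed_Collect_le continuous_intros)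
  \<comment> \<open>The time axis, where the norm in the shear is not differentiable.\<close>
  define N :: "(real \<times> (real ^ 'n)) set" where "N = UNIV \<times> {0}"
  have N: "N \<in> null_sets lborel"
  proof -
    have "emeasure (lborel \<Otimes>\<^sub>M lborel) N = 0"
      unfolding N_def by (subst lborel.emeasure_pair_measure_Times) auto
    moreover have "N \<in> sets borel" unfolding N_def by (intro borel_closed closed_Times) auto
    ultimately show ?thesis by (auto simp: null_sets_def lborel_prod)
  qed
  have dsh: "((\<lambda>r. sh (s, x + r *\<^sub>R v)) has_derivative (\<lambda>r. r *\<^sub>R (v \<bullet> sgn x / \<sigma>, v))) (at 0)"
    if "x \<noteq> 0" for s x v
  proof -
    have "((\<lambda>r. norm (x + r *\<^sub>R v)) has_derivative (\<lambda>r. (r *\<^sub>R v) \<bullet> sgn x)) (at 0)"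
      by (rule has_derivative_compose[of "\<lambda>r. x + r *\<^sub>R v" "\<lambda>r. r *\<^sub>R v" 0 UNIV norm])
         (use norm_has_derivative_sgn[OF that] in \<open>auto intro!: derivative_eq_intros\<close>)
    then show ?thesis unfolding sh_def using \<sigma> by (auto intro!: derivative_eq_intros)
  qed
  have dsh0: "((\<lambda>s. sh (s, x)) has_derivative (\<lambda>r. r *\<^sub>R (1, 0))) (at s)" for s x
    unfolding sh_def using \<sigma> by (auto intro!: derivative_eq_intros)

  text \<open>In the coordinate \<open>s = t - norm x / \<sigma>\<close> the spatial derivatives integrate to zero.\<close>
  define f where "f i z = (if z \<in> H then W (sh z) $ i else 0)" for i z
  define f' where "f' i z = (if z \<in> H then D1 (sh z) (axis i 1 \<bullet> sgn (snd z) / \<sigma>, axis i 1) $ i else 0)"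
    for i z
  have fm: "f i \<in> borel_measurable borel" for i
    unfolding f_def
    by (intro borel_measurable_continuous_on_if[OF Hm] continuous_intros continuous_on_subset[OF Wcont])
       (auto simp: H_def)
  have f0: "f i z = 0" if "norm z > R'" for i z
    using supp'[of "fst z" "snd z"] that by (auto simp: f_def H_def)
  \<comment> \<open>The shift leaves \<open>s\<close> unchanged, so both points lie in
    \<open>H\<close> or neither does, and the cut-off at \<open>H\<close> does not spoil the
    Lipschitz bound.\<close>
  have flip: "\<bar>f i (z + r *\<^sub>R (0, axis i 1)) - f i z\<bar> \<le> L1 * (1 / \<sigma> + 1) * \<bar>r\<bar>" for i z r
  proof (cases "z \<in> H")
    case True
    obtain s x where z: "z = (s, x)" by force
    have "\<bar>f i (z + r *\<^sub>R (0, axis i 1)) - f i z\<bar> = \<bar>(W (sh (s, x + r *\<^sub>R axis i 1)) - W (sh (s, x))) $ i\<bar>"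
      using True by (simp add: f_def H_def z)
    also have "\<dots> \<le> norm (W (sh (s, x + r *\<^sub>R axis i 1)) - W (sh (s, x)))" by (rule component_le_norm_cart)
    also have "\<dots> \<le> L1 * (\<bar>s - s\<bar> + (1 / \<sigma> + 1) * norm ((x + r *\<^sub>R axis i 1) - x))"
      using True by (intro lipW) (auto simp: H_def z)
    finally show ?thesis by (simp add: norm_axis_1)
  qed (use \<sigma> L0 in \<open>auto simp: f_def H_def\<close>)
  have fder: "((\<lambda>r. f i (z + r *\<^sub>R (0, axis i 1))) has_real_derivative f' i z) (at 0)" if "z \<notin> N" for i z
  proof (cases "z \<in> H")
    case True
    obtain s x where z: "z = (s, x)" by force
    have x: "x \<noteq> 0" using that by (simp add: N_def z)
    have s: "0 < s" using True by (simp add: H_def z)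
    have "((\<lambda>r. W (sh (s, x + r *\<^sub>R axis i 1)))
        has_derivative (\<lambda>r. D1 (sh (s, x)) (r *\<^sub>R (axis i 1 \<bullet> sgn x / \<sigma>, axis i 1)))) (at 0)"
      by (rule has_derivative_compose[OF dsh[OF x]]) (use d1[OF shC[OF s, of x]] in simp)
    then have "((\<lambda>r. W (sh (s, x + r *\<^sub>R axis i 1)) $ i)
        has_derivative (\<lambda>r. D1 (sh (s, x)) (r *\<^sub>R (axis i 1 \<bullet> sgn x / \<sigma>, axis i 1)) $ i)) (at 0)"
      by (rule bounded_linear.has_derivative[OF bounded_linear_vec_nth])
    moreover have "D1 (sh (s, x)) (r *\<^sub>R v) $ i = D1 (sh (s, x)) v $ i * r" for r v
      using has_derivative_linear[OF d1[OF shC[OF s, of x]]] by (simp add: linear_cmul)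
    ultimately have "((\<lambda>r. W (sh (s, x + r *\<^sub>R axis i 1)) $ i) has_real_derivative
        D1 (sh (s, x)) (axis i 1 \<bullet> sgn x / \<sigma>, axis i 1) $ i) (at 0)"
      unfolding has_field_derivative_def by (simp only:)
    then show ?thesis
      using True s by (simp add: f_def f'_def H_def z)
  qed (auto simp: f_def f'_def H_def)
  have ax: "(0, axis i 1) \<noteq> (0 :: real \<times> (real ^ 'n))" for i by (simp add: prod_eq_iff axis_eq_0_iff)
  have f'int: "integrable lborel (\<lambda>z. indicator (- N) z * f' i z)"
    and f'0: "(LINT z|lborel. indicator (- N) z * f' i z) = 0" for i
  proof -
    show "integrable lborel (\<lambda>z. indicator (- N) z * f' i z)"
      by (rule integral_directional_derivative_eq_0(1)[OF fm f0 ax flip N fder])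
    show "(LINT z|lborel. indicator (- N) z * f' i z) = 0"
      by (rule integral_directional_derivative_eq_0(2)[OF fm f0 ax flip N fder])
  qed

  \<comment> \<open>The pairing of the current with \<open>ds\<close>, where \<open>ds\<close> is
    \<open>dt\<close> minus the spatial covector \<open>sgn x / \<sigma>\<close>.\<close>
  define w where "w z = (if z \<in> {z. 0 \<le> fst z} then W0 (sh z) else 0)
    - (sgn (snd z) /\<^sub>R \<sigma>) \<bullet> (if z \<in> {z. 0 \<le> fst z} then W (sh z) else 0)" for z
  define w' where "w' z = D0 (sh z) (1, 0) - (sgn (snd z) /\<^sub>R \<sigma>) \<bullet> D1 (sh z) (1, 0)" for z
  have sndm: "(snd :: real \<times> (real^'n) \<Rightarrow> _) \<in> borel_measurable borel"
    by (intro borel_measurable_continuous_onI continuous_intros)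
  have sgnm[measurable]: "(\<lambda>z::real \<times> (real^'n). sgn (snd z)) \<in> borel_measurable borel"
    unfolding sgn_div_norm using sndm by measurable
  have [measurable]: "(\<lambda>z. if z \<in> {z. 0 \<le> fst z} then W0 (sh z) else 0) \<in> borel_measurable borel"
    "(\<lambda>z. if z \<in> {z. 0 \<le> fst z} then W (sh z) else 0) \<in> borel_measurable borel"
    by (rule borel_measurable_continuous_on_if[OF Hc W0cont continuous_on_const]
          borel_measurable_continuous_on_if[OF Hc Wcont continuous_on_const])+
  have wm: "w \<in> borel_measurable borel" unfolding w_def by measurable
  have sg1: "norm (sgn (x::real^'n) /\<^sub>R \<sigma>) \<le> 1 / \<sigma>" for x
    using \<sigma> by (simp add: norm_sgn divide_inverse)
  have wlip: "\<bar>w (s, x) - w (s', x)\<bar> \<le> (L0 + (1 / \<sigma>) * L1) * \<bar>s - s'\<bar>" if "0 \<le> s" "0 \<le> s'" for s s' x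
  proof -
    have "w (s, x) - w (s', x) = (W0 (sh (s, x)) - W0 (sh (s', x)))
        - (sgn x /\<^sub>R \<sigma>) \<bullet> (W (sh (s, x)) - W (sh (s', x)))"
      using that by (simp add: w_def inner_diff_right)
    also have "\<bar>\<dots>\<bar> \<le> \<bar>W0 (sh (s, x)) - W0 (sh (s', x))\<bar>
        + norm (sgn x /\<^sub>R \<sigma>) * norm (W (sh (s, x)) - W (sh (s', x)))"
      using Cauchy_Schwarz_ineq2[of "sgn x /\<^sub>R \<sigma>" "W (sh (s, x)) - W (sh (s', x))"] by linarith
    also have "\<dots> \<le> L0 * \<bar>s - s'\<bar> + (1 / \<sigma>) * (L1 * \<bar>s - s'\<bar>)"
      using lipW[OF that, of x x] lipW0[OF that, of x x] \<sigma> by (intro add_mono mult_mono sg1) auto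
    finally show ?thesis by (simp add: algebra_simps)
  qed
  have w0: "w (s, x) = 0" if "0 \<le> s" "norm (s, x) > R'" for s x
    using supp'[OF that] by (simp add: w_def)
  have wder: "((\<lambda>s. w (s, x)) has_real_derivative w' (s, x)) (at s)" if s: "0 < s" for s x
  proof -
    have 0: "((\<lambda>s. W0 (sh (s, x))) has_derivative (\<lambda>r. D0 (sh (s, x)) (r *\<^sub>R (1, 0)))) (at s)"
      by (rule has_derivative_compose[OF dsh0]) (use d0[OF shC[OF s, of x]] in simp)
    have 1: "((\<lambda>s. W (sh (s, x))) has_derivative (\<lambda>r. D1 (sh (s, x)) (r *\<^sub>R (1, 0)))) (at s)"
      by (rule has_derivative_compose[OF dsh0]) (use d1[OF shC[OF s, of x]] in simp)
    have "((\<lambda>s. W0 (sh (s, x)) - (sgn x /\<^sub>R \<sigma>) \<bullet> W (sh (s, x))) has_derivative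
       (\<lambda>r. D0 (sh (s, x)) (r *\<^sub>R (1, 0)) - (sgn x /\<^sub>R \<sigma>) \<bullet> D1 (sh (s, x)) (r *\<^sub>R (1, 0)))) (at s)"
      by (intro has_derivative_diff has_derivative_inner_right 0 1)
    moreover have lin: "D1 (sh (s, x)) (r *\<^sub>R v) = r *\<^sub>R D1 (sh (s, x)) v"
      "D0 (sh (s, x)) (r *\<^sub>R v) = r *\<^sub>R D0 (sh (s, x)) v" for r v
      using has_derivative_linear[OF d1[OF shC[OF s, of x]]] has_derivative_linear[OF d0[OF shC[OF s, of x]]]
      by (simp_all only: linear_cmul)
    have "(\<lambda>r. D0 (sh (s, x)) (r *\<^sub>R (1, 0)) - (sgn x /\<^sub>R \<sigma>) \<bullet> D1 (sh (s, x)) (r *\<^sub>R (1, 0))) = (*) (w' (s, x))"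
      unfolding lin by (simp add: w'_def fun_eq_iff inner_scaleR_right algebra_simps)
    ultimately have "((\<lambda>s. W0 (sh (s, x)) - (sgn x /\<^sub>R \<sigma>) \<bullet> W (sh (s, x))) has_real_derivative w' (s, x)) (at s)"
      unfolding has_field_derivative_def by simp
    moreover have "\<forall>\<^sub>F s in nhds s. w (s, x) = W0 (sh (s, x)) - (sgn x /\<^sub>R \<sigma>) \<bullet> W (sh (s, x))"
      using eventually_nhds_in_open[of "{0<..}" s] s by (auto elim!: eventually_mono simp: w_def)
    ultimately show ?thesis by (subst DERIV_cong_ev[OF refl _ refl]) auto
  qed
  note wint = integral_halfspace_derivative[OF wm wlip w0 wder]

  \<comment> \<open>By the chain rule each \<open>f' i\<close> contains an additional
    \<open>s\<close>-derivative of \<open>W\<close>; summed over \<open>i\<close> these cancel the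
    \<open>W\<close>-part of \<open>w'\<close>.\<close>
  have split: "indicator (cone \<sigma>) (sh z) * dv (sh z)
      = indicator {0<..} (fst z) * w' z + (\<Sum>i\<in>UNIV. indicator (- N) z * f' i z)" if "z \<notin> N" for z
  proof (cases "z \<in> H")
    case True
    then have c: "sh z \<in> cone \<sigma>" by (simp add: shC')
    have lin: "linear (D1 (sh z))" by (rule has_derivative_linear[OF d1[OF c]])
    have "D1 (sh z) (axis i 1 \<bullet> sgn (snd z) / \<sigma>, axis i 1) $ i
      = (sgn (snd z) /\<^sub>R \<sigma>) $ i * D1 (sh z) (1, 0) $ i + D1 (sh z) (0, axis i 1) $ i" for i
    proof -
      have e: "(axis i 1 \<bullet> sgn (snd z) / \<sigma>, axis i 1) = (sgn (snd z) $ i / \<sigma>) *\<^sub>R (1, 0) + (0, axis i (1::real))"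
        by (simp add: inner_axis' )
      show ?thesis unfolding e linear_add[OF lin] linear_cmul[OF lin] by (simp add: divide_inverse)
    qed
    then have "(\<Sum>i\<in>UNIV. f' i z) = (sgn (snd z) /\<^sub>R \<sigma>) \<bullet> D1 (sh z) (1, 0) + (\<Sum>i\<in>UNIV. D1 (sh z) (0, axis i 1) $ i)"
      using True by (simp add: f'_def sum.distrib inner_vec_def)
    then show ?thesis using True that c by (simp add: H_def dv w'_def)
  next
    case False
    then show ?thesis by (simp add: shC' H_def f'_def)
  qed
  have Kc: "closed ?K"
    unfolding case_prod_beta' by (intro closed_Collect_le continuous_intros)
  have Co: "open (cone \<sigma> :: (real \<times> (real ^ 'n)) set)"
    unfolding cone_def case_prod_beta' by (intro open_Collect_less continuous_intros)
  have CK: "cone \<sigma> \<subseteq> ?K" by (auto simp: cone_def)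
  have dvm: "(\<lambda>z. indicator (cone \<sigma>) z * dv z) \<in> borel_measurable borel"
  proof -
    have tr: "(h has_derivative D) (at z) \<Longrightarrow> z \<in> cone \<sigma> \<Longrightarrow>
        ((\<lambda>z. if z \<in> ?K then h z else 0) has_derivative D) (at z)" for h D z
      by (rule has_derivative_transform_within_open[where f=h, OF _ Co], assumption+, rule sym, rule if_P)
        (use CK in blast)
    have Km: "?K \<in> sets borel" using Kc by (rule borel_closed)
    have 0: "(\<lambda>z. indicator (cone \<sigma>) z * D0 z (1, 0)) \<in> borel_measurable borel"
      by (rule borel_measurable_directional_derivative[OF
            borel_measurable_continuous_on_if[OF Km lipschitz_on_continuous_on[OF l0] continuous_on_const] Co
            tr[OF d0]])
    have 1: "(\<lambda>z. indicator (cone \<sigma>) z * (D1 z (0, axis i 1) $ i)) \<in> borel_measurable borel" for i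
      by (rule borel_measurable_directional_derivative[where D = "\<lambda>z h. D1 z h $ i", OF
            borel_measurable_continuous_on_if[OF Km continuous_on_component[OF lipschitz_on_continuous_on[OF l1]]
              continuous_on_const] Co tr[OF bounded_linear.has_derivative[OF bounded_linear_vec_nth d1]]])
    have "(\<lambda>z. indicator (cone \<sigma>) z * dv z) = (\<lambda>z. indicator (cone \<sigma>) z * D0 z (1, 0)
        + (\<Sum>i\<in>UNIV. indicator (cone \<sigma>) z * (D1 z (0, axis i 1) $ i)))"
      by (rule ext) (auto simp: indicator_def dv)
    then show ?thesis by (simp only:) (intro borel_measurable_add borel_measurable_sum 0 1)
  qed
  have shm: "sh \<in> borel_measurable borel" by (rule borel_measurable_continuous_onI[OF shcont])
  have "(\<lambda>x::real^'n. norm x / \<sigma>) \<in> borel_measurable borel" by measurable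
  from distr_shear_lborel[OF this] have D: "distr lborel borel sh = lborel" by (simp add: sh_def[abs_def])
  let ?r = "\<lambda>z. indicator {0<..} (fst z) * w' z + (\<Sum>i\<in>UNIV. indicator (- N) z * f' i z)"
  have rint: "integrable lborel ?r"
    by (intro Bochner_Integration.integrable_add wint(1) Bochner_Integration.integrable_sum f'int)
  have m2: "(\<lambda>z. indicator (cone \<sigma>) (sh z) * dv (sh z)) \<in> borel_measurable lborel"
    using measurable_compose[OF shm dvm] by simp
  have AE: "AE z in lborel. indicator (cone \<sigma>) (sh z) * dv (sh z) = ?r z"
    using AE_not_in[OF N] by eventually_elim (rule split)
  have "integrable lborel (\<lambda>z. indicator (cone \<sigma>) (sh z) * dv (sh z))"
    using rint integrable_cong_AE[OF m2 _ AE] by blast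
  then have "integrable (distr lborel borel sh) (\<lambda>z. indicator (cone \<sigma>) z * dv z)"
    using shm dvm by (subst integrable_distr_eq) auto
  then show "set_integrable lborel (cone \<sigma>) dv"
    by (simp add: D set_integrable_def)
  have "(LINT z:cone \<sigma>|lborel. dv z) = (LINT z|distr lborel borel sh. indicator (cone \<sigma>) z * dv z)"
    by (simp add: D set_lebesgue_integral_def)
  also have "\<dots> = (LINT z|lborel. indicator (cone \<sigma>) (sh z) * dv (sh z))"
    using shm dvm by (subst integral_distr) auto
  also have "\<dots> = (LINT z|lborel. ?r z)"
    using rint by (intro integral_cong_AE m2 AE) auto
  also have "\<dots> = - (LINT x|lborel. w (0, x))"
    by (simp only: Bochner_Integration.integral_add[OF wint(1) Bochner_Integration.integrable_sum[OF f'int]]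
        Bochner_Integration.integral_sum[OF f'int] f'0 wint(2)) simp
  also have "\<dots> = (LINT x|lborel. - w (0, x))" by simp
  also have "\<dots> = (LINT x|lborel. (W (norm x / \<sigma>, x) \<bullet> sgn x) / \<sigma> - W0 (norm x / \<sigma>, x))"
    by (intro Bochner_Integration.integral_cong refl)
       (simp add: w_def sh_def divide_inverse inner_commute)
  finally show "(LINT z:cone \<sigma>|lborel. dv z)
      = (LINT x|lborel. (W (norm x / \<sigma>, x) \<bullet> sgn x) / \<sigma> - W0 (norm x / \<sigma>, x))" .
qed

section \<open>Regularised powers\<close>

text \<open>Only the point 0 is at issue: decay faster than linear forces the difference quotient to
  0 there.\<close>

lemma has_real_derivative_zero_extension:
  fixes f g g' :: "real \<Rightarrow> real"
  assumes f0: "\<And>y. y \<le> 0 \<Longrightarrow> f y = 0" and fg: "\<And>y. 0 < y \<Longrightarrow> f y = g y"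
    and g: "\<And>y. 0 < y \<Longrightarrow> (g has_real_derivative f' y) (at y)"
    and f'0: "\<And>y. y \<le> 0 \<Longrightarrow> f' y = 0"
    and a: "1 < a" and bd: "\<And>y. 0 < y \<Longrightarrow> \<bar>f y\<bar> \<le> B * y powr a"
  shows "(f has_real_derivative f' y) (at y)"
proof -
  consider "0 < y" | "y < 0" | "y = 0" by linarith
  then show ?thesis
  proof cases
    case 1
    have "\<forall>\<^sub>F y in nhds y. f y = g y"
      using eventually_nhds_in_open[of "{0<..}" y] 1 by (auto elim!: eventually_mono simp: fg)
    with g[OF 1] show ?thesis by (simp add: DERIV_cong_ev[OF refl _ refl])
  next
    case 2
    have "\<forall>\<^sub>F y in nhds y. f y = 0"
      using eventually_nhds_in_open[of "{..<0}" y] 2 by (auto elim!: eventually_mono simp: f0)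
    then show ?thesis using 2 f'0[of y] by (simp add: DERIV_cong_ev[OF refl _ refl])
  next
    case 3
    have B: "0 \<le> B" using bd[of 1] by simp
    have lim: "((\<lambda>h. B * \<bar>h\<bar> powr (a - 1)) \<longlongrightarrow> 0) (at 0)"
      using a by (auto intro!: tendsto_mult_right_zero tendsto_zero_powrI[where b = "a - 1"] tendsto_rabs_zero)
    have "((\<lambda>h. (f (0 + h) - f 0) / h) \<longlongrightarrow> 0) (at 0)"
    proof (rule Lim_null_comparison[OF _ lim])
      show "\<forall>\<^sub>F h in at 0. norm ((f (0 + h) - f 0) / h) \<le> B * \<bar>h\<bar> powr (a - 1)"
      proof (rule eventually_at_filter[THEN iffD2], rule always_eventually, intro allI impI)
        fix h :: real assume h: "h \<noteq> 0"
        show "norm ((f (0 + h) - f 0) / h) \<le> B * \<bar>h\<bar> powr (a - 1)"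
        proof (cases "0 < h")
          case True
          have "\<bar>f h\<bar> / h \<le> (B * h powr a) / h" using True bd by (intro divide_right_mono) auto
          also have "\<dots> = B * h powr (a - 1)" using True by (simp add: powr_diff)
          finally show ?thesis using True by (simp add: f0)
        qed (use B in \<open>simp add: f0\<close>)
      qed
    qed
    then show ?thesis using 3 f'0[of 0] by (simp add: DERIV_def)
  qed
qed

text \<open>\<open>wt b e\<close> is a twice differentiable substitute for the positive part of \<open>y powr b\<close>, recovered as
  \<open>e\<close> tends to 0. Its derivatives are \<open>wt1\<close> and \<open>wt2\<close>; \<open>wt_err\<close>, with derivative \<open>wt_err1\<close>, is the
  defect in Euler's identity for homogeneous functions.\<close>
definition wt :: "real \<Rightarrow> real \<Rightarrow> real \<Rightarrow> real" where
  "wt b e y = (if y \<le> 0 then 0 else y powr (b + 2) / (y + e) ^ 2)"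
definition wt1 :: "real \<Rightarrow> real \<Rightarrow> real \<Rightarrow> real" where
  "wt1 b e y = (if y \<le> 0 then 0 else y powr (b + 1) * (b * y + (b + 2) * e) / (y + e) ^ 3)"
definition wt_err :: "real \<Rightarrow> real \<Rightarrow> real \<Rightarrow> real" where
  "wt_err b e y = (if y \<le> 0 then 0 else 2 * e * y powr (b + 2) / (y + e) ^ 3)"
definition wt_err1 :: "real \<Rightarrow> real \<Rightarrow> real \<Rightarrow> real" where
  "wt_err1 b e y = (if y \<le> 0 then 0 else 2 * e * y powr (b + 1) * ((b - 1) * y + (b + 2) * e) / (y + e) ^ 4)"
definition wt2 :: "real \<Rightarrow> real \<Rightarrow> real \<Rightarrow> real" where
  "wt2 b e y = (if y \<le> 0 then 0 else ((b - 1) * wt1 b e y + wt_err1 b e y) / y)"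

lemma powr_Suc_split: "0 < y \<Longrightarrow> y powr (b + 2) = y * y powr (b + 1)"
  "0 < (y::real) \<Longrightarrow> y powr (b + 1) = y * y powr b"
  using powr_add[of y "b + 1" 1] powr_add[of y b 1] by (auto simp: algebra_simps)

lemma frac_cancel_cube: "s \<noteq> 0 \<Longrightarrow> a * (3 * s) / s ^ 3 = 3 * a / s^2" for s :: real
  by (simp add: power2_eq_square power3_eq_cube)

text \<open>Interpolation between \<open>e\<close> and \<open>y\<close>: both are at most
  \<open>max y e\<close>, hence so is \<open>e powr (1 - a) * y powr a\<close>. It converts a factor
  \<open>e\<close> into a positive power of \<open>e\<close> that is uniform in
  \<open>y\<close>.\<close>

lemma powr_interp_le:
  fixes y e :: real
  assumes "0 < y" "0 < e" "0 \<le> a" "a \<le> 1"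
  shows "e * y powr a \<le> e powr a * (y + e)"
proof -
  have "e powr (1 - a) * y powr a \<le> (max y e) powr (1 - a) * (max y e) powr a"
    using assms by (intro mult_mono powr_mono2) auto
  also have "\<dots> = max y e" using assms by (simp add: powr_add[symmetric])
  also have "\<dots> \<le> y + e" using assms by simp
  finally have "e powr a * (e powr (1 - a) * y powr a) \<le> e powr a * (y + e)"
    by (intro mult_left_mono) auto
  moreover have "e powr a * e powr (1 - a) = e" using assms by (simp add: powr_add[symmetric])
  ultimately show ?thesis by (simp add: mult.assoc[symmetric])
qed

context
  fixes b e :: real
  assumes b: "0 < b" "b \<le> 1" and e: "0 < e"
begin

lemma wt_nonneg: "0 \<le> wt b e y" "0 \<le> wt1 b e y" "0 \<le> wt_err b e y"
  using b e by (auto simp: wt_def wt1_def wt_err_def intro!: divide_nonneg_nonneg mult_nonneg_nonneg)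

lemma wt_num_le: "0 < y \<Longrightarrow> b * y + (b + 2) * e \<le> 3 * (y + e)"
proof -
  assume y: "0 < y"
  have "b * e \<le> e" "b * y \<le> y" using b e y by auto
  then show ?thesis using y e unfolding distrib_left distrib_right by linarith
qed

lemma wt_le: "0 < y \<Longrightarrow> wt b e y \<le> y powr b"
proof -
  assume y: "0 < y"
  have "y powr (b + 2) = y^2 * y powr b"
    using y by (simp add: powr_Suc_split power2_eq_square)
  also have "\<dots> \<le> (y + e)^2 * y powr b"
    using y e by (intro mult_right_mono power_mono) auto
  finally show ?thesis using y e by (simp add: wt_def divide_le_eq mult.commute)
qed

lemma wt_ge: "e \<le> y \<Longrightarrow> y powr b / 4 \<le> wt b e y"
proof -
  assume y: "e \<le> y"
  have "y powr b * (y + e)^2 \<le> y powr b * (2 * y)^2"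
    using y e by (intro mult_left_mono power_mono) auto
  also have "\<dots> = 4 * y powr (b + 2)" using y e by (simp add: powr_Suc_split power2_eq_square)
  finally show ?thesis using y e by (simp add: wt_def field_simps)
qed

lemma wt_deriv: "(wt b e has_real_derivative wt1 b e y) (at y)"
proof (rule has_real_derivative_zero_extension[where g = "\<lambda>y. y powr (b + 2) / (y + e) ^ 2" and a = "b + 2"
      and B = "inverse (e^2)"])
  fix y :: real assume y: "0 < y"
  show "((\<lambda>y. y powr (b + 2) / (y + e) ^ 2) has_real_derivative wt1 b e y) (at y)"
  proof (rule DERIV_cong)
    show "((\<lambda>y. y powr (b + 2) / (y + e) ^ 2) has_real_derivative
        ((b + 2) * y powr (b + 1) * (y + e)^2 - y powr (b + 2) * (2 * (y + e))) / ((y + e)^2 * (y + e)^2)) (at y)"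
      using y e by (auto intro!: derivative_eq_intros simp: add.commute[of 1 b])
    show "((b + 2) * y powr (b + 1) * (y + e)^2 - y powr (b + 2) * (2 * (y + e))) / ((y + e)^2 * (y + e)^2) = wt1 b e y"
      using y e by (simp add: wt1_def powr_Suc_split frac_eq_eq) algebra
  qed
  have "y powr (b + 2) / (y + e)^2 \<le> y powr (b + 2) / e^2"
    using y e by (intro divide_left_mono power_mono) auto
  then show "\<bar>wt b e y\<bar> \<le> inverse (e^2) * y powr (b + 2)"
    using y e by (simp add: wt_def field_simps)
qed (use b in \<open>auto simp: wt_def wt1_def\<close>)

lemma wt1_euler: "y * wt1 b e y = b * wt b e y + wt_err b e y"
proof (cases "0 < y")
  case True
  then show ?thesis
    using e by (simp add: wt_def wt1_def wt_err_def powr_Suc_split add_frac_eq frac_eq_eq) algebra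
qed (simp add: wt_def wt1_def wt_err_def)

lemma wt2_euler: "y * wt2 b e y = (b - 1) * wt1 b e y + wt_err1 b e y"
  by (auto simp: wt2_def wt1_def wt_err1_def)

text \<open>The logarithmic derivative of \<open>wt\<close> times \<open>y\<close> is
  \<open>b + 2 * e / (y + e)\<close>: the order of vanishing passes from \<open>b\<close> for large
  \<open>y\<close> to \<open>b + 2\<close> near 0. The constant is uniform in
  \<open>e\<close>.\<close>

lemma wt1_le: "y * wt1 b e y \<le> (b + 2) * wt b e y"
proof (cases "0 < y")
  case True
  have "2 * e * y powr (b + 2) \<le> 2 * (y + e) * y powr (b + 2)" using True by (intro mult_right_mono) auto
  then have "wt_err b e y \<le> 2 * wt b e y"
    using True e by (simp add: wt_err_def wt_def divide_simps power2_eq_square power3_eq_cube)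
  then show ?thesis unfolding wt1_euler by (simp add: algebra_simps)
qed (simp add: wt_def wt1_def)

lemma wt1_ge: "0 < y \<Longrightarrow> b * y powr (b + 1) / (y + e)^2 \<le> wt1 b e y"
proof -
  assume y: "0 < y"
  have "b * (y + e) * y powr (b + 1) \<le> (b * y + (b + 2) * e) * y powr (b + 1)"
    using b e by (intro mult_right_mono) (auto simp: algebra_simps)
  then show ?thesis using y e
    by (simp add: wt1_def divide_simps power2_eq_square power3_eq_cube)
qed

text \<open>This first defect tends to 0 with \<open>e\<close> uniformly in \<open>y\<close>, so it
  can be integrated against any bounded function.\<close>

lemma wt_err_le: "wt_err b e y \<le> 2 * e powr b"
proof (cases "0 < y")
  case True
  have "e * y powr (b + 2) = y^2 * (e * y powr b)"
    using True by (simp add: powr_Suc_split power2_eq_square)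
  also have "\<dots> \<le> (y + e)^2 * (e powr b * (y + e))"
    using True b e by (intro mult_mono power_mono powr_interp_le) auto
  finally show ?thesis using True e
    by (simp add: wt_err_def divide_simps power2_eq_square power3_eq_cube) (simp add: algebra_simps)
qed (simp add: wt_err_def)

lemma wt_err1_abs_le: "\<bar>wt_err1 b e y\<bar> \<le> (if y \<le> 0 then 0 else 6 * e * y powr (b + 1) / (y + e) ^ 3)"
proof (cases "0 < y")
  case True
  have "\<bar>(b - 1) * y + (b + 2) * e\<bar> \<le> 3 * (y + e)"
  proof -
    have "b * e \<le> e" "b * y \<le> y" "0 \<le> b * e" "0 \<le> b * y" using b e True by auto
    then show ?thesis using True e unfolding distrib_left distrib_right left_diff_distrib by linarith
  qed
  then have "2 * e * y powr (b + 1) * \<bar>(b - 1) * y + (b + 2) * e\<bar> \<le> 2 * e * y powr (b + 1) * (3 * (y + e))"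
    using e by (intro mult_left_mono) auto
  then show ?thesis using True e
    by (simp add: wt_err1_def abs_mult abs_divide divide_simps power3_eq_cube power4_eq_xxxx)
qed (simp add: wt_err1_def)

text \<open>The exponent \<open>b + 2\<close> in \<open>wt\<close> is high enough for the second
  derivative to stay bounded at 0 when \<open>e\<close> is fixed. This makes \<open>wt1\<close>
  Lipschitz on bounded sets, as the divergence theorem requires of the current.\<close>

lemma wt2_abs_le: "y \<le> R \<Longrightarrow> 0 \<le> R \<Longrightarrow> \<bar>wt2 b e y\<bar> \<le> 9 * R powr b / e^2"
proof (cases "0 < y")
  case True
  assume R: "y \<le> R"
  have w1: "\<bar>(b - 1) * wt1 b e y\<bar> \<le> 3 * y powr (b + 1) / (y + e)^2"
  proof -
    have "(b * y + (b + 2) * e) \<le> 3 * (y + e)"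
      using True by (rule wt_num_le)
    then have "y powr (b + 1) * (b * y + (b + 2) * e) / (y + e) ^ 3 \<le> y powr (b + 1) * (3 * (y + e)) / (y + e) ^ 3"
      using True e by (intro divide_right_mono mult_left_mono) auto
    then have "wt1 b e y \<le> 3 * y powr (b + 1) / (y + e)^2"
      using True e frac_cancel_cube[of "y + e" "y powr (b + 1)"] by (simp add: wt1_def)
    moreover have "\<bar>(b - 1) * wt1 b e y\<bar> \<le> 1 * wt1 b e y"
      unfolding abs_mult using b wt_nonneg(2)[of y] by (intro mult_mono) auto
    ultimately show ?thesis by simp
  qed
  have w2: "\<bar>wt_err1 b e y\<bar> \<le> 6 * y powr (b + 1) / (y + e)^2"
  proof -
    have "6 * e * y powr (b + 1) / (y + e) ^ 3 \<le> 6 * (y + e) * y powr (b + 1) / (y + e) ^ 3"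
      using True e by (intro divide_right_mono mult_right_mono) auto
    also have "\<dots> = 6 * y powr (b + 1) / (y + e)^2"
      using True e frac_cancel_cube[of "y + e" "2 * y powr (b + 1)"] by (simp add: algebra_simps)
    finally show ?thesis using wt_err1_abs_le[of y] True by simp
  qed
  have "y * \<bar>wt2 b e y\<bar> = \<bar>(b - 1) * wt1 b e y + wt_err1 b e y\<bar>"
    using True wt2_euler[of y] by (metis abs_mult abs_of_pos)
  also have "\<dots> \<le> 9 * y powr (b + 1) / (y + e)^2" using w1 w2 by simp
  also have "\<dots> \<le> 9 * y powr (b + 1) / e^2"
    using True e by (intro divide_left_mono power_mono) auto
  finally have "y * \<bar>wt2 b e y\<bar> \<le> y * (9 * y powr b / e^2)"
    using True by (simp add: powr_Suc_split mult.left_commute)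
  then have "\<bar>wt2 b e y\<bar> \<le> 9 * y powr b / e^2" using True by (rule mult_left_le_imp_le)
  also have "\<dots> \<le> 9 * R powr b / e^2"
    using True R b e by (intro divide_right_mono mult_left_mono powr_mono2) auto
  finally show ?thesis .
qed (simp add: wt2_def)

lemma wt1_deriv: "(wt1 b e has_real_derivative wt2 b e y) (at y)"
proof (rule has_real_derivative_zero_extension[where g = "\<lambda>y. y powr (b + 1) * (b * y + (b + 2) * e) / (y + e) ^ 3" and a = "b + 1"
      and B = "3 / e^2"])
  fix y :: real assume y: "0 < y"
  show "((\<lambda>y. y powr (b + 1) * (b * y + (b + 2) * e) / (y + e) ^ 3) has_real_derivative wt2 b e y) (at y)"
  proof (rule DERIV_cong)
    show "((\<lambda>y. y powr (b + 1) * (b * y + (b + 2) * e) / (y + e) ^ 3) has_real_derivative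
        (((b + 1) * y powr b * (b * y + (b + 2) * e) + y powr (b + 1) * b) * (y + e) ^ 3
          - y powr (b + 1) * (b * y + (b + 2) * e) * (3 * (y + e)^2)) / ((y + e) ^ 3 * (y + e) ^ 3)) (at y)"
      using y e by (auto intro!: derivative_eq_intros)
    have "y * ((((b + 1) * y powr b * (b * y + (b + 2) * e) + y powr (b + 1) * b) * (y + e) ^ 3
          - y powr (b + 1) * (b * y + (b + 2) * e) * (3 * (y + e)^2)) / ((y + e) ^ 3 * (y + e) ^ 3))
      = (b - 1) * wt1 b e y + wt_err1 b e y"
      using y e by (simp add: wt1_def wt_err1_def powr_Suc_split add_frac_eq frac_eq_eq) algebra
    then show "(((b + 1) * y powr b * (b * y + (b + 2) * e) + y powr (b + 1) * b) * (y + e) ^ 3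
          - y powr (b + 1) * (b * y + (b + 2) * e) * (3 * (y + e)^2)) / ((y + e) ^ 3 * (y + e) ^ 3) = wt2 b e y"
      using y by (simp add: wt2_def eq_divide_eq mult.commute)
  qed
  have "(b * y + (b + 2) * e) \<le> 3 * (y + e)"
    using y by (rule wt_num_le)
  then have "wt1 b e y \<le> y powr (b + 1) * (3 * (y + e)) / (y + e) ^ 3"
    using y e unfolding wt1_def by (auto intro!: divide_right_mono mult_left_mono)
  also have "\<dots> = 3 * y powr (b + 1) / (y + e)^2"
    using y e by (intro frac_cancel_cube) auto
  also have "\<dots> \<le> 3 * y powr (b + 1) / e^2"
    using y e by (intro divide_left_mono power_mono) auto
  finally show "\<bar>wt1 b e y\<bar> \<le> 3 / e^2 * y powr (b + 1)"
    using wt_nonneg(2)[of y] by simp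
qed (use b in \<open>auto simp: wt1_def wt2_def\<close>)

end

text \<open>Unlike \<open>wt_err\<close>, this defect need not be uniformly small: at
  \<open>y = e\<close> it can be of size \<open>e powr (b - 1)\<close>. Half of the exponent is
  spent on a small factor, and the other half leaves the derivative of a weight of exponent
  \<open>b / 2\<close>, whose integral stays bounded as \<open>e\<close> tends to 0.\<close>

lemma wt_err1_le_wt1:
  assumes "0 < b" "b \<le> 1" "0 < e"
  shows "\<bar>wt_err1 b e y\<bar> \<le> 12 / b * e powr (b / 2) * wt1 (b / 2) e y"
proof (cases "0 < y")
  case True
  have "y powr (b + 1) = y powr (b / 2) * y powr (b / 2 + 1)"
    using True by (simp add: powr_add[symmetric])
  then have "e * y powr (b + 1) = (e * y powr (b / 2)) * y powr (b / 2 + 1)" by simp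
  also have "\<dots> \<le> (e powr (b / 2) * (y + e)) * y powr (b / 2 + 1)"
    using assms True by (intro mult_right_mono powr_interp_le) auto
  finally have "6 * e * y powr (b + 1) / (y + e) ^ 3 \<le> 6 * ((e powr (b / 2) * (y + e)) * y powr (b / 2 + 1)) / (y + e) ^ 3"
    using assms True by (intro divide_right_mono) auto
  also have "\<dots> = 12 / b * e powr (b / 2) * (b / 2 * y powr (b / 2 + 1) / (y + e)^2)"
    using assms True by (simp add: power2_eq_square power3_eq_cube)
  also have "\<dots> \<le> 12 / b * e powr (b / 2) * wt1 (b / 2) e y"
    using assms True by (intro mult_left_mono wt1_ge) auto
  finally show ?thesis using wt_err1_abs_le[OF assms, of y] True by simp
qed (simp add: wt_err1_def wt1_def)

section \<open>Bounded Lipschitz functions and second derivatives\<close>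

text \<open>Boundedness and the Lipschitz property are carried together because only the conjunction is
  stable under products.\<close>
definition blip :: "'a::metric_space set \<Rightarrow> ('a \<Rightarrow> 'b::real_normed_vector) \<Rightarrow> bool" where
  "blip S f \<longleftrightarrow> bounded (f ` S) \<and> (\<exists>L. L-lipschitz_on S f)"

lemma blipI: "(\<And>z. z \<in> S \<Longrightarrow> norm (f z) \<le> B) \<Longrightarrow> L-lipschitz_on S f \<Longrightarrow> blip S f"
  unfolding blip_def bounded_iff by blast

lemma blipE:
  assumes "blip S f"
  obtains B L where "0 \<le> B" "0 \<le> L" "\<And>z. z \<in> S \<Longrightarrow> norm (f z) \<le> B"
    "\<And>z z'. z \<in> S \<Longrightarrow> z' \<in> S \<Longrightarrow> norm (f z - f z') \<le> L * dist z z'" "L-lipschitz_on S f"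
proof -
  obtain B where B: "\<And>z. z \<in> S \<Longrightarrow> norm (f z) \<le> B" using assms by (auto simp: blip_def bounded_iff)
  obtain L where L: "L-lipschitz_on S f" using assms by (auto simp: blip_def)
  show thesis
    using lipschitz_on_nonneg[OF L] lipschitz_onD[OF L] B L
    by (intro that[of "max B 0" L]) (auto simp: dist_norm max.coboundedI1)
qed

lemma blip_const: "blip S (\<lambda>z. c)"
  by (rule blipI[where B = "norm c"]) (auto intro: lipschitz_on_constant)

lemma blip_add:
  assumes "blip S f" "blip S g" shows "blip S (\<lambda>z. f z + g z)"
proof -
  obtain B L where f: "\<And>z. z \<in> S \<Longrightarrow> norm (f z) \<le> B" "L-lipschitz_on S f" by (rule blipE[OF assms(1)]) blast
  obtain B' L' where g: "\<And>z. z \<in> S \<Longrightarrow> norm (g z) \<le> B'" "L'-lipschitz_on S g" by (rule blipE[OF assms(2)]) blast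
  show ?thesis
    by (rule blipI[where B = "B + B'", OF _ lipschitz_on_add[OF f(2) g(2)]])
      (use f(1) g(1) in \<open>blast intro: norm_triangle_le add_mono\<close>)
qed

lemma blip_bounded_linear:
  assumes "bounded_linear h" "blip S f" shows "blip S (\<lambda>z. h (f z))"
proof -
  obtain B L where f: "0 \<le> B" "0 \<le> L" "\<And>z. z \<in> S \<Longrightarrow> norm (f z) \<le> B"
    "\<And>z z'. z \<in> S \<Longrightarrow> z' \<in> S \<Longrightarrow> norm (f z - f z') \<le> L * dist z z'" by (rule blipE[OF assms(2)]) blast
  obtain K where K: "0 < K" "\<And>x. norm (h x) \<le> norm x * K"
    using bounded_linear.pos_bounded[OF assms(1)] by blast
  show ?thesis
  proof (rule blipI[where B = "B * K" and L = "L * K"])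
    show "norm (h (f z)) \<le> B * K" if "z \<in> S" for z
      using K(2)[of "f z"] mult_right_mono[OF f(3)[OF that], of K] K(1) by linarith
    show "(L * K)-lipschitz_on S (\<lambda>z. h (f z))"
    proof (rule lipschitz_onI)
      fix x y assume "x \<in> S" "y \<in> S"
      then have "norm (f x - f y) * K \<le> L * dist x y * K" using K f(4) by (intro mult_right_mono) auto
      then show "dist (h (f x)) (h (f y)) \<le> L * K * dist x y"
        using K(2)[of "f x - f y"] bounded_linear.linear[OF assms(1)]
        by (simp add: dist_norm linear_diff[symmetric] algebra_simps)
    qed (use f K in auto)
  qed
qed

lemma blip_bounded_bilinear:
  assumes bb: "bounded_bilinear h" and "blip S f" "blip S g" shows "blip S (\<lambda>z. h (f z) (g z))"
proof -
  obtain B L where f: "0 \<le> B" "0 \<le> L" "\<And>z. z \<in> S \<Longrightarrow> norm (f z) \<le> B"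
    "\<And>z z'. z \<in> S \<Longrightarrow> z' \<in> S \<Longrightarrow> norm (f z - f z') \<le> L * dist z z'" by (rule blipE[OF assms(2)]) blast
  obtain B' L' where g: "0 \<le> B'" "0 \<le> L'" "\<And>z. z \<in> S \<Longrightarrow> norm (g z) \<le> B'"
    "\<And>z z'. z \<in> S \<Longrightarrow> z' \<in> S \<Longrightarrow> norm (g z - g z') \<le> L' * dist z z'" by (rule blipE[OF assms(3)]) blast
  interpret bounded_bilinear h by (rule bb)
  obtain K where K: "0 \<le> K" "\<And>x y. norm (h x y) \<le> norm x * norm y * K" using nonneg_bounded by blast
  show ?thesis
  proof (rule blipI[where B = "B * B' * K" and L = "(L * B' + B * L') * K"])
    show "norm (h (f z) (g z)) \<le> B * B' * K" if "z \<in> S" for z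
      using f g K that by (intro order_trans[OF K(2)] mult_mono) auto
    show "((L * B' + B * L') * K)-lipschitz_on S (\<lambda>z. h (f z) (g z))"
    proof (rule lipschitz_onI)
      fix x y assume xy: "x \<in> S" "y \<in> S"
      have "h (f x) (g x) - h (f y) (g y) = h (f x - f y) (g x) + h (f y) (g x - g y)"
        by (simp add: diff_left diff_right)
      then have "norm (h (f x) (g x) - h (f y) (g y)) \<le> norm (h (f x - f y) (g x)) + norm (h (f y) (g x - g y))"
        by (metis norm_triangle_ineq)
      also have "\<dots> \<le> (L * dist x y) * B' * K + B * (L' * dist x y) * K"
        using f g K xy by (intro add_mono order_trans[OF K(2)] mult_mono) auto
      finally show "dist (h (f x) (g x)) (h (f y) (g y)) \<le> (L * B' + B * L') * K * dist x y"
        by (simp add: dist_norm algebra_simps)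
    qed (use f g K in auto)
  qed
qed

lemmas blip_mult = blip_bounded_bilinear[OF bounded_bilinear_mult]
  and blip_scaleR = blip_bounded_bilinear[OF bounded_bilinear_scaleR]
  and blip_inner = blip_bounded_bilinear[OF bounded_bilinear_inner]

lemma blip_minus: "blip S f \<Longrightarrow> blip S (\<lambda>z. - f z)"
  by (rule blip_bounded_linear[OF bounded_linear_minus[OF bounded_linear_ident]])

lemma blip_diff: "blip S f \<Longrightarrow> blip S g \<Longrightarrow> blip S (\<lambda>z. f z - g z)"
  using blip_add[of S f "\<lambda>z. - g z"] blip_minus[of S g] by simp

lemma blip_power: "blip S f \<Longrightarrow> blip S (\<lambda>z. (f z :: real) ^ k)"
  by (induction k) (auto intro: blip_const blip_mult)

lemma blip_sum: "(\<And>i. i \<in> I \<Longrightarrow> blip S (f i)) \<Longrightarrow> blip S (\<lambda>z. \<Sum>i\<in>I. f i z)"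
  by (induction I rule: infinite_finite_induct) (auto intro: blip_const blip_add)

lemma blip_vec:
  assumes "\<And>i. blip S (\<lambda>z. f i z)"
  shows "blip S (\<lambda>z. (\<chi> i. f i z) :: real ^ 'n::finite)"
proof -
  have "(\<lambda>z. (\<chi> i. f i z) :: real ^ 'n) = (\<lambda>z. \<Sum>i\<in>UNIV. f i z *\<^sub>R axis i 1)"
    by (auto simp: fun_eq_iff vec_eq_iff axis_def if_distrib cong: if_cong)
  then show ?thesis using assms by (auto intro!: blip_sum blip_scaleR blip_const)
qed

lemma blip_ident: "bounded S \<Longrightarrow> blip S (\<lambda>z. z)"
  by (auto simp: blip_def intro: lipschitz_on_id)

lemma blip_fst: "bounded S \<Longrightarrow> blip S (\<lambda>z. fst z)"
  and blip_snd: "bounded S \<Longrightarrow> blip S (\<lambda>z. snd z)"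
  by (auto intro: blip_bounded_linear blip_ident bounded_linear_fst bounded_linear_snd)

lemma blip_compose_real:
  fixes g :: "real \<Rightarrow> real"
  assumes q: "blip S q" and g: "\<And>y. (g has_real_derivative g' y) (at y)"
    and bd: "\<And>R. \<exists>M. \<forall>y. \<bar>y\<bar> \<le> R \<longrightarrow> \<bar>g' y\<bar> \<le> M"
  shows "blip S (\<lambda>z. g (q z))"
proof -
  obtain B L where f: "0 \<le> B" "0 \<le> L" "\<And>z. z \<in> S \<Longrightarrow> norm (q z) \<le> B"
    "\<And>z z'. z \<in> S \<Longrightarrow> z' \<in> S \<Longrightarrow> norm (q z - q z') \<le> L * dist z z'" by (rule blipE[OF q]) blast
  obtain M where M: "\<And>y. \<bar>y\<bar> \<le> B \<Longrightarrow> \<bar>g' y\<bar> \<le> M" using bd by blast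
  have M0: "0 \<le> M" using M[of 0] f(1) by auto
  have lip: "\<bar>g x - g y\<bar> \<le> M * \<bar>x - y\<bar>" if "\<bar>x\<bar> \<le> B" "\<bar>y\<bar> \<le> B" for x y
    using field_differentiable_bound[of "{-B..B}" g g' M x y] g M that
    by (auto simp: abs_le_iff intro: has_field_derivative_at_within)
  show ?thesis
  proof (rule blipI[where B = "\<bar>g 0\<bar> + M * B" and L = "M * L"])
    show "norm (g (q z)) \<le> \<bar>g 0\<bar> + M * B" if "z \<in> S" for z
      using lip[of "q z" 0] f(1) f(3)[OF that] mult_left_mono[OF f(3)[OF that] M0] by simp
    show "(M * L)-lipschitz_on S (\<lambda>z. g (q z))"
    proof (rule lipschitz_onI)
      fix x y assume xy: "x \<in> S" "y \<in> S"
      then show "dist (g (q x)) (g (q y)) \<le> M * L * dist x y"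
        using lip[of "q x" "q y"] f(3) mult_left_mono[OF f(4)[OF xy] M0] by (force simp: dist_norm)
    qed (use f M0 in auto)
  qed
qed

lemma vec_axis_expand: "snd h = (\<Sum>i\<in>UNIV. (snd h $ i) *\<^sub>R axis i (1::real))" for h :: "real \<times> (real ^ 'n::finite)"
  by (auto simp: vec_eq_iff axis_def if_distrib cong: if_cong)

lemma has_derivative_dt_dx:
  fixes f :: "real \<times> (real ^ 'n::finite) \<Rightarrow> real"
  assumes "f differentiable (at z within S)"
  shows "(f has_derivative (\<lambda>h. fst h * dt S f z + snd h \<bullet> (\<chi> i. dx S i f z))) (at z within S)"
proof -
  let ?D = "frechet_derivative f (at z within S)"
  have D: "(f has_derivative ?D) (at z within S)" using assms frechet_derivative_works by blast
  have lin: "linear ?D" by (rule has_derivative_linear[OF D])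
  have "?D h = fst h * dt S f z + snd h \<bullet> (\<chi> i. dx S i f z)" for h
  proof -
    have "h = fst h *\<^sub>R (1, 0) + (\<Sum>i\<in>UNIV. (snd h $ i) *\<^sub>R (0, axis i (1::real)))"
      using vec_axis_expand[of h] by (simp add: prod_eq_iff fst_sum snd_sum)
    then have "?D h = ?D (fst h *\<^sub>R (1, 0) + (\<Sum>i\<in>UNIV. (snd h $ i) *\<^sub>R (0, axis i (1::real))))" by simp
    also have "\<dots> = fst h * ?D (1, 0) + (\<Sum>i\<in>UNIV. (snd h $ i) * ?D (0, axis i 1))"
      using lin by (simp add: linear_add linear_cmul linear_sum del: scaleR_Pair)
    finally show ?thesis by (simp add: dt_def dx_def dderiv_def inner_vec_def)
  qed
  then have "?D = (\<lambda>h. fst h * dt S f z + snd h \<bullet> (\<chi> i. dx S i f z))" by (rule ext)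
  then show ?thesis using D by simp
qed

text \<open>Compactness bounds the derivatives, and on a convex set such a bound is a Lipschitz
  constant.\<close>

lemma blip_C1_on:
  fixes f :: "real \<times> (real ^ 'n::finite) \<Rightarrow> real"
  assumes S: "compact S" "convex S" and f: "C1_on S f"
  shows "blip S f"
proof -
  have cont: "continuous_on S f" "continuous_on S (dt S f)" "continuous_on S (\<lambda>z. (\<chi> i. dx S i f z) :: real ^ 'n)"
    using f unfolding C1_on_def dt_def dx_def
    by (auto intro: differentiable_imp_continuous_on continuous_on_vec_lambda)
  obtain B0 where B0: "\<And>z. z \<in> S \<Longrightarrow> norm (f z) \<le> B0"
    using compact_imp_bounded[OF compact_continuous_image[OF cont(1) S(1)]] by (auto simp: bounded_iff)
  obtain B1 where B1: "\<And>z. z \<in> S \<Longrightarrow> norm (dt S f z) \<le> B1"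
    using compact_imp_bounded[OF compact_continuous_image[OF cont(2) S(1)]] by (auto simp: bounded_iff)
  obtain B2 where B2: "\<And>z. z \<in> S \<Longrightarrow> norm ((\<chi> i. dx S i f z) :: real ^ 'n) \<le> B2"
    using compact_imp_bounded[OF compact_continuous_image[OF cont(3) S(1)]] by (auto simp: bounded_iff)
  show ?thesis
  proof (rule blipI[OF B0, where L = "\<bar>B1\<bar> + \<bar>B2\<bar>"])
    show "(\<bar>B1\<bar> + \<bar>B2\<bar>)-lipschitz_on S f"
    proof (rule lipschitz_onI)
      fix x y assume xy: "x \<in> S" "y \<in> S"
      have "norm (f x - f y) \<le> (\<bar>B1\<bar> + \<bar>B2\<bar>) * norm (x - y)"
      proof (rule differentiable_bound[OF S(2) has_derivative_dt_dx _ xy])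
        fix z assume z: "z \<in> S"
        show "f differentiable at z within S" using f z by (auto simp: C1_on_def differentiable_on_def)
        show "onorm (\<lambda>h. fst h * dt S f z + snd h \<bullet> (\<chi> i. dx S i f z)) \<le> \<bar>B1\<bar> + \<bar>B2\<bar>"
        proof (rule onorm_bound)
          fix h :: "real \<times> (real ^ 'n)"
          have "norm (fst h * dt S f z + snd h \<bullet> (\<chi> i. dx S i f z))
            \<le> norm (fst h) * norm (dt S f z) + norm (snd h) * norm ((\<chi> i. dx S i f z) :: real ^ 'n)"
            by (intro order_trans[OF norm_triangle_ineq] add_mono) (auto simp: abs_mult Cauchy_Schwarz_ineq2)
          also have "\<dots> \<le> norm h * \<bar>B1\<bar> + norm h * \<bar>B2\<bar>"
            using B1[OF z] B2[OF z] norm_fst_le[of "fst h" "snd h"] norm_snd_le[of "snd h" "fst h"]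
            by (intro add_mono mult_mono) auto
          finally show "norm (fst h * dt S f z + snd h \<bullet> (\<chi> i. dx S i f z)) \<le> (\<bar>B1\<bar> + \<bar>B2\<bar>) * norm h"
            by (simp add: algebra_simps)
        qed simp
      qed
      then show "dist (f x) (f y) \<le> (\<bar>B1\<bar> + \<bar>B2\<bar>) * dist x y" by (simp add: dist_norm)
    qed simp
  qed
qed

section \<open>Symmetry of second derivatives\<close>

lemma second_difference_mean_value:
  fixes f :: "'a::real_normed_vector \<Rightarrow> real"
  assumes s: "0 < s" and U: "\<And>x y. 0 \<le> x \<Longrightarrow> x \<le> s \<Longrightarrow> 0 \<le> y \<Longrightarrow> y \<le> s \<Longrightarrow> z + x *\<^sub>R u + y *\<^sub>R v \<in> U"
    and f: "\<And>z. z \<in> U \<Longrightarrow> (f has_derivative D z) (at z)"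
    and Du: "\<And>z. z \<in> U \<Longrightarrow> ((\<lambda>z. D z u) has_derivative E z) (at z)"
  shows "\<exists>x y. 0 < x \<and> x < s \<and> 0 < y \<and> y < s \<and>
    f (z + s *\<^sub>R u + s *\<^sub>R v) - f (z + s *\<^sub>R u) - f (z + s *\<^sub>R v) + f z = s^2 * E (z + x *\<^sub>R u + y *\<^sub>R v) v"
proof -
  define F where "F x = f (z + x *\<^sub>R u + s *\<^sub>R v) - f (z + x *\<^sub>R u)" for x
  have lin: "(g has_derivative G) (at p) \<Longrightarrow> G (r *\<^sub>R w) = r * G w" for g :: "'a \<Rightarrow> real" and G p r w
    by (drule has_derivative_linear) (simp add: linear_cmul)
  have line: "((\<lambda>x. g (p + x *\<^sub>R w + q)) has_real_derivative G w) (at x)"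
    if "(g has_derivative G) (at (p + x *\<^sub>R w + q))" for g :: "'a \<Rightarrow> real" and G p q w x
  proof -
    have "((\<lambda>x. g (p + x *\<^sub>R w + q)) has_derivative (\<lambda>r. G (r *\<^sub>R w))) (at x)"
      by (rule has_derivative_compose[of "\<lambda>x. p + x *\<^sub>R w + q" "\<lambda>r. r *\<^sub>R w" x UNIV g G]) (use that in \<open>auto intro!: derivative_eq_intros\<close>)
    moreover have "(\<lambda>r. G (r *\<^sub>R w)) = (*) (G w)" using lin[OF that] by (simp add: fun_eq_iff)
    ultimately show ?thesis by (simp add: has_field_derivative_def)
  qed
  have dF: "(F has_real_derivative D (z + x *\<^sub>R u + s *\<^sub>R v) u - D (z + x *\<^sub>R u) u) (at x)" if "0 \<le> x" "x \<le> s" for x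
  proof -
    have 1: "z + x *\<^sub>R u + s *\<^sub>R v \<in> U" using that s by (intro U) auto
    have 2: "z + x *\<^sub>R u + 0 \<in> U" using that s U[of x 0] by simp
    show ?thesis
      unfolding F_def using DERIV_diff[OF line[OF f[OF 1]] line[OF f[OF 2]]] by simp
  qed
  obtain x where x: "0 < x" "x < s" "F s - F 0 = (s - 0) * (D (z + x *\<^sub>R u + s *\<^sub>R v) u - D (z + x *\<^sub>R u) u)"
    using MVT2[OF s dF] by blast
  have dG: "((\<lambda>y. D (z + x *\<^sub>R u + y *\<^sub>R v) u) has_real_derivative E (z + x *\<^sub>R u + y *\<^sub>R v) v) (at y)"
    if "0 \<le> y" "y \<le> s" for y
  proof -
    have "z + x *\<^sub>R u + y *\<^sub>R v + 0 \<in> U" using that x U[of x y] by simp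
    from line[OF Du[OF this]] show ?thesis by simp
  qed
  obtain y where y: "0 < y" "y < s"
    "D (z + x *\<^sub>R u + s *\<^sub>R v) u - D (z + x *\<^sub>R u + 0 *\<^sub>R v) u = (s - 0) * E (z + x *\<^sub>R u + y *\<^sub>R v) v"
    using MVT2[OF s dG] by blast
  have "F s - F 0 = s^2 * E (z + x *\<^sub>R u + y *\<^sub>R v) v" using x(3) y(3) by (simp add: power2_eq_square)
  then show ?thesis using x y by (intro exI[of _ x] exI[of _ y]) (simp add: F_def algebra_simps)
qed

text \<open>The second difference over a small parallelogram is symmetric in \<open>u\<close> and
  \<open>v\<close>. The mean value theorem, applied in either order, writes it as \<open>s^2\<close>
  times one of the mixed derivatives at a nearby point, and continuity closes the gap.\<close>

lemma mixed_derivatives_commute: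
  fixes f :: "'a::real_normed_vector \<Rightarrow> real"
  assumes U: "open U" "z \<in> U" and f: "\<And>z. z \<in> U \<Longrightarrow> (f has_derivative D z) (at z)"
    and Du: "\<And>z. z \<in> U \<Longrightarrow> ((\<lambda>z. D z u) has_derivative E z) (at z)"
    and Dv: "\<And>z. z \<in> U \<Longrightarrow> ((\<lambda>z. D z v) has_derivative E' z) (at z)"
    and cont: "continuous_on U (\<lambda>z. E z v)" "continuous_on U (\<lambda>z. E' z u)"
  shows "E z v = E' z u"
proof (rule ccontr)
  assume ne: "E z v \<noteq> E' z u"
  define d where "d = \<bar>E z v - E' z u\<bar> / 2"
  have d: "0 < d" using ne by (simp add: d_def)
  have c: "isCont (\<lambda>z. E z v) z" "isCont (\<lambda>z. E' z u) z"
    using cont U by (auto simp: continuous_on_eq_continuous_at)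
  obtain r1 where r1: "0 < r1" "\<And>p. dist p z < r1 \<Longrightarrow> dist (E p v) (E z v) < d"
    using c(1) d unfolding continuous_at_eps_delta by blast
  obtain r2 where r2: "0 < r2" "\<And>p. dist p z < r2 \<Longrightarrow> dist (E' p u) (E' z u) < d"
    using c(2) d unfolding continuous_at_eps_delta by blast
  obtain r3 where r3: "0 < r3" "ball z r3 \<subseteq> U" using U by (meson openE)
  define r where "r = min r1 (min r2 r3)"
  define s where "s = r / (norm u + norm v + 1)"
  have pos: "0 < norm u + norm v + 1" by (intro add_nonneg_pos add_nonneg_nonneg) auto
  have s: "0 < s" using r1(1) r2(1) r3(1) pos by (simp add: s_def r_def)
  have near: "dist (z + x *\<^sub>R u + y *\<^sub>R v) z < r" if "0 \<le> x" "x \<le> s" "0 \<le> y" "y \<le> s" for x y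
  proof -
    have "dist (z + x *\<^sub>R u + y *\<^sub>R v) z \<le> x * norm u + y * norm v"
      using that norm_triangle_ineq[of "x *\<^sub>R u" "y *\<^sub>R v"] by (simp add: dist_norm add.assoc)
    also have "\<dots> \<le> s * norm u + s * norm v" using that by (intro add_mono mult_right_mono) auto
    also have "\<dots> < s * (norm u + norm v + 1)" using s by (simp add: algebra_simps)
    also have "\<dots> = r" using pos by (simp add: s_def)
    finally show ?thesis .
  qed
  have inU: "z + x *\<^sub>R u + y *\<^sub>R v \<in> U" if "0 \<le> x" "x \<le> s" "0 \<le> y" "y \<le> s" for x y
    using near[OF that] r3 by (auto simp: r_def dist_commute subset_iff)
  obtain x y where xy: "0 < x" "x < s" "0 < y" "y < s"
    "f (z + s *\<^sub>R u + s *\<^sub>R v) - f (z + s *\<^sub>R u) - f (z + s *\<^sub>R v) + f z = s^2 * E (z + x *\<^sub>R u + y *\<^sub>R v) v"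
    using second_difference_mean_value[OF s inU f Du] by blast
  have inU': "z + x *\<^sub>R v + y *\<^sub>R u \<in> U" if "0 \<le> x" "x \<le> s" "0 \<le> y" "y \<le> s" for x y
    using inU[of y x] that by (simp add: algebra_simps)
  obtain x' y' where xy': "0 < x'" "x' < s" "0 < y'" "y' < s"
    "f (z + s *\<^sub>R v + s *\<^sub>R u) - f (z + s *\<^sub>R v) - f (z + s *\<^sub>R u) + f z = s^2 * E' (z + x' *\<^sub>R v + y' *\<^sub>R u) u"
    using second_difference_mean_value[OF s inU' f Dv] by blast
  have "E (z + x *\<^sub>R u + y *\<^sub>R v) v = E' (z + y' *\<^sub>R u + x' *\<^sub>R v) u"
    using xy(5) xy'(5) s by (simp add: algebra_simps)
  moreover have "dist (E (z + x *\<^sub>R u + y *\<^sub>R v) v) (E z v) < d"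
    using near[of x y] xy by (intro r1) (auto simp: r_def)
  moreover have "dist (E' (z + y' *\<^sub>R u + x' *\<^sub>R v) u) (E' z u) < d"
    using near[of y' x'] xy' by (intro r2) (auto simp: r_def)
  ultimately show False unfolding d_def dist_real_def by (auto simp: abs_if split: if_splits)
qed

section \<open>The weight centred at a point outside the cone\<close>

text \<open>The apex \<open>(T, x0)\<close> lies outside the cone, so no singular vertex meets the region \<open>q > 0\<close>.\<close>
locale cone_geometry =
  fixes \<sigma> \<eta> T :: real and x0 :: "real ^ 'n::finite" and S :: "(real \<times> (real ^ 'n)) set"
  assumes \<sigma>: "0 < \<sigma>" "\<sigma> < 1" and \<eta>: "1 + 4 / (1 - \<sigma>) \<le> \<eta>" and T: "0 < T"
    and x0: "norm x0 = (1 + \<sigma>) / 2 * T" and S_def: "S = closure (cone_region \<sigma> \<eta> T)"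
begin

definition K :: "(real \<times> (real ^ 'n)) set" where "K = {(t, x). norm x \<le> \<sigma> * t}"
definition U :: "(real \<times> (real ^ 'n)) set" where "U = {(t, x). norm x < \<sigma> * t \<and> T / \<eta> < t \<and> t < \<eta> * T}"
definition tau where "tau z = fst z - T" for z :: "real \<times> (real ^ 'n)"
definition xi where "xi z = snd z - x0" for z :: "real \<times> (real ^ 'n)"
definition q where "q z = xi z \<bullet> xi z - (tau z)^2" for z

lemma \<eta>_bounds: "4 + (1 - \<sigma>) \<le> \<eta> * (1 - \<sigma>)" "1 < \<eta>" "0 < \<eta>"
proof -
  have "4 / (1 - \<sigma>) * (1 - \<sigma>) = 4" by (rule nonzero_eq_divide_eq[THEN iffD1, OF _ refl]) (use \<sigma> in simp)
  then show "4 + (1 - \<sigma>) \<le> \<eta> * (1 - \<sigma>)"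
    using mult_right_mono[OF \<eta>, of "1 - \<sigma>"] \<sigma> by (simp add: distrib_right)
  have "0 < 4 / (1 - \<sigma>)" using \<sigma> by simp
  then show "1 < \<eta>" "0 < \<eta>" using \<eta> by linarith+
qed

lemma cone_region_eq: "cone_region \<sigma> \<eta> T = U"
  by (auto simp: cone_region_def cone_def U_def divide_inverse mult.commute)

lemma S_closure: "S = closure U" by (simp add: S_def cone_region_eq)

lemma open_U: "open U"
  unfolding U_def case_prod_beta' by (intro open_Collect_conj open_Collect_less continuous_intros)

lemma convex_U: "convex U"
proof (rule convexI)
  fix z w :: "real \<times> (real ^ 'n)" and u v :: real
  assume a: "z \<in> U" "w \<in> U" "0 \<le> u" "0 \<le> v" "u + v = 1"
  have strict: "u * x1 + v * x2 < u * y1 + v * y2" if "x1 < y1" "x2 < y2" for x1 x2 y1 y2 :: real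
  proof (cases "u = 0")
    case True
    then show ?thesis using a that by simp
  next
    case False
    then show ?thesis using a that by (intro add_less_le_mono) (auto intro: mult_left_mono)
  qed
  have "norm (u *\<^sub>R snd z + v *\<^sub>R snd w) \<le> u * norm (snd z) + v * norm (snd w)"
    using a norm_triangle_ineq[of "u *\<^sub>R snd z" "v *\<^sub>R snd w"] by simp
  also have "\<dots> < u * (\<sigma> * fst z) + v * (\<sigma> * fst w)"
    using a by (intro strict) (auto simp: U_def)
  finally have 1: "norm (u *\<^sub>R snd z + v *\<^sub>R snd w) < \<sigma> * (u * fst z + v * fst w)" by (simp add: algebra_simps)
  have 2: "u * (T / \<eta>) + v * (T / \<eta>) < u * fst z + v * fst w"
    "u * fst z + v * fst w < u * (\<eta> * T) + v * (\<eta> * T)"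
    using a by (intro strict; auto simp: U_def)+
  have "u * c + v * c = c" for c using a(5) by (metis distrib_right mult_1)
  with 2 have "T / \<eta> < u * fst z + v * fst w" "u * fst z + v * fst w < \<eta> * T" by metis+
  with 1 show "u *\<^sub>R z + v *\<^sub>R w \<in> U" by (simp add: U_def case_prod_beta')
qed

lemma closed_K: "closed K"
  unfolding K_def case_prod_beta' by (intro closed_Collect_le continuous_intros)

lemma S_subset: "S \<subseteq> K \<inter> {z. T / \<eta> \<le> fst z \<and> fst z \<le> \<eta> * T}"
proof -
  have "closed (K \<inter> {z. T / \<eta> \<le> fst z \<and> fst z \<le> \<eta> * T})"
    by (intro closed_Int closed_K closed_Collect_conj closed_Collect_le continuous_intros)
  then show ?thesis unfolding S_closure by (rule closure_minimal[rotated]) (auto simp: U_def K_def)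
qed

lemma convex_S: "convex S" unfolding S_closure by (intro convex_closure convex_U)

lemma compact_S: "compact S"
proof -
  have "norm z \<le> \<eta> * T + \<sigma> * (\<eta> * T)" if "z \<in> S" for z
  proof -
    have z: "norm (snd z) \<le> \<sigma> * fst z" "T / \<eta> \<le> fst z" "fst z \<le> \<eta> * T"
      using that S_subset by (auto simp: K_def)
    have "0 \<le> T / \<eta>" using T \<eta>_bounds by simp
    moreover have "\<sigma> * fst z \<le> \<sigma> * (\<eta> * T)" using z(3) \<sigma> by simp
    ultimately show ?thesis
      using norm_Pair_le[of "fst z" "snd z"] z by simp
  qed
  then have "bounded S" unfolding bounded_iff by blast
  then show ?thesis by (simp add: compact_eq_bounded_closed S_closure)
qed

lemma in_S: assumes "z \<in> K" "T / \<eta> < fst z" "fst z < \<eta> * T" shows "z \<in> S"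
proof -
  \<comment> \<open>Shrinking the space component moves a point of the lateral boundary strictly
    inside the cone while its time stays fixed.\<close>
  define u where "u k = (fst z, (1 - inverse (real (Suc k))) *\<^sub>R snd z)" for k
  have t: "0 < fst z" using assms(2) T \<eta>_bounds by (smt (verit) divide_pos_pos)
  have "u k \<in> U" for k
  proof -
    have k: "0 \<le> 1 - inverse (real (Suc k))" "1 - inverse (real (Suc k)) < 1"
      by (auto simp: field_simps)
    have "(1 - inverse (real (Suc k))) * norm (snd z) \<le> (1 - inverse (real (Suc k))) * (\<sigma> * fst z)"
      using assms(1) k by (intro mult_left_mono) (auto simp: K_def)
    also have "\<dots> < 1 * (\<sigma> * fst z)" using k t \<sigma> by (intro mult_strict_right_mono) auto
    finally show ?thesis using assms k by (auto simp: u_def U_def)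
  qed
  moreover have "u \<longlonglongrightarrow> (fst z, (1 - 0) *\<^sub>R snd z)"
    unfolding u_def by (intro tendsto_intros LIMSEQ_inverse_real_of_nat)
  ultimately show ?thesis unfolding S_closure closure_sequential by force
qed

lemma U_interior: "U \<subseteq> interior S"
  unfolding S_closure by (intro interior_maximal closure_subset open_U)

lemma U_S: "U \<subseteq> S" unfolding S_closure by (rule closure_subset)

text \<open>On the cone \<open>0 \<le> q z\<close> yields
  \<open>\<bar>t - T\<bar> \<le> \<sigma> * t + norm x0\<close>; the upper bound on \<open>t\<close>
  then uses \<sigma> < 1 and the lower one \<open>norm x0 < T\<close>. The third bound reflects that
  the apex has positive distance from the cone.\<close>

lemma time_bounds:
  assumes "z \<in> K" "0 \<le> q z"
  shows "(1 - \<sigma>) / 4 * T \<le> fst z" "fst z \<le> 2 / (1 - \<sigma>) * T" "(1 - \<sigma>) / 4 * T \<le> norm (xi z)"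
proof -
  have "(tau z)^2 \<le> (norm (xi z))^2" using assms(2) by (simp add: q_def power2_norm_eq_inner)
  then have a: "\<bar>tau z\<bar> \<le> norm (xi z)" by (simp add: abs_le_square_iff[symmetric])
  have b: "norm (xi z) \<le> norm (snd z) + norm x0" unfolding xi_def by (rule norm_triangle_ineq4)
  have x: "norm (snd z) \<le> \<sigma> * fst z" using assms(1) by (auto simp: K_def)
  have c: "\<bar>fst z - T\<bar> \<le> \<sigma> * fst z + (1 + \<sigma>) / 2 * T" using a b x x0 by (simp add: tau_def)
  moreover have "(1 + \<sigma>) / 2 * T \<le> 1 * T" using \<sigma> T by (intro mult_right_mono) auto
  ultimately have "(1 - \<sigma>) * fst z \<le> 2 * T" unfolding left_diff_distrib by linarith
  then show "fst z \<le> 2 / (1 - \<sigma>) * T" using \<sigma> by (simp add: field_simps)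
  have "0 \<le> \<sigma> * fst z" using x norm_ge_zero order_trans by blast
  then have t: "0 \<le> fst z" using \<sigma> by (simp add: zero_le_mult_iff)
  have "\<sigma> * fst z \<le> 1 * fst z" using t \<sigma> by (intro mult_right_mono) auto
  moreover have "T - fst z \<le> \<sigma> * fst z + (1 + \<sigma>) / 2 * T" using c by linarith
  moreover have "(1 + \<sigma>) / 2 * T = T / 2 + \<sigma> * T / 2" "(1 - \<sigma>) / 4 * T = T / 4 - \<sigma> * T / 4"
    by (simp_all add: field_simps)
  ultimately show "(1 - \<sigma>) / 4 * T \<le> fst z" by linarith
  have "norm x0 \<le> norm (xi z) + norm (snd z)"
    using norm_triangle_ineq4[of "snd z" "xi z"] by (simp add: xi_def)
  then have "(1 + \<sigma>) / 2 * T \<le> norm (xi z) + \<sigma> * fst z" using x x0 by simp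
  moreover have "\<sigma> * fst z = \<sigma> * T + \<sigma> * tau z" by (simp add: tau_def algebra_simps)
  moreover have "\<sigma> * tau z \<le> 1 * norm (xi z)"
  proof -
    have "\<sigma> * tau z \<le> \<sigma> * norm (xi z)" using a \<sigma> by (intro mult_left_mono) auto
    also have "\<dots> \<le> 1 * norm (xi z)" using \<sigma> by (intro mult_right_mono) auto
    finally show ?thesis .
  qed
  ultimately show "(1 - \<sigma>) / 4 * T \<le> norm (xi z)" by (simp add: algebra_simps)
qed

text \<open>Here the lower bound on \<eta> enters: the part of the cone with
  \<open>q \<ge> 0\<close> stays strictly between the two truncating time slices, which therefore
  contribute no flux.\<close>

lemma time_gaps: "T / \<eta> < (1 - \<sigma>) / 4 * T" "2 / (1 - \<sigma>) * T < \<eta> * T"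
proof -
  have "1 < (1 - \<sigma>) / 4 * \<eta>" using \<eta>_bounds(1) \<sigma> by (simp add: algebra_simps)
  then have "1 * T < (1 - \<sigma>) / 4 * \<eta> * T" using T by (rule mult_strict_right_mono)
  then show "T / \<eta> < (1 - \<sigma>) / 4 * T" using \<eta>_bounds by (simp add: divide_less_eq mult.commute mult.left_commute)
  have "2 / (1 - \<sigma>) < \<eta>" using \<eta> \<sigma> by (smt (verit) divide_right_mono)
  then show "2 / (1 - \<sigma>) * T < \<eta> * T" using T by (rule mult_strict_right_mono)
qed

lemma time_strict:
  assumes "z \<in> K" "0 \<le> q z"
  shows "T / \<eta> < fst z" "fst z < \<eta> * T"
proof -
  show "T / \<eta> < fst z" "fst z < \<eta> * T" using time_bounds(1,2)[OF assms] time_gaps by linarith+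
qed

lemma q_nonneg_in_S: "z \<in> K \<Longrightarrow> 0 \<le> q z \<Longrightarrow> z \<in> S"
  using in_S time_strict by blast

lemma cone_eq: "cone \<sigma> = {z \<in> K. norm (snd z) < \<sigma> * fst z}"
  by (auto simp: cone_def K_def)

lemma q_nonneg_in_U: "z \<in> cone \<sigma> \<Longrightarrow> 0 \<le> q z \<Longrightarrow> z \<in> U"
  using time_strict[of z] by (auto simp: cone_eq U_def K_def)

lemma tau_xi_bounds:
  assumes "z \<in> S"
  shows "\<bar>tau z\<bar> \<le> (\<eta> + 1) * T" "norm (xi z) \<le> (\<eta> + 1) * T" "q z \<le> ((\<eta> + 1) * T)^2"
proof -
  have z: "norm (snd z) \<le> \<sigma> * fst z" "T / \<eta> \<le> fst z" "fst z \<le> \<eta> * T"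
    using assms S_subset by (auto simp: K_def)
  have "0 \<le> T / \<eta>" using T \<eta>_bounds by simp
  then have t: "0 \<le> fst z" using z by simp
  then show "\<bar>tau z\<bar> \<le> (\<eta> + 1) * T" using z T by (auto simp: tau_def algebra_simps abs_le_iff)
  have "norm (xi z) \<le> norm (snd z) + norm x0" unfolding xi_def by (rule norm_triangle_ineq4)
  also have "\<dots> \<le> 1 * fst z + 1 * T"
    using z(1) t \<sigma> T mult_right_mono[of \<sigma> 1 "fst z"] unfolding x0 by (intro add_mono mult_right_mono) auto
  also have "\<dots> \<le> (\<eta> + 1) * T" using z by (simp add: algebra_simps)
  finally show x: "norm (xi z) \<le> (\<eta> + 1) * T" .
  have "q z \<le> (norm (xi z))^2" by (simp add: q_def power2_norm_eq_inner)
  also have "\<dots> \<le> ((\<eta> + 1) * T)^2" using x by (intro power_mono) auto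
  finally show "q z \<le> ((\<eta> + 1) * T)^2" .
qed

text \<open>Put \<open>\<delta> = (1 - \<sigma>) / 8 * T\<close>. At time \<open>T\<close> the cone
  has distance \<open>4 * \<delta>\<close> from \<open>x0\<close>. In the time window considered
  \<open>\<bar>tau\<bar> \<le> \<delta>\<close> and the distance is still at least
  \<open>3 * \<delta>\<close>, so \<open>q\<close> is at least
  \<open>8 * \<delta>^2\<close>.\<close>

lemma q_ge_near:
  assumes "z \<in> cone_region \<sigma> (1 + (1 - \<sigma>) / 8) T"
  shows "(1 - \<sigma>)^2 / 8 * T^2 \<le> q z"
proof -
  let ?g = "1 + (1 - \<sigma>) / 8"
  have z: "inverse ?g * T < fst z" "fst z < ?g * T" "norm (snd z) < \<sigma> * fst z"
    using assms by (auto simp: cone_region_def cone_def)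
  have "(1 - (1 - \<sigma>) / 8) * ?g \<le> 1" using zero_le_power2[of "1 - \<sigma>"] by (simp add: algebra_simps power2_eq_square)
  moreover have "0 < ?g" using \<sigma> by (simp add: add_pos_nonneg)
  ultimately have "1 - (1 - \<sigma>) / 8 \<le> inverse ?g" by (simp only: inverse_eq_divide pos_le_divide_eq)
  then have "(1 - (1 - \<sigma>) / 8) * T \<le> inverse ?g * T" using T by (intro mult_right_mono) auto
  then have "T - (1 - \<sigma>) / 8 * T \<le> fst z" using z(1) unfolding left_diff_distrib[of 1] by simp
  moreover have "fst z \<le> T + (1 - \<sigma>) / 8 * T" using z(2) unfolding distrib_right by simp
  ultimately have t: "\<bar>tau z\<bar> \<le> (1 - \<sigma>) / 8 * T" unfolding tau_def by linarith
  have "norm x0 \<le> norm (xi z) + norm (snd z)"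
    using norm_triangle_ineq4[of "snd z" "xi z"] by (simp add: xi_def)
  moreover have "\<sigma> * fst z \<le> \<sigma> * T + (1 - \<sigma>) / 8 * T"
  proof -
    have "\<sigma> * fst z \<le> \<sigma> * (?g * T)" using z \<sigma> by (intro mult_left_mono) auto
    also have "\<dots> = \<sigma> * T + \<sigma> * ((1 - \<sigma>) / 8 * T)" by (simp add: distrib_left distrib_right)
    also have "\<dots> \<le> \<sigma> * T + 1 * ((1 - \<sigma>) / 8 * T)" using \<sigma> T by (intro add_left_mono mult_right_mono) auto
    finally show ?thesis by simp
  qed
  moreover have "norm x0 = 4 * ((1 - \<sigma>) / 8 * T) + \<sigma> * T" unfolding x0 by (simp add: field_simps)
  ultimately have x: "3 * ((1 - \<sigma>) / 8 * T) \<le> norm (xi z)" using z(3) by linarith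
  have "0 \<le> (1 - \<sigma>) / 8 * T" using \<sigma> T by simp
  then have "(3 * ((1 - \<sigma>) / 8 * T))^2 \<le> (norm (xi z))^2" using x by (intro power_mono) auto
  moreover have "(tau z)^2 \<le> ((1 - \<sigma>) / 8 * T)^2" using t by (simp add: abs_le_square_iff[symmetric])
  ultimately show ?thesis by (simp add: q_def power2_norm_eq_inner power_mult_distrib power_divide)
qed

lemma blip_tau: "blip S tau" and blip_xi: "blip S xi" and blip_q: "blip S q"
proof -
  have b: "bounded S" using compact_S by (rule compact_imp_bounded)
  show t: "blip S tau" unfolding tau_def by (intro blip_diff blip_const blip_fst b)
  show x: "blip S xi" unfolding xi_def by (intro blip_diff blip_const blip_snd b)
  show "blip S q" unfolding q_def by (intro blip_diff blip_power blip_inner t x)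
qed

lemma q_has_derivative: "(q has_derivative (\<lambda>h. 2 * (xi z \<bullet> snd h) - 2 * (tau z * fst h))) (at z within A)"
  unfolding q_def xi_def tau_def by (auto intro!: derivative_eq_intros simp: inner_commute algebra_simps)

text \<open>The fields are controlled only on \<open>S\<close>, whereas the divergence theorem asks
  for the whole closed cone. Between the set where \<open>f\<close> may be nonzero and the
  complement of \<open>S\<close> there is a time gap \<open>d\<close>, so across it the bound on
  \<open>f\<close> divided by \<open>d\<close> serves as a Lipschitz constant.\<close>

lemma lipschitz_on_K:
  assumes b: "blip S f" and v: "\<And>z. z \<in> K \<Longrightarrow> q z \<le> 0 \<Longrightarrow> f z = 0"
  shows "\<exists>L. L-lipschitz_on K f"
proof -
  obtain B L where f: "0 \<le> B" "0 \<le> L" "\<And>z. z \<in> S \<Longrightarrow> norm (f z) \<le> B"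
    "\<And>z z'. z \<in> S \<Longrightarrow> z' \<in> S \<Longrightarrow> norm (f z - f z') \<le> L * dist z z'" by (rule blipE[OF b]) blast
  define d where "d = min ((1 - \<sigma>) / 4 * T - T / \<eta>) (\<eta> * T - 2 / (1 - \<sigma>) * T)"
  have d: "0 < d" using time_gaps by (simp add: d_def)
  have out: "norm (f z - f w) \<le> B / d * dist z w" if z: "z \<in> S" and w: "w \<in> K" "w \<notin> S" for z w
  proof -
    have fw: "f w = 0" using w q_nonneg_in_S v by (metis linear)
    show ?thesis
    proof (cases "0 < q z")
      case True
      have zK: "z \<in> K" using z S_subset by blast
      have "fst w \<le> T / \<eta> \<or> \<eta> * T \<le> fst w" using in_S[OF w(1)] w(2) by linarith
      then have "d \<le> \<bar>fst z - fst w\<bar>"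
        using time_bounds[OF zK] True by (auto simp: d_def)
      also have "\<dots> \<le> dist z w" by (metis dist_fst_le dist_real_def)
      finally have "B / d * d \<le> B / d * dist z w" using f d by (intro mult_left_mono) auto
      then show ?thesis using f(3)[OF z] d fw by simp
    next
      case False
      then show ?thesis using v[of z] z S_subset fw f d by auto
    qed
  qed
  have "norm (f z - f w) \<le> (L + B / d) * dist z w" if "z \<in> K" "w \<in> K" for z w
  proof -
    have le: "L * dist z w \<le> (L + B / d) * dist z w" "B / d * dist z w \<le> (L + B / d) * dist z w"
      using f d unfolding distrib_right by auto
    consider "z \<in> S" "w \<in> S" | "z \<in> S" "w \<notin> S" | "z \<notin> S" "w \<in> S" | "z \<notin> S" "w \<notin> S" by blast
    then show ?thesis
    proof cases
      case 1 then show ?thesis using f(4) le by (meson order_trans)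
    next
      case 2 then show ?thesis using out that le by (meson order_trans)
    next
      case 3 then show ?thesis using out[of w z] that le by (metis dist_commute norm_minus_commute order_trans)
    next
      case 4
      then have "f z = 0" "f w = 0" using that q_nonneg_in_S v by (metis linear)+
      then show ?thesis using f d by simp
    qed
  qed
  then have "(L + B / d)-lipschitz_on K f" using f d by (intro lipschitz_onI) (auto simp: dist_norm)
  then show ?thesis ..
qed

text \<open>A point of the open cone outside \<open>U\<close> has \<open>q < 0\<close>, an open
  condition under which both fields vanish; derivatives and divergence are therefore extended by
  zero from \<open>U\<close> to the cone.\<close>

lemma divergence_supported:
  assumes b0: "blip S W0" and b1: "blip S W"
    and v: "\<And>z. z \<in> K \<Longrightarrow> q z \<le> 0 \<Longrightarrow> W0 z = 0 \<and> W z = 0"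
    and d0: "\<And>z. z \<in> U \<Longrightarrow> (W0 has_derivative D0 z) (at z)"
    and d1: "\<And>z. z \<in> U \<Longrightarrow> (W has_derivative D1 z) (at z)"
    and dv: "\<And>z. z \<in> U \<Longrightarrow> dv z = D0 z (1, 0) + (\<Sum>i\<in>UNIV. D1 z (0, axis i 1) $ i)"
  shows "set_integrable lborel U dv"
    and "(LINT z:U|lborel. dv z) = (LINT x|lborel. (W (norm x / \<sigma>, x) \<bullet> sgn x) / \<sigma> - W0 (norm x / \<sigma>, x))"
proof -
  obtain L0 L1 where L: "L0-lipschitz_on {(t, x). norm x \<le> \<sigma> * t} W0" "L1-lipschitz_on {(t, x). norm x \<le> \<sigma> * t} W"
    using lipschitz_on_K[OF b0] lipschitz_on_K[OF b1] v unfolding K_def by blast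
  have supp: "W0 (t, x) = 0 \<and> W (t, x) = 0" if "norm x \<le> \<sigma> * t" "\<eta> * T \<le> t" for t x
    using v[of "(t, x)"] time_strict[of "(t, x)"] that by (force simp: K_def)
  let ?D0 = "\<lambda>z. if z \<in> U then D0 z else (\<lambda>h. 0)" and ?D1 = "\<lambda>z. if z \<in> U then D1 z else (\<lambda>h. 0)"
  have Co: "open (cone \<sigma> :: (real \<times> (real ^ 'n)) set)"
    unfolding cone_def case_prod_beta' by (intro open_Collect_less continuous_intros)
  have qc: "continuous_on A q" for A
    unfolding q_def xi_def tau_def by (intro continuous_intros)
  have opn: "open (cone \<sigma> \<inter> {z. q z < 0})"
    by (intro open_Int Co open_Collect_less qc continuous_intros)
  have out: "z \<in> cone \<sigma> \<inter> {z. q z < 0}" if "z \<in> cone \<sigma>" "z \<notin> U" for z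
    using q_nonneg_in_U[OF that(1)] that by (auto simp: not_le[symmetric])
  have zero: "(f has_derivative (\<lambda>h. 0)) (at z)"
    if "z \<in> cone \<sigma>" "z \<notin> U" "\<And>z. z \<in> K \<Longrightarrow> q z \<le> 0 \<Longrightarrow> f z = 0" for z and f :: "_ \<Rightarrow> 'c::real_normed_vector"
    by (rule has_derivative_transform_within_open[where f = "\<lambda>z. 0", OF has_derivative_const opn out[OF that(1,2)]])
       (use that(3) in \<open>auto simp: cone_eq\<close>)
  have e0: "(W0 has_derivative ?D0 z) (at z)" if "z \<in> cone \<sigma>" for z
    using zero[OF that, of W0] d0 v by (cases "z \<in> U") auto
  have e1: "(W has_derivative ?D1 z) (at z)" if "z \<in> cone \<sigma>" for z
    using zero[OF that, of W] d1 v by (cases "z \<in> U") auto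
  let ?dv = "\<lambda>z. if z \<in> U then dv z else 0"
  have UC: "U \<subseteq> cone \<sigma>" by (auto simp: U_def cone_def)
  have eq: "(\<lambda>z. indicator (cone \<sigma>) z *\<^sub>R ?dv z) = (\<lambda>z. indicator U z *\<^sub>R dv z)"
    using UC by (auto simp: indicator_def fun_eq_iff)
  have dv': "?dv z = ?D0 z (1, 0) + (\<Sum>i\<in>UNIV. ?D1 z (0, axis i 1) $ i)" if "z \<in> cone \<sigma>" for z
    using dv by simp
  note main = cone_divergence[where R = "\<eta> * T", OF \<sigma>(1) L supp e0 e1 dv']
  show "set_integrable lborel U dv" using main(1) unfolding set_integrable_def eq .
  show "(LINT z:U|lborel. dv z) = (LINT x|lborel. (W (norm x / \<sigma>, x) \<bullet> sgn x) / \<sigma> - W0 (norm x / \<sigma>, x))"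
    using main(2) unfolding set_lebesgue_integral_def eq .
qed

end

section \<open>The multiplier identity\<close>

text \<open>The algebra of the divergence at one point: \<open>y\<close> is \<open>q\<close>,
  \<open>G\<close>, \<open>G1\<close>, \<open>G2\<close> are the weight and its derivatives,
  \<open>Z\<close> is the scaling derivative of \<phi>, \<open>N\<close> the Minkowski square of the
  gradient, \<open>H\<close> the Hessian term and \<open>ZV\<close> the scaling derivative of
  \<open>V\<close>. The \<open>H\<close> terms cancel, and so do the \<open>N\<close> terms, since
  \<open>1 + (n - 1) / 2 = (n + 1) / 2\<close>. Euler's identities then replace
  \<open>y * G1\<close> and \<open>y * G2\<close> and complete the square, with the defects
  \<open>E2\<close> and \<open>E\<close> left over.\<close>

lemma bulk_identity:
  fixes n b c p V P \<phi> Z N G G1 G2 E2 E y H ZV :: real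
  assumes "y * G1 = b * G + E2" and "y * G2 = (b - 1) * G1 + E" and "c = (n - 1) / 2 + b"
    and r: "r * (p + 1) = 1" and "P * \<phi> = \<Phi>"
  shows "- V * P * (G * Z + ((n - 1) / 2 * G + y * G1) * \<phi>)
      + (G1 * (2 * Z) * Z + G * (N + H) + ((n - 1) / 2 * G1 + G1 + y * G2) * (2 * Z) * \<phi>
          + ((n - 1) / 2 * G + y * G1) * N)
      + (n + 1) * (- (G * N) / 2 + c * G1 * \<phi>^2 + r * (G * V * \<Phi>))
      + (- (G1 * (2 * y) * N + G * (2 * H)) / 2
          + c * (G2 * (2 * y) * \<phi>^2 + G1 * (2 * \<phi> * Z))
          + r * (G1 * (2 * y) * V * \<Phi> + G * ZV * \<Phi> + G * V * ((p + 1) * P * Z)))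
    = 2 * G1 * (Z + c * \<phi>)^2 + 2 * E * \<phi> * (Z + c * \<phi>)
      + \<Phi> * (V * G * ((2 * b + n + 1) * r - c) - V * E2 * (1 - 2 * r) + r * G * ZV)"
proof -
  have rp: "r * (G * V * ((p + 1) * P * Z)) = G * V * P * Z"
    using r by (metis (no_types, opaque_lifting) mult.assoc mult.commute mult_1)
  have n: "n = 2 * c - 2 * b + 1" using assms(3) by (simp add: field_simps)
  have e1: "G1 * (2 * y) = 2 * (b * G + E2)" "G2 * (2 * y) = 2 * ((b - 1) * G1 + E)"
    unfolding assms(1,2)[symmetric] by simp_all
  show ?thesis
    unfolding distrib_left[of r] rp e1 assms(1,2) n assms(5)[symmetric]
    by (simp add: field_simps power2_eq_square)
qed

lemma linear_prod_expand:
  fixes D :: "real \<times> (real ^ 'n::finite) \<Rightarrow> real"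
  assumes "linear D"
  shows "D (s, v) = s * D (1, 0) + (\<Sum>i\<in>UNIV. v $ i * D (0, axis i 1))"
proof -
  have "(s, v) = s *\<^sub>R (1, 0) + (\<Sum>i\<in>UNIV. (v $ i) *\<^sub>R (0, axis i (1::real)))"
    using vec_axis_expand[of "(s, v)"] by (simp add: prod_eq_iff fst_sum snd_sum)
  then have "D (s, v) = D (s *\<^sub>R (1, 0) + (\<Sum>i\<in>UNIV. (v $ i) *\<^sub>R (0, axis i (1::real))))" by simp
  also have "\<dots> = s * D (1, 0) + (\<Sum>i\<in>UNIV. v $ i * D (0, axis i 1))"
    using assms by (simp add: linear_add linear_cmul linear_sum del: scaleR_Pair)
  finally show ?thesis .
qed

lemma vec_lambda_has_derivative:
  assumes "\<And>i. ((\<lambda>z. f i z) has_derivative (\<lambda>h. f' i h)) F"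
  shows "((\<lambda>z. (\<chi> i. f i z) :: real ^ 'n::finite) has_derivative (\<lambda>h. \<chi> i. f' i h)) F"
proof -
  have *: "(\<lambda>z. (\<chi> i. g i z) :: real ^ 'n) = (\<lambda>z. \<Sum>i\<in>UNIV. g i z *\<^sub>R axis i 1)" for g :: "'n \<Rightarrow> 'b \<Rightarrow> real"
    by (auto simp: fun_eq_iff vec_eq_iff axis_def if_distrib cong: if_cong)
  show ?thesis unfolding * by (intro has_derivative_sum has_derivative_scaleR_left assms)
qed

text \<open>Positive and negative parts of \<open>y\<close> are treated separately; each is a zero
  extension of a power with exponent above 1.\<close>

lemma abs_powr_has_derivative:
  fixes p :: real
  assumes p: "1 \<le> p"
  shows "((\<lambda>y. \<bar>y\<bar> powr (p + 1)) has_real_derivative (p + 1) * (\<bar>y\<bar> powr (p - 1) * y)) (at y)"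
proof -
  define f where "f y = (if y \<le> 0 then 0 else y powr (p + 1))" for y :: real
  define f' where "f' y = (if y \<le> 0 then 0 else (p + 1) * y powr p)" for y :: real
  have d: "(f has_real_derivative f' y) (at y)" for y
  proof (rule has_real_derivative_zero_extension[where g = "\<lambda>y. y powr (p + 1)" and a = "p + 1" and B = 1])
    show "((\<lambda>y. y powr (p + 1)) has_real_derivative f' y) (at y)" if "0 < y" for y
      using that by (auto intro!: derivative_eq_intros simp: f'_def)
  qed (use p in \<open>auto simp: f_def f'_def\<close>)
  have "((\<lambda>y. f (- y)) has_real_derivative f' (- y) * (- 1)) (at y)"
    by (rule DERIV_chain2[OF d]) (auto intro!: derivative_eq_intros)
  then have "((\<lambda>y. f y + f (- y)) has_real_derivative f' y + f' (- y) * (- 1)) (at y)"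
    by (intro DERIV_add d)
  moreover have "(\<lambda>y. f y + f (- y)) = (\<lambda>y. \<bar>y\<bar> powr (p + 1))"
    using p by (auto simp: fun_eq_iff f_def abs_if)
  moreover have "u powr p = u powr (p - 1) * u" if "0 < u" for u :: real
    using powr_add[of u "p - 1" 1] that by simp
  then have "f' y + f' (- y) * (- 1) = (p + 1) * (\<bar>y\<bar> powr (p - 1) * y)"
    by (auto simp: f'_def abs_if)
  ultimately show ?thesis by simp
qed

lemma abs_powr_derivative_bound:
  fixes p :: real
  assumes "1 \<le> p" shows "\<exists>M. \<forall>y. \<bar>y\<bar> \<le> R \<longrightarrow> \<bar>(p + 1) * (\<bar>y\<bar> powr (p - 1) * y)\<bar> \<le> M"
proof (intro exI[of _ "(p + 1) * (R powr (p - 1) * R)"] allI impI)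
  fix y :: real assume "\<bar>y\<bar> \<le> R"
  then show "\<bar>(p + 1) * (\<bar>y\<bar> powr (p - 1) * y)\<bar> \<le> (p + 1) * (R powr (p - 1) * R)"
    using assms by (auto simp: abs_mult intro!: mult_mono powr_mono2)
qed

lemma wt2_bounded:
  assumes "0 < b" "b \<le> 1" "0 < e"
  shows "\<exists>M. \<forall>y. \<bar>y\<bar> \<le> R \<longrightarrow> \<bar>wt2 b e y\<bar> \<le> M"
    and "\<exists>M. \<forall>y. \<bar>y\<bar> \<le> R \<longrightarrow> \<bar>wt1 b e y\<bar> \<le> M"
proof -
  show 2: "\<exists>M. \<forall>y. \<bar>y\<bar> \<le> R \<longrightarrow> \<bar>wt2 b e y\<bar> \<le> M"
    using wt2_abs_le[OF assms, of _ "\<bar>R\<bar>"] by (intro exI[of _ "9 * \<bar>R\<bar> powr b / e^2"]) auto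
  have "continuous_on {-\<bar>R\<bar>..\<bar>R\<bar>} (wt1 b e)"
    using DERIV_isCont[OF wt1_deriv[OF assms]] by (blast intro: continuous_at_imp_continuous_on)
  then have "bounded (wt1 b e ` {-\<bar>R\<bar>..\<bar>R\<bar>})" by (intro compact_imp_bounded compact_continuous_image compact_Icc)
  then obtain M where "\<forall>y\<in>{-\<bar>R\<bar>..\<bar>R\<bar>}. \<bar>wt1 b e y\<bar> \<le> M" by (auto simp: bounded_iff)
  then show "\<exists>M. \<forall>y. \<bar>y\<bar> \<le> R \<longrightarrow> \<bar>wt1 b e y\<bar> \<le> M" by (intro exI[of _ M]) (auto simp: abs_le_iff)
qed

context cone_geometry
begin

lemma blip_wt:
  assumes "0 < b" "b \<le> 1" "0 < e"
  shows "blip S (\<lambda>z. wt b e (q z))" "blip S (\<lambda>z. wt1 b e (q z))"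
  by (rule blip_compose_real[OF blip_q wt_deriv[OF assms] wt2_bounded(2)[OF assms]]
      blip_compose_real[OF blip_q wt1_deriv[OF assms] wt2_bounded(1)[OF assms]])+

end

locale wave_field = cone_geometry \<sigma> \<eta> T x0 S
  for \<sigma> \<eta> T :: real and x0 :: "real ^ 'n::finite" and S +
  fixes p b :: real and V \<phi> :: "real \<times> (real ^ 'n) \<Rightarrow> real"
  assumes p: "1 \<le> p" and b: "0 < b" "b \<le> 1" and V: "C1_on S V" and \<phi>: "C2_on S \<phi>"
    and wave: "\<And>z. z \<in> S \<Longrightarrow> wave_op S \<phi> z + V z * \<bar>\<phi> z\<bar> powr (p - 1) * \<phi> z = 0"
begin

definition nn where "nn = real CARD('n)"
definition cc where "cc = (nn - 1) / 2 + b"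
definition rr where "rr = 1 / (p + 1)"
definition pt where "pt = dt S \<phi>"
definition px where "px z = (\<chi> i. dx S i \<phi> z)" for z
definition Phi where "Phi z = \<bar>\<phi> z\<bar> powr (p + 1)" for z
definition Zp where "Zp z = tau z * pt z + xi z \<bullet> px z" for z
definition NN where "NN z = px z \<bullet> px z - (pt z)^2" for z
text \<open>The zeroth order coefficient that makes the \<open>NN\<close> terms of the divergence
  cancel for an arbitrary weight. For the pure power \<open>y powr b\<close> it is
  \<open>cc * y powr b\<close>.\<close>

definition QQ where "QQ e y = (nn - 1) / 2 * wt b e y + y * wt1 b e y" for e y
definition A1 where "A1 e z = wt b e (q z) * Zp z + QQ e (q z) * \<phi> z" for e z
definition A2 where "A2 e z = - (wt b e (q z) * NN z) / 2 + cc * wt1 b e (q z) * (\<phi> z)^2 + rr * (wt b e (q z) * V z * Phi z)" for e z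
text \<open>\<open>(W0, W)\<close> is the current of the multiplier \<open>wt b e q * Zp + QQ e q * \<phi>\<close>, where \<open>Zp\<close> is the derivative
  of \<open>\<phi>\<close> along the scaling field of the apex. The summand with \<open>cc\<close> completes the square in its divergence.\<close>
definition W0 where "W0 e z = - pt z * A1 e z + tau z * A2 e z" for e z
definition W where "W e z = A1 e z *\<^sub>R px z + A2 e z *\<^sub>R xi z" for e z
definition bulk where "bulk e z = 2 * wt1 b e (q z) * (Zp z + cc * \<phi> z)^2 + 2 * wt_err1 b e (q z) * \<phi> z * (Zp z + cc * \<phi> z)
  + Phi z * (V z * wt b e (q z) * ((2 * b + nn + 1) * rr - cc) - V z * wt_err b e (q z) * (1 - 2 * rr)
    + rr * wt b e (q z) * (tau z * dt S V z + xi z \<bullet> (\<chi> i. dx S i V z)))" for e z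

lemma C1_derivs: "C1_on S \<phi>" "C1_on S pt" "C1_on S (dx S i \<phi>)"
  using \<phi> unfolding C2_on_def pt_def dt_def dx_def by auto

lemma C1_has_derivative:
  assumes "C1_on S f" "z \<in> U"
  shows "(f has_derivative (\<lambda>h. fst h * dt S f z + snd h \<bullet> (\<chi> i. dx S i f z))) (at z)"
proof -
  have "z \<in> interior S" "z \<in> S" using assms U_interior U_S by auto
  then have "at z within S = at z" by (intro at_within_interior)
  moreover have "f differentiable (at z within S)"
    using assms(1) \<open>z \<in> S\<close> unfolding C1_on_def differentiable_on_def by blast
  ultimately show ?thesis using has_derivative_dt_dx[of f z S] by simp
qed

lemma px_has_derivative:
  assumes z: "z \<in> U"
  shows "(px has_derivative (\<lambda>h. \<chi> i. fst h * dt S (dx S i \<phi>) z + snd h \<bullet> (\<chi> j. dx S j (dx S i \<phi>) z))) (at z)"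
  unfolding px_def by (rule vec_lambda_has_derivative) (rule C1_has_derivative[OF C1_derivs(3) z])

text \<open>Applied to the scaling field \<open>(tau z, xi z)\<close> and the Minkowski gradient
  \<open>(- pt z, px z)\<close>, it identifies the second order terms produced by \<open>A1\<close>
  and by \<open>A2\<close>.\<close>

lemma hessian_symmetric:
  assumes z: "z \<in> U"
  defines "da \<equiv> \<lambda>z h. fst h * dt S pt z + snd h \<bullet> (\<chi> i. dx S i pt z)"
    and "dB \<equiv> \<lambda>z h. (\<chi> i. fst h * dt S (dx S i \<phi>) z + snd h \<bullet> (\<chi> j. dx S j (dx S i \<phi>) z))"
  shows "fst u * da z v + snd u \<bullet> dB z v = fst v * da z u + snd v \<bullet> dB z u"
proof (rule mixed_derivatives_commute[OF open_U z, where f = \<phi> and D = "\<lambda>z h. fst h * pt z + snd h \<bullet> px z"])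
  have cd: "continuous_on U (dt S f)" "continuous_on U (dx S i f)" if "C1_on S f" for f i
    using that U_S unfolding C1_on_def dt_def dx_def by (auto intro: continuous_on_subset)
  show "(\<phi> has_derivative (\<lambda>h. fst h * pt z + snd h \<bullet> px z)) (at z)" if "z \<in> U" for z
    using C1_has_derivative[OF C1_derivs(1) that] by (simp add: pt_def px_def)
  have D: "((\<lambda>z. fst u * pt z + snd u \<bullet> px z) has_derivative (\<lambda>h. fst u * da z h + snd u \<bullet> dB z h)) (at z)"
    if "z \<in> U" for z u
    unfolding da_def dB_def
    by (intro has_derivative_add has_derivative_mult_right has_derivative_inner_right
        C1_has_derivative[OF C1_derivs(2) that] px_has_derivative[OF that])
  show "((\<lambda>z. fst u * pt z + snd u \<bullet> px z) has_derivative (\<lambda>h. fst u * da z h + snd u \<bullet> dB z h)) (at z)"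
    "((\<lambda>z. fst v * pt z + snd v \<bullet> px z) has_derivative (\<lambda>h. fst v * da z h + snd v \<bullet> dB z h)) (at z)"
    if "z \<in> U" for z using D[OF that] by blast+
  have "continuous_on U (\<lambda>z. fst u * da z v + snd u \<bullet> dB z v)" for u v
    unfolding da_def dB_def by (intro continuous_intros continuous_on_vec_lambda cd C1_derivs)
  then show "continuous_on U (\<lambda>z. fst u * da z v + snd u \<bullet> dB z v)"
    "continuous_on U (\<lambda>z. fst v * da z u + snd v \<bullet> dB z u)" by blast+
qed

lemma blip_basic: "blip S \<phi>" "blip S pt" "blip S px" "blip S V" "blip S Phi" "blip S Zp" "blip S NN"
proof -
  note * = blip_C1_on[OF compact_S convex_S]
  show 1: "blip S \<phi>" "blip S pt" "blip S px" "blip S V"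
    unfolding px_def by (intro * C1_derivs V blip_vec)+
  show "blip S Phi" unfolding Phi_def
    by (rule blip_compose_real[OF 1(1) abs_powr_has_derivative[OF p] abs_powr_derivative_bound[OF p]])
  show "blip S Zp" "blip S NN" unfolding Zp_def NN_def
    by (intro blip_add blip_diff blip_mult blip_inner blip_power blip_tau blip_xi 1)+
qed

lemma blip_A: assumes "0 < e" shows "blip S (A1 e)" "blip S (A2 e)"
proof -
  have half: "blip S f \<Longrightarrow> blip S (\<lambda>z. - f z / 2)" for f :: "_ \<Rightarrow> real"
    using blip_mult[OF blip_const[of S "- 1 / 2"], of f] by simp
  show "blip S (A1 e)" unfolding A1_def QQ_def
    by (intro blip_add blip_mult blip_const blip_basic blip_wt[OF b assms] blip_q)
  show "blip S (A2 e)" unfolding A2_def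
    by (intro half blip_add blip_mult blip_const blip_power blip_basic blip_wt[OF b assms] blip_q)
qed

lemma blip_W: assumes "0 < e" shows "blip S (W0 e)" "blip S (W e)"
proof -
  show "blip S (W0 e)" unfolding W0_def
    by (intro blip_add blip_mult blip_minus blip_A[OF assms] blip_basic blip_tau)
  show "blip S (W e)" unfolding W_def
    by (intro blip_add blip_scaleR blip_A[OF assms] blip_basic blip_xi)
qed

lemma W_zero: "q z \<le> 0 \<Longrightarrow> W0 e z = 0 \<and> W e z = 0"
  by (simp add: W0_def W_def A1_def A2_def QQ_def wt_def wt1_def)

lemma divergence_bulk:
  assumes e: "0 < e" and z: "z \<in> U"
  shows "\<exists>D0 D1. (W0 e has_derivative D0) (at z) \<and> (W e has_derivative D1) (at z) \<and>
    D0 (1, 0) + (\<Sum>i\<in>UNIV. D1 (0, axis i 1) $ i) = bulk e z"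
proof -
  have zS: "z \<in> S" using z U_S by auto
  define da where "da h = fst h * dt S pt z + snd h \<bullet> (\<chi> i. dx S i pt z)" for h
  define dB where "dB h = (\<chi> i. fst h * dt S (dx S i \<phi>) z + snd h \<bullet> (\<chi> j. dx S j (dx S i \<phi>) z))" for h
  define dV where "dV h = fst h * dt S V z + snd h \<bullet> (\<chi> i. dx S i V z)" for h
  define df where "df h = fst h * pt z + snd h \<bullet> px z" for h
  define dq where "dq h = 2 * (xi z \<bullet> snd h) - 2 * (tau z * fst h)" for h
  define P where "P = \<bar>\<phi> z\<bar> powr (p - 1) * \<phi> z"
  let ?G = "wt b e (q z)" and ?G1 = "wt1 b e (q z)" and ?G2 = "wt2 b e (q z)"
  define dZ where "dZ h = fst h * pt z + tau z * da h + (snd h \<bullet> px z + xi z \<bullet> dB h)" for h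
  define dN where "dN h = 2 * (px z \<bullet> dB h) - 2 * (pt z * da h)" for h
  define dA1 where "dA1 h = ?G1 * dq h * Zp z + ?G * dZ h
    + ((nn - 1) / 2 * ?G1 + ?G1 + q z * ?G2) * dq h * \<phi> z + QQ e (q z) * df h" for h
  define dA2 where "dA2 h = - (?G1 * dq h * NN z + ?G * dN h) / 2
    + cc * (?G2 * dq h * (\<phi> z)^2 + ?G1 * (2 * \<phi> z * df h))
    + rr * (?G1 * dq h * V z * Phi z + ?G * dV h * Phi z + ?G * V z * ((p + 1) * P * df h))" for h
  have ha: "(pt has_derivative da) (at z)" unfolding da_def by (rule C1_has_derivative[OF C1_derivs(2) z])
  have hB: "(px has_derivative dB) (at z)" unfolding dB_def by (rule px_has_derivative[OF z])
  have hV: "(V has_derivative dV) (at z)" unfolding dV_def by (rule C1_has_derivative[OF V z])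
  have hf: "(\<phi> has_derivative df) (at z)"
    using C1_has_derivative[OF C1_derivs(1) z] by (simp add: df_def[abs_def] pt_def px_def)
  have hq: "(q has_derivative dq) (at z)" unfolding dq_def by (rule q_has_derivative)
  have hG: "((\<lambda>z. wt b e (q z)) has_derivative (\<lambda>h. dq h * ?G1)) (at z)"
    by (rule DERIV_compose_FDERIV[OF wt_deriv[OF b e] hq])
  have hG1: "((\<lambda>z. wt1 b e (q z)) has_derivative (\<lambda>h. dq h * ?G2)) (at z)"
    by (rule DERIV_compose_FDERIV[OF wt1_deriv[OF b e] hq])
  have hP: "(Phi has_derivative (\<lambda>h. df h * ((p + 1) * P))) (at z)"
    unfolding Phi_def P_def by (rule DERIV_compose_FDERIV[OF abs_powr_has_derivative[OF p] hf])
  have ht: "(tau has_derivative fst) (at z)" unfolding tau_def by (auto intro!: derivative_eq_intros)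
  have hx: "(xi has_derivative snd) (at z)" unfolding xi_def by (auto intro!: derivative_eq_intros)
  have hZ: "(Zp has_derivative dZ) (at z)" unfolding Zp_def
    by (rule derivative_eq_intros ha hB ht hx refl)+ (simp add: dZ_def fun_eq_iff algebra_simps)
  have hN: "(NN has_derivative dN) (at z)" unfolding NN_def
    by (rule derivative_eq_intros ha hB refl)+ (simp add: dN_def fun_eq_iff inner_commute algebra_simps)
  have hA1: "(A1 e has_derivative dA1) (at z)" unfolding A1_def QQ_def
    by (rule derivative_eq_intros hG hG1 hq hZ hf refl)+
       (simp add: dA1_def QQ_def fun_eq_iff algebra_simps)
  have hA2: "(A2 e has_derivative dA2) (at z)" unfolding A2_def
    by (rule derivative_eq_intros hG hG1 hN hf hV hP refl | simp)+
       (simp add: dA2_def fun_eq_iff algebra_simps)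
  define D0 where "D0 h = - da h * A1 e z - pt z * dA1 h + fst h * A2 e z + tau z * dA2 h" for h
  define D1 where "D1 h = dA1 h *\<^sub>R px z + A1 e z *\<^sub>R dB h + (dA2 h *\<^sub>R xi z + A2 e z *\<^sub>R snd h)" for h
  have h0: "(W0 e has_derivative D0) (at z)" unfolding W0_def
    by (rule derivative_eq_intros hA1 hA2 ha ht refl)+ (simp add: D0_def fun_eq_iff algebra_simps)
  have h1: "(W e has_derivative D1) (at z)" unfolding W_def
    by (rule derivative_eq_intros hA1 hA2 hB hx refl)+ (simp add: D1_def fun_eq_iff algebra_simps)
  have box: "- da (1, 0) + (\<Sum>i\<in>UNIV. dB (0, axis i 1) $ i) = - V z * P"
  proof -
    have "wave_op S \<phi> z = - da (1, 0) + (\<Sum>i\<in>UNIV. dB (0, axis i 1) $ i)"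
      by (simp add: wave_op_def da_def dB_def pt_def inner_axis')
    then show ?thesis using wave[OF zS] by (simp add: P_def)
  qed
  have l1: "dA1 (- pt z, px z) = - pt z * dA1 (1, 0) + (\<Sum>i\<in>UNIV. px z $ i * dA1 (0, axis i 1))"
    by (rule linear_prod_expand[OF has_derivative_linear[OF hA1]])
  have l2: "dA2 (tau z, xi z) = tau z * dA2 (1, 0) + (\<Sum>i\<in>UNIV. xi z $ i * dA2 (0, axis i 1))"
    by (rule linear_prod_expand[OF has_derivative_linear[OF hA2]])
  \<comment> \<open>Regrouped by the product rule: the wave operator times \<open>A1\<close>, the
    derivative of \<open>A1\<close> along the Minkowski gradient of \<phi>, and the derivative of
    \<open>A2\<close> along the scaling field, whose divergence is \<open>nn + 1\<close>.\<close>
  have "D0 (1, 0) + (\<Sum>i\<in>UNIV. D1 (0, axis i 1) $ i)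
    = (- da (1, 0) + (\<Sum>i\<in>UNIV. dB (0, axis i 1) $ i)) * A1 e z + dA1 (- pt z, px z)
      + (nn + 1) * A2 e z + dA2 (tau z, xi z)"
    unfolding l1 l2 by (simp add: D0_def D1_def sum.distrib sum_distrib_left nn_def algebra_simps)
  also have "\<dots> = bulk e z"
  proof -
    \<comment> \<open>The Hessian of \<phi> evaluated on the scaling field and the Minkowski
      gradient.\<close>
    let ?H = "tau z * da (- pt z, px z) + xi z \<bullet> dB (- pt z, px z)"
    have sym: "?H = - pt z * da (tau z, xi z) + px z \<bullet> dB (tau z, xi z)"
      using hessian_symmetric[OF z, of "(tau z, xi z)" "(- pt z, px z)"] by (simp add: da_def dB_def)
    have q1: "dq (- pt z, px z) = 2 * Zp z" "dq (tau z, xi z) = 2 * q z"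
      by (simp_all add: dq_def Zp_def q_def power2_eq_square)
    have f1: "df (- pt z, px z) = NN z" "df (tau z, xi z) = Zp z"
      by (simp_all add: df_def Zp_def NN_def power2_eq_square)
    have Z1: "dZ (- pt z, px z) = NN z + ?H" by (simp add: dZ_def NN_def power2_eq_square)
    have N1: "dN (tau z, xi z) = 2 * ?H" unfolding sym by (simp add: dN_def)
    have V1: "dV (tau z, xi z) = tau z * dt S V z + xi z \<bullet> (\<chi> i. dx S i V z)" by (simp add: dV_def)
    have Pf: "P * \<phi> z = Phi z"
    proof (cases "\<phi> z = 0")
      case False
      have "\<bar>\<phi> z\<bar> powr (p + 1) = \<bar>\<phi> z\<bar> powr (p - 1) * \<bar>\<phi> z\<bar> powr 2"
        using powr_add[of "\<bar>\<phi> z\<bar>" "p - 1" 2] by (simp add: add.commute)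
      then show ?thesis using False by (simp add: Phi_def P_def power2_eq_square)
    qed (simp add: Phi_def P_def)
    have rp: "rr * (p + 1) = 1" using p by (simp add: rr_def)
    have "dA1 (- pt z, px z) = ?G1 * (2 * Zp z) * Zp z + ?G * (NN z + ?H)
        + ((nn - 1) / 2 * ?G1 + ?G1 + q z * ?G2) * (2 * Zp z) * \<phi> z + ((nn - 1) / 2 * ?G + q z * ?G1) * NN z"
      unfolding dA1_def q1 f1 Z1 QQ_def ..
    moreover have "dA2 (tau z, xi z) = - (?G1 * (2 * q z) * NN z + ?G * (2 * ?H)) / 2
        + cc * (?G2 * (2 * q z) * (\<phi> z)^2 + ?G1 * (2 * \<phi> z * Zp z))
        + rr * (?G1 * (2 * q z) * V z * Phi z + ?G * dV (tau z, xi z) * Phi z + ?G * V z * ((p + 1) * P * Zp z))"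
      unfolding dA2_def q1 f1 N1 ..
    ultimately show ?thesis
      unfolding box bulk_def V1[symmetric] A1_def A2_def QQ_def
      by (simp only: bulk_identity[OF wt1_euler[OF b e] wt2_euler[OF b e] cc_def rp Pf, where H = ?H])
  qed
  finally show ?thesis using h0 h1 by blast
qed

lemma bulk_integral:
  assumes e: "0 < e"
  shows "set_integrable lborel U (bulk e)"
    and "(LINT z:U|lborel. bulk e z)
      = (LINT x|lborel. (W e (norm x / \<sigma>, x) \<bullet> sgn x) / \<sigma> - W0 e (norm x / \<sigma>, x))"
proof -
  have "\<forall>z\<in>U. \<exists>D. (W0 e has_derivative fst D) (at z) \<and> (W e has_derivative snd D) (at z) \<and>
      fst D (1, 0) + (\<Sum>i\<in>UNIV. snd D (0, axis i 1) $ i) = bulk e z"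
  proof
    fix z assume "z \<in> U"
    from divergence_bulk[OF e this] obtain D0 D1 where "(W0 e has_derivative D0) (at z) \<and> (W e has_derivative D1) (at z) \<and>
      D0 (1, 0) + (\<Sum>i\<in>UNIV. D1 (0, axis i 1) $ i) = bulk e z" by (elim exE)
    then show "\<exists>D. (W0 e has_derivative fst D) (at z) \<and> (W e has_derivative snd D) (at z) \<and>
      fst D (1, 0) + (\<Sum>i\<in>UNIV. snd D (0, axis i 1) $ i) = bulk e z"
      by (intro exI[of _ "(D0, D1)"]) simp
  qed
  from bchoice[OF this] obtain D where D': "\<forall>z\<in>U. (W0 e has_derivative fst (D z)) (at z) \<and> (W e has_derivative snd (D z)) (at z) \<and>
      fst (D z) (1, 0) + (\<Sum>i\<in>UNIV. snd (D z) (0, axis i 1) $ i) = bulk e z" by (elim exE)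
  have D: "\<And>z. z \<in> U \<Longrightarrow> (W0 e has_derivative fst (D z)) (at z)"
    "\<And>z. z \<in> U \<Longrightarrow> (W e has_derivative snd (D z)) (at z)"
    "\<And>z. z \<in> U \<Longrightarrow> bulk e z = fst (D z) (1, 0) + (\<Sum>i\<in>UNIV. snd (D z) (0, axis i 1) $ i)"
    using D' by simp_all
  note main = divergence_supported[OF blip_W[OF e] W_zero D]
  show "set_integrable lborel U (bulk e)" by (rule main(1))
  show "(LINT z:U|lborel. bulk e z)
      = (LINT x|lborel. (W e (norm x / \<sigma>, x) \<bullet> sgn x) / \<sigma> - W0 e (norm x / \<sigma>, x))"
    by (rule main(2))
qed

end

section \<open>A trace inequality on the lateral boundary\<close>

context cone_geometry
begin

definition gr :: "real ^ 'n \<Rightarrow> real \<times> (real ^ 'n)" where "gr x = (norm x / \<sigma>, x)"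
definition Sh :: "(real ^ 'n) set" where "Sh = {x. T / \<eta> < norm x / \<sigma> \<and> norm x / \<sigma> < \<eta> * T}"

lemma gr_K: "gr x \<in> K" using \<sigma> by (simp add: gr_def K_def)

lemma gr_S: "x \<in> Sh \<Longrightarrow> gr x \<in> S"
  by (rule in_S[OF gr_K]) (auto simp: gr_def Sh_def)

lemma q_Sh: "0 \<le> q (gr x) \<Longrightarrow> x \<in> Sh"
  using time_strict[OF gr_K, of x] by (simp add: Sh_def gr_def)

lemma open_Sh: "open Sh"
  unfolding Sh_def using \<sigma> by (intro open_Collect_conj open_Collect_less continuous_intros) auto

lemma Sh_nonzero: "x \<in> Sh \<Longrightarrow> x \<noteq> 0"
  using T \<eta>_bounds by (auto simp: Sh_def divide_less_0_iff)

lemma gr_lipschitz: "dist (gr x) (gr y) \<le> (1 / \<sigma> + 1) * dist x y"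
proof -
  have "\<bar>norm x / \<sigma> - norm y / \<sigma>\<bar> \<le> norm (x - y) / \<sigma>"
    using \<sigma> norm_triangle_ineq3[of x y] by (simp add: diff_divide_distrib[symmetric] divide_right_mono)
  then show ?thesis
    using norm_Pair_le[of "norm x / \<sigma> - norm y / \<sigma>" "x - y"] by (simp add: gr_def dist_norm distrib_right)
qed

lemma gr_continuous: "continuous_on A gr"
  unfolding gr_def using \<sigma> by (intro continuous_intros) auto

lemma Sh_integrable:
  assumes "blip S f"
  shows "set_integrable lborel Sh (\<lambda>x. f (gr x) :: real)"
proof -
  obtain B L where f: "0 \<le> B" "\<And>z. z \<in> S \<Longrightarrow> norm (f z) \<le> B" "L-lipschitz_on S f" by (rule blipE[OF assms]) blast
  have "continuous_on Sh (\<lambda>x. f (gr x))"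
    by (rule continuous_on_compose2[OF lipschitz_on_continuous_on[OF f(3)] gr_continuous]) (auto intro: gr_S)
  then have "(\<lambda>x. indicator Sh x *\<^sub>R f (gr x)) \<in> borel_measurable borel"
    by (rule borel_measurable_continuous_on_indicator[rotated]) (use open_Sh in auto)
  then show ?thesis unfolding set_integrable_def
  proof (rule integrable_bounded_support[where B = B and R = "\<sigma> * (\<eta> * T)"])
    show "\<bar>indicator Sh x *\<^sub>R f (gr x)\<bar> \<le> B" for x
      using f(1) f(2)[OF gr_S] by (auto simp: indicator_def)
    show "indicator Sh x *\<^sub>R f (gr x) = 0" if "norm x > \<sigma> * (\<eta> * T)" for x
      using that \<sigma> by (auto simp: Sh_def indicator_def field_simps)
  qed
qed

lemma vanishing_eq_Sh:
  assumes "\<And>z. z \<in> K \<Longrightarrow> q z \<le> 0 \<Longrightarrow> f z = 0"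
  shows "f (gr x) = indicator Sh x * (f (gr x) :: real)"
  using assms[OF gr_K, of x] q_Sh[of x] by (cases "q (gr x) \<le> 0") auto

text \<open>Along each ray of the lateral boundary \<open>q\<close> is a quadratic polynomial of positive discriminant, so its
  derivative cannot be small where \<open>q\<close> is.\<close>
lemma gr_radial_identity:
  assumes z: "z = gr x"
  defines "m \<equiv> 2 * (snd z \<bullet> xi z - fst z * tau z)"
  shows "(fst z)^2 * T^2 * (1 - \<sigma>)^2 \<le> m^2 + 4 * (1 - \<sigma>^2) * (fst z)^2 * q z"
proof -
  define t where "t = fst z"
  define u where "u = x \<bullet> x0"
  define k where "k = (1 + \<sigma>) / 2"
  have t: "norm x = \<sigma> * t" "0 \<le> t" using \<sigma> by (simp_all add: t_def z gr_def)
  have xx: "x \<bullet> x = \<sigma>^2 * t^2" using t by (simp add: power2_norm_eq_inner[symmetric] power_mult_distrib)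
  have x00: "x0 \<bullet> x0 = k^2 * T^2" unfolding power2_norm_eq_inner[symmetric] x0 k_def by (rule power_mult_distrib)
  have m: "m = 2 * (\<sigma>^2 * t^2 - u - t * (t - T))"
    unfolding m_def by (simp add: z gr_def xi_def tau_def t_def inner_diff_right u_def xx[unfolded t_def z gr_def])
  have q: "q z = \<sigma>^2 * t^2 - 2 * u + k^2 * T^2 - (t - T)^2"
    unfolding q_def xi_def tau_def using xx x00
    by (simp add: z gr_def t_def inner_diff_left inner_diff_right u_def inner_commute)
  \<comment> \<open>For a quadratic polynomial with leading coefficient \<open>A\<close>, the square
    of the derivative minus \<open>4 * A * q\<close> is the discriminant. Here the variable is the
    time along the ray, \<open>A = - (1 - \<sigma>^2)\<close>, and both sides are multiplied by
    \<open>t^2\<close>.\<close>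
  have id: "m^2 + 4 * (1 - \<sigma>^2) * t^2 * q z = 4 * (t * T - u)^2 - 4 * t^2 * (1 - \<sigma>^2) * (T^2 - k^2 * T^2)"
    unfolding m q by (simp add: power2_eq_square algebra_simps)
  \<comment> \<open>The discriminant is smallest on the ray pointing towards \<open>x0\<close>.
    There it is a perfect square, and it is nonzero because \<open>k > \<sigma>\<close>, that is,
    because \<open>x0\<close> lies outside the cone.\<close>
  have "u \<le> norm x * norm x0" unfolding u_def by (rule norm_cauchy_schwarz)
  then have u: "u \<le> t * T * (\<sigma> * k)" unfolding t(1) x0 k_def[symmetric] by (simp add: mult.commute mult.left_commute)
  have sk: "\<sigma> * k \<le> 1" using \<sigma> mult_mono[of \<sigma> 1 k 1] by (simp add: k_def)
  have "0 \<le> t * T * (1 - \<sigma> * k)" using t T sk by simp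
  moreover have "t * T * (1 - \<sigma> * k) \<le> t * T - u" using u by (simp add: algebra_simps)
  ultimately have "(t * T * (1 - \<sigma> * k))^2 \<le> (t * T - u)^2" by (intro power_mono) auto
  moreover have "4 * (t * T * (1 - \<sigma> * k))^2 - 4 * t^2 * (1 - \<sigma>^2) * (T^2 - k^2 * T^2) = t^2 * T^2 * (2 * (k - \<sigma>))^2"
    by (simp add: power2_eq_square algebra_simps)
  moreover have "2 * (k - \<sigma>) = 1 - \<sigma>" by (simp add: k_def field_simps)
  ultimately show ?thesis unfolding id[folded t_def] t_def[symmetric] by simp
qed

end

context wave_field
begin

text \<open>The integrand of the boundary integral that is to bound everything.\<close>

definition Den where "Den z = ((pt z)^2 + px z \<bullet> px z) + Phi z + inverse T ^ 2 * (\<phi> z)^2" for z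

lemma blip_Den: "blip S Den"
  unfolding Den_def by (intro blip_add blip_mult blip_power blip_inner blip_basic blip_const)

definition rad where "rad z = 2 * (snd z \<bullet> xi z - fst z * tau z)" for z

text \<open>\<open>trd\<close> is the divergence of the radial field \<open>wt b e q * rad * \<phi>^2 * x\<close> in the graph coordinates of the
  lateral boundary, \<open>rad\<close> being the radial derivative of \<open>q\<close> there.\<close>
definition trd where "trd e z = wt1 b e (q z) * (rad z)^2 * (\<phi> z)^2
      + wt b e (q z) * (((nn + 1) * rad z + 2 * (snd z \<bullet> snd z - (fst z)^2)) * (\<phi> z)^2
         + 2 * rad z * \<phi> z * (fst z * pt z + snd z \<bullet> px z))" for e z

lemma trace_identity:
  assumes e: "0 < e"
  shows "integrable lborel (\<lambda>x. trd e (gr x))" and "(LINT x|lborel. trd e (gr x)) = 0"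
proof -
  define F where "F z = wt b e (q z) * rad z * (\<phi> z)^2" for z
  define dF where "dF z h = wt1 b e (q z) * (2 * (xi z \<bullet> snd h) - 2 * (tau z * fst h)) * rad z * (\<phi> z)^2
    + wt b e (q z) * (2 * (snd h \<bullet> xi z + snd z \<bullet> snd h - fst h * tau z - fst z * fst h)) * (\<phi> z)^2
    + wt b e (q z) * rad z * (2 * \<phi> z * (fst h * pt z + snd h \<bullet> px z))" for z h :: "real \<times> (real ^ 'n)"
  have bS: "bounded S" using compact_S by (rule compact_imp_bounded)
  have bF: "blip S (\<lambda>z. F z * snd z $ i)" for i
    unfolding F_def rad_def
    by (intro blip_mult blip_diff blip_inner blip_power blip_const blip_fst blip_snd blip_tau blip_xi bS
        blip_wt[OF b e] blip_basic blip_bounded_linear[OF bounded_linear_vec_nth])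
  have F0: "F z = 0" if "q z \<le> 0" for z using that by (simp add: F_def wt_def)
  have derF: "(F has_derivative dF z) (at z within S)" if z: "z \<in> S" for z
  proof -
    have hf: "(\<phi> has_derivative (\<lambda>h. fst h * pt z + snd h \<bullet> px z)) (at z within S)"
      using has_derivative_dt_dx[of \<phi> z S] C1_derivs(1) z by (simp add: C1_on_def differentiable_on_def pt_def px_def)
    have hG: "((\<lambda>z. wt b e (q z)) has_derivative (\<lambda>h. (2 * (xi z \<bullet> snd h) - 2 * (tau z * fst h)) * wt1 b e (q z))) (at z within S)"
      by (rule DERIV_compose_FDERIV[OF wt_deriv[OF b e] q_has_derivative])
    have hr: "(rad has_derivative (\<lambda>h. 2 * (snd h \<bullet> xi z + snd z \<bullet> snd h - fst h * tau z - fst z * fst h))) (at z within S)"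
      unfolding rad_def xi_def tau_def
      by (rule derivative_eq_intros refl)+ (simp add: fun_eq_iff algebra_simps)
    show ?thesis unfolding F_def
      by (rule derivative_eq_intros hf hG hr refl)+ (simp add: dF_def fun_eq_iff algebra_simps)
  qed
  define h where "h i x = F (gr x) * x $ i" for i and x :: "real ^ 'n"
  \<comment> \<open>Splitting at \<open>0 \<le> q\<close> leaves an open set on which
    \<open>h i\<close> vanishes identically, while every point with \<open>0 \<le> q\<close> has the
    neighbourhood \<open>Sh\<close>, which \<open>gr\<close> maps into \<open>S\<close>.\<close>
  define h' where "h' i x = (if 0 \<le> q (gr x) then dF (gr x) (axis i 1 \<bullet> sgn x / \<sigma>, axis i 1) * x $ i + F (gr x) else 0)"
    for i and x :: "real ^ 'n"
  have grd: "(gr has_derivative (\<lambda>h. (h \<bullet> sgn x / \<sigma>, h))) (at x)" if "x \<noteq> 0" for x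
    unfolding gr_def using \<sigma> by (auto intro!: derivative_eq_intros norm_has_derivative_sgn[OF that])
  have hL: "\<exists>L. L-lipschitz_on UNIV (h i)" for i
  proof -
    obtain L where L: "L-lipschitz_on K (\<lambda>z. F z * snd z $ i)"
      using lipschitz_on_K[OF bF] F0 by fastforce
    have "dist (h i x) (h i y) \<le> L * ((1 / \<sigma> + 1) * dist x y)" for x y
    proof -
      have "dist (h i x) (h i y) \<le> L * dist (gr x) (gr y)"
        using lipschitz_onD[OF L gr_K[of x] gr_K[of y]] by (simp add: h_def gr_def)
      also have "\<dots> \<le> L * ((1 / \<sigma> + 1) * dist x y)"
        using lipschitz_on_nonneg[OF L] gr_lipschitz by (intro mult_left_mono)
      finally show ?thesis .
    qed
    then have "(L * (1 / \<sigma> + 1))-lipschitz_on UNIV (h i)"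
      using lipschitz_on_nonneg[OF L] \<sigma> by (intro lipschitz_onI) (auto simp: mult.assoc)
    then show ?thesis ..
  qed
  have h0: "h i x = 0" if "norm x > \<sigma> * (\<eta> * T)" for i x
  proof -
    have "x \<notin> Sh" using that \<sigma> by (auto simp: Sh_def field_simps)
    then have "q (gr x) \<le> 0" using q_Sh[of x] by (meson linear)
    then show ?thesis by (simp add: h_def F0)
  qed
  have qc: "continuous_on A (\<lambda>x. q (gr x))" for A
    by (rule continuous_on_compose2[OF _ gr_continuous, of UNIV])
       (auto simp: q_def xi_def tau_def intro!: continuous_intros)
  have der: "(h i has_derivative (\<lambda>v. (if 0 \<le> q (gr x) then dF (gr x) (v \<bullet> sgn x / \<sigma>, v) * x $ i + F (gr x) * v $ i else 0))) (at x)" for i x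
  proof (cases "0 \<le> q (gr x)")
    case True
    have x: "x \<in> Sh" by (rule q_Sh[OF True])
    have "((\<lambda>x. F (gr x)) has_derivative (\<lambda>v. dF (gr x) (v \<bullet> sgn x / \<sigma>, v))) (at x within Sh)"
      by (rule has_derivative_in_compose2[where t = S, OF derF _ x has_derivative_at_withinI[OF grd[OF Sh_nonzero[OF x]]]])
         (auto intro: gr_S)
    then have "((\<lambda>x. F (gr x)) has_derivative (\<lambda>v. dF (gr x) (v \<bullet> sgn x / \<sigma>, v))) (at x)"
      using at_within_open[OF x open_Sh] by simp
    then have "(h i has_derivative (\<lambda>v. F (gr x) * v $ i + dF (gr x) (v \<bullet> sgn x / \<sigma>, v) * x $ i)) (at x)"
      unfolding h_def by (rule has_derivative_mult[OF _ bounded_linear.has_derivative[OF bounded_linear_vec_nth has_derivative_ident]])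
    then show ?thesis using True by (simp add: add.commute)
  next
    case False
    have o: "open {x. q (gr x) < 0}" by (intro open_Collect_less qc continuous_intros)
    have "(h i has_derivative (\<lambda>v. 0)) (at x)"
      by (rule has_derivative_transform_within_open[where f = "\<lambda>x. 0", OF has_derivative_const o])
         (use False in \<open>auto simp: h_def F0\<close>)
    then show ?thesis using False by simp
  qed
  have int: "integrable lborel (h' i)" "(LINT x|lborel. h' i x) = 0" for i
  proof -
    obtain L where L: "L-lipschitz_on UNIV (h i)" using hL by blast
    have hm: "h i \<in> borel_measurable borel"
      by (rule borel_measurable_continuous_onI[OF lipschitz_on_continuous_on[OF L]])
    have lip: "\<bar>h i (z + r *\<^sub>R axis i 1) - h i z\<bar> \<le> L * \<bar>r\<bar>" for z r
      using lipschitz_onD[OF L, of "z + r *\<^sub>R axis i 1" z] by (simp add: dist_norm norm_axis_1)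
    have ax: "axis i 1 \<noteq> (0 :: real ^ 'n)" by (simp add: axis_eq_0_iff)
    have d: "((\<lambda>r. h i (z + r *\<^sub>R axis i 1)) has_real_derivative h' i z) (at 0)" for z
    proof -
      let ?D = "\<lambda>v. (if 0 \<le> q (gr z) then dF (gr z) (v \<bullet> sgn z / \<sigma>, v) * z $ i + F (gr z) * v $ i else 0)"
      have "((\<lambda>r. h i (z + r *\<^sub>R axis i 1)) has_derivative (\<lambda>r. ?D (r *\<^sub>R axis i 1))) (at 0)"
        by (rule has_derivative_compose[of "\<lambda>r. z + r *\<^sub>R axis i 1" "\<lambda>r. r *\<^sub>R axis i 1" 0 UNIV "h i" ?D])
           (use der[of i z] in \<open>auto intro!: derivative_eq_intros\<close>)
      moreover have "?D (r *\<^sub>R axis i 1) = h' i z * r" for r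
        using linear_cmul[OF has_derivative_linear[OF der[of i z]], of r "axis i 1"]
        by (simp add: h'_def axis_def)
      ultimately show ?thesis by (simp add: has_field_derivative_def)
    qed
    show "integrable lborel (h' i)"
      using integral_directional_derivative_eq_0(1)[OF hm h0 ax lip, where N = "{}" and h' = "h' i"] d by simp
    show "(LINT x|lborel. h' i x) = 0"
      using integral_directional_derivative_eq_0(2)[OF hm h0 ax lip, where N = "{}" and h' = "h' i"] d by simp
  qed
  have sum: "(\<Sum>i\<in>UNIV. h' i x) = trd e (gr x)" for x
  proof (cases "0 \<le> q (gr x)")
    case True
    have x: "x \<in> Sh" by (rule q_Sh[OF True])
    let ?z = "gr x"
    have lin: "linear (\<lambda>v. dF ?z v)" using has_derivative_linear[OF derF[OF gr_S[OF x]]] by simp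
    have lin2: "linear (\<lambda>v. dF ?z (v \<bullet> sgn x / \<sigma>, v))"
    proof -
      have "linear (\<lambda>v::real^'n. (v \<bullet> sgn x / \<sigma>, v))"
        by (rule linearI) (auto simp: inner_add_left add_divide_distrib)
      from linear_compose[OF this lin] show ?thesis by (simp add: o_def)
    qed
    have xe: "x = (\<Sum>i\<in>UNIV. (x $ i) *\<^sub>R axis i 1)" using vec_axis_expand[of "(0, x)"] by simp
    have "dF ?z (x \<bullet> sgn x / \<sigma>, x) = (\<Sum>i\<in>UNIV. x $ i * dF ?z (axis i 1 \<bullet> sgn x / \<sigma>, axis i 1))"
      using arg_cong[OF xe, of "\<lambda>v. dF ?z (v \<bullet> sgn x / \<sigma>, v)"]
      by (simp only: linear_sum[OF lin2] linear_cmul[OF lin2] real_scaleR_def)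
    then have "(\<Sum>i\<in>UNIV. dF ?z (axis i 1 \<bullet> sgn x / \<sigma>, axis i 1) * x $ i) = dF ?z (x \<bullet> sgn x / \<sigma>, x)"
      by (simp only: mult.commute)
    \<comment> \<open>The graph map is homogeneous of degree one, so it carries the radial field
      \<open>x\<close> to the position vector of space-time, which is tangent to the cone.\<close>
    also have "(x \<bullet> sgn x / \<sigma>, x) = ?z"
      using Sh_nonzero[OF x] by (simp add: gr_def sgn_div_norm power2_norm_eq_inner[symmetric] power2_eq_square)
    finally have s: "(\<Sum>i\<in>UNIV. h' i x) = dF ?z ?z + nn * F ?z"
      using True by (simp add: h'_def sum.distrib nn_def)
    show ?thesis using True unfolding s dF_def F_def rad_def trd_def
      by (simp add: algebra_simps power2_eq_square inner_commute)
  qed (simp add: h'_def trd_def wt_def wt1_def)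
  have "(\<lambda>x. trd e (gr x)) = (\<lambda>x. \<Sum>i\<in>UNIV. h' i x)" using sum by (intro ext) (rule sym)
  then show "integrable lborel (\<lambda>x. trd e (gr x))" "(LINT x|lborel. trd e (gr x)) = 0"
    using int by (simp_all only: Bochner_Integration.integral_sum Bochner_Integration.integrable_sum) simp
qed

end

context cone_geometry
begin

lemma U_integrable:
  assumes "blip S f"
  shows "set_integrable lborel U (f :: _ \<Rightarrow> real)"
proof -
  obtain B L where f: "0 \<le> B" "\<And>z. z \<in> S \<Longrightarrow> norm (f z) \<le> B" "L-lipschitz_on S f" by (rule blipE[OF assms]) blast
  obtain R where R: "\<And>z. z \<in> S \<Longrightarrow> norm z \<le> R" using compact_imp_bounded[OF compact_S] by (auto simp: bounded_iff)
  have "continuous_on U f"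
    using lipschitz_on_continuous_on[OF f(3)] U_S by (rule continuous_on_subset)
  then have "(\<lambda>z. indicator U z *\<^sub>R f z) \<in> borel_measurable borel"
    by (rule borel_measurable_continuous_on_indicator[rotated]) (use open_U in auto)
  then show ?thesis unfolding set_integrable_def
  proof (rule integrable_bounded_support[where B = B and R = R])
    show "\<bar>indicator U z *\<^sub>R f z\<bar> \<le> B" for z using f(1) f(2)[of z] U_S by (auto simp: indicator_def)
    show "indicator U z *\<^sub>R f z = 0" if "norm z > R" for z using R[of z] that U_S by (auto simp: indicator_def)
  qed
qed

lemma wt_le_uniform:
  assumes "0 < b" "b \<le> 1" "0 < e" "z \<in> S"
  shows "wt b e (q z) \<le> (((\<eta> + 1) * T)^2) powr b"
proof (cases "0 < q z")
  case True
  then show ?thesis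
    using wt_le[OF assms(1-3) True] powr_mono2[OF _ _ tau_xi_bounds(3)[OF assms(4)], of b] assms(1) by linarith
qed (simp add: wt_def)

end

context wave_field
begin

lemma Phi_nonneg: "0 \<le> Phi z" by (simp add: Phi_def)

lemma Den_ge: "(pt z)^2 + px z \<bullet> px z \<le> Den z" "Phi z \<le> Den z" "(\<phi> z)^2 \<le> T^2 * Den z" "0 \<le> Den z"
proof -
  have 1: "0 \<le> px z \<bullet> px z" "0 \<le> (inverse T)^2 * (\<phi> z)^2" "0 \<le> (pt z)^2" by auto
  with Phi_nonneg[of z] show "(pt z)^2 + px z \<bullet> px z \<le> Den z" "Phi z \<le> Den z" "0 \<le> Den z"
    unfolding Den_def by linarith+
  have "(inverse T)^2 * (\<phi> z)^2 \<le> Den z" using 1 Phi_nonneg[of z] unfolding Den_def by linarith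
  then have "T^2 * ((inverse T)^2 * (\<phi> z)^2) \<le> T^2 * Den z" by (intro mult_left_mono) auto
  then show "(\<phi> z)^2 \<le> T^2 * Den z" using T by (simp add: power_inverse field_simps)
qed

lemma grad_sum_le: "(\<bar>pt z\<bar> + norm (px z))^2 \<le> 2 * Den z" "\<bar>\<phi> z\<bar> * (\<bar>pt z\<bar> + norm (px z)) \<le> 2 * (T * Den z)"
proof -
  have "(\<bar>pt z\<bar> + norm (px z))^2 \<le> 2 * ((pt z)^2 + px z \<bullet> px z)"
    using zero_le_power2[of "\<bar>pt z\<bar> - norm (px z)"]
    by (simp add: power2_sum power2_diff power2_norm_eq_inner)
  also have "\<dots> \<le> 2 * Den z" using Den_ge(1)[of z] by simp
  finally show s: "(\<bar>pt z\<bar> + norm (px z))^2 \<le> 2 * Den z" .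
  let ?s = "\<bar>pt z\<bar> + norm (px z)"
  have "2 * (T * (\<bar>\<phi> z\<bar> * ?s)) \<le> (\<phi> z)^2 + T^2 * ?s^2"
    using zero_le_power2[of "\<bar>\<phi> z\<bar> - T * ?s"] by (simp add: power2_diff power_mult_distrib mult_ac)
  also have "\<dots> \<le> T^2 * Den z + T^2 * (2 * Den z)" using s Den_ge(3)[of z] by (intro add_mono mult_left_mono) auto
  also have "\<dots> \<le> 2 * (T * (2 * (T * Den z)))"
    using mult_nonneg_nonneg[of "T^2" "Den z"] Den_ge(4)[of z] by (simp add: power2_eq_square mult.assoc)
  finally show "\<bar>\<phi> z\<bar> * ?s \<le> 2 * (T * Den z)" using T by simp
qed

lemma nn_ge: "1 \<le> nn" unfolding nn_def by (simp add: Suc_le_eq)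

text \<open>The numerator bounds the lower order terms of \<open>trd\<close>:
  \<open>4 * \<eta> * (\<eta> + 1)\<close> comes from \<open>\<bar>rad\<bar>\<close>, 14 is 2 from
  the derivative of \<open>rad\<close> plus 12 from \<open>4 * (b + 2)\<close>, and the last summand
  comes from the cross term of \<phi> with its derivative. The denominator is the lower bound for
  \<open>rad^2 + 4 * t^2 * q\<close> in units of \<open>T ^ 4\<close>.\<close>

definition "trace_const = (4 * \<eta> * (\<eta> + 1) * (nn + 1) + 14 * \<eta>^2 + 16 * \<eta>^2 * (\<eta> + 1)) / ((1 - \<sigma>) ^ 4 / 16)"
text \<open>A bound for the weight on \<open>S\<close>, uniform in \<open>e\<close>. Its power of
  \<open>T\<close> is cancelled at the end by that in the lower bound for the weight.\<close>

definition "Mb = (((\<eta> + 1) * T)^2) powr b"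

text \<open>The transversality bound \<open>c * T ^ 4 \<le> rad^2 + 4 * t^2 * q\<close> is
  multiplied by \<open>wt1 * \<phi>^2\<close>. The \<open>rad\<close> part is the leading term of
  \<open>trd\<close>; in the \<open>q\<close> part the product \<open>q * wt1\<close> is no worse
  than \<open>wt\<close>. \<open>trd\<close> itself is kept, not estimated, because its integral
  vanishes.\<close>

lemma trace_pointwise:
  assumes e: "0 < e"
  shows "wt1 b e (q (gr x)) * (\<phi> (gr x))^2
    \<le> trd e (gr x) / ((1 - \<sigma>) ^ 4 / 16 * T ^ 4) + trace_const * Mb * (indicator Sh x * Den (gr x))"
proof (cases "0 \<le> q (gr x)")
  case True
  define z where "z = gr x"
  have x: "x \<in> Sh" using q_Sh True .
  have zS: "z \<in> S" and zK: "z \<in> K" unfolding z_def using gr_S[OF x] gr_K .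
  have qz: "0 \<le> q z" using True by (simp add: z_def)
  let ?G = "wt b e (q z)" and ?G1 = "wt1 b e (q z)" and ?t = "fst z" and ?f = "\<phi> z"
  have G: "0 \<le> ?G" "0 \<le> ?G1" "q z * ?G1 \<le> (b + 2) * ?G" "?G \<le> Mb"
    using wt_nonneg[OF b e] wt1_le[OF b e] wt_le_uniform[OF b e zS] by (auto simp: Mb_def)
  have t: "(1 - \<sigma>) / 4 * T \<le> ?t" "?t \<le> \<eta> * T" "0 \<le> ?t"
    using time_bounds(1)[OF zK qz] time_strict[OF zK qz] divide_pos_pos[OF T \<eta>_bounds(3)] by linarith+
  have nx: "norm (snd z) \<le> ?t"
    using zK t \<sigma> mult_right_mono[of \<sigma> 1 ?t] by (auto simp: K_def)
  have tx: "\<bar>tau z\<bar> \<le> (\<eta> + 1) * T" "norm (xi z) \<le> (\<eta> + 1) * T" using tau_xi_bounds[OF zS] by auto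
  have \<eta>T: "0 \<le> \<eta> * T" "0 \<le> (\<eta> + 1) * T" using T \<eta>_bounds by auto
  define m0 where "m0 = 4 * \<eta> * (\<eta> + 1)"
  define N0 where "N0 = (nn + 1) * m0 + 14 * \<eta>^2 + 4 * \<eta> * m0"
  have m0: "0 \<le> m0" using \<eta>_bounds by (simp add: m0_def)
  have m: "\<bar>rad z\<bar> \<le> m0 * T^2"
  proof -
    have "\<bar>snd z \<bullet> xi z\<bar> \<le> (\<eta> * T) * ((\<eta> + 1) * T)"
      using nx t tx \<eta>T by (intro order_trans[OF Cauchy_Schwarz_ineq2] mult_mono) auto
    moreover have "\<bar>?t * tau z\<bar> \<le> (\<eta> * T) * ((\<eta> + 1) * T)"
      using t tx \<eta>T unfolding abs_mult by (intro mult_mono) auto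
    moreover have "m0 * T^2 = 2 * ((\<eta> * T) * ((\<eta> + 1) * T) + (\<eta> * T) * ((\<eta> + 1) * T))"
      by (simp add: m0_def power2_eq_square algebra_simps)
    moreover have "\<bar>2 * (u - v)\<bar> \<le> 2 * (X + X)" if "\<bar>u\<bar> \<le> X" "\<bar>v\<bar> \<le> X" for u v X :: real using that by (auto simp: abs_le_iff)
    ultimately show ?thesis unfolding rad_def by metis
  qed
  define d where "d = ?t * pt z + snd z \<bullet> px z"
  have "\<bar>d\<bar> \<le> (\<eta> * T) * (\<bar>pt z\<bar> + norm (px z))"
  proof -
    have "\<bar>?t * pt z\<bar> \<le> (\<eta> * T) * \<bar>pt z\<bar>" using t unfolding abs_mult by (intro mult_right_mono) auto
    moreover have "\<bar>snd z \<bullet> px z\<bar> \<le> (\<eta> * T) * norm (px z)"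
      using nx t by (intro order_trans[OF Cauchy_Schwarz_ineq2] mult_right_mono) auto
    ultimately show ?thesis
      unfolding d_def distrib_left by (intro order_trans[OF abs_triangle_ineq] add_mono)
  qed
  then have "\<bar>?f\<bar> * \<bar>d\<bar> \<le> \<bar>?f\<bar> * ((\<eta> * T) * (\<bar>pt z\<bar> + norm (px z)))" by (intro mult_left_mono) auto
  also have "\<dots> = (\<eta> * T) * (\<bar>?f\<bar> * (\<bar>pt z\<bar> + norm (px z)))" by simp
  also have "\<dots> \<le> (\<eta> * T) * (2 * (T * Den z))" using grad_sum_le(2) \<eta>T by (intro mult_left_mono)
  finally have fd: "\<bar>?f\<bar> * \<bar>d\<bar> \<le> 2 * \<eta> * T^2 * Den z" by (simp add: power2_eq_square mult_ac)
  have t2: "?t^2 \<le> \<eta>^2 * T^2" using t by (simp add: power_mult_distrib[symmetric] power_mono)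
  have main: "?t^2 * T^2 * (1 - \<sigma>)^2 \<le> (rad z)^2 + 4 * (1 - \<sigma>^2) * ?t^2 * q z"
    using gr_radial_identity[of z x] by (simp add: z_def rad_def)
  have "((1 - \<sigma>) / 4 * T)^2 \<le> ?t^2" using t \<sigma> T by (intro power_mono) auto
  then have "((1 - \<sigma>) / 4 * T)^2 * (T^2 * (1 - \<sigma>)^2) \<le> ?t^2 * (T^2 * (1 - \<sigma>)^2)" by (intro mult_right_mono) auto
  moreover have "(1 - \<sigma>) ^ 4 / 16 * T ^ 4 = ((1 - \<sigma>) / 4 * T)^2 * (T^2 * (1 - \<sigma>)^2)"
    by (simp add: power2_eq_square power4_eq_xxxx)
  moreover have "4 * (1 - \<sigma>^2) * ?t^2 * q z \<le> 4 * 1 * ?t^2 * q z"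
    using qz by (intro mult_right_mono mult_left_mono) auto
  ultimately have d0: "(1 - \<sigma>) ^ 4 / 16 * T ^ 4 \<le> (rad z)^2 + 4 * ?t^2 * q z" using main by (simp add: mult.assoc)
  have "(1 - \<sigma>) ^ 4 / 16 * T ^ 4 * (?G1 * ?f^2) \<le> ((rad z)^2 + 4 * ?t^2 * q z) * (?G1 * ?f^2)"
    using d0 G by (intro mult_right_mono) auto
  \<comment> \<open>The first summand will be completed to \<open>trd e z\<close>; the second is rid
    of \<open>wt1\<close> by \<open>q * wt1 \<le> (b + 2) * wt\<close>.\<close>
  also have "\<dots> = ?G1 * (rad z)^2 * ?f^2 + 4 * ?t^2 * ?f^2 * (q z * ?G1)" by (simp add: algebra_simps)
  also have "\<dots> \<le> ?G1 * (rad z)^2 * ?f^2 + 4 * ?t^2 * ?f^2 * ((b + 2) * ?G)"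
    using G by (intro add_left_mono mult_left_mono) auto
  also have "\<dots> = trd e z + ?G * (- (((nn + 1) * rad z + 2 * (snd z \<bullet> snd z - ?t^2)) * ?f^2 + 2 * rad z * ?f * d)
      + 4 * (b + 2) * ?t^2 * ?f^2)"
    unfolding trd_def d_def by (simp add: algebra_simps)
  also have "\<dots> \<le> trd e z + ?G * (T ^ 4 * Den z * N0)"
  proof (intro add_left_mono mult_left_mono G(1))
    let ?lhs = "- (((nn + 1) * rad z + 2 * (snd z \<bullet> snd z - ?t^2)) * ?f^2 + 2 * rad z * ?f * d) + 4 * (b + 2) * ?t^2 * ?f^2"
    let ?rest = "?lhs \<le> T ^ 4 * Den z * N0"
    have a: "- ((nn + 1) * rad z * ?f^2) \<le> (nn + 1) * (m0 * T^2) * ?f^2"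
    proof -
      have "(nn + 1) * (- rad z) * ?f^2 \<le> (nn + 1) * (m0 * T^2) * ?f^2"
        using m nn_ge by (intro mult_right_mono mult_left_mono) auto
      then show ?thesis by simp
    qed
    have b1: "- (2 * (snd z \<bullet> snd z - ?t^2) * ?f^2) \<le> 2 * (\<eta>^2 * T^2) * ?f^2"
    proof -
      have "?t^2 - snd z \<bullet> snd z \<le> \<eta>^2 * T^2" using t2 inner_ge_zero[of "snd z"] by linarith
      then have "2 * (?t^2 - snd z \<bullet> snd z) * ?f^2 \<le> 2 * (\<eta>^2 * T^2) * ?f^2" by (intro mult_right_mono mult_left_mono) auto
      then show ?thesis by (simp add: algebra_simps)
    qed
    have c: "- (2 * rad z * ?f * d) \<le> 2 * (m0 * T^2) * (2 * \<eta> * T^2 * Den z)"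
    proof -
      have "- (2 * rad z * ?f * d) \<le> \<bar>2 * rad z * ?f * d\<bar>" by simp
      also have "\<dots> = 2 * \<bar>rad z\<bar> * (\<bar>?f\<bar> * \<bar>d\<bar>)" by (simp add: abs_mult)
      also have "\<dots> \<le> 2 * (m0 * T^2) * (2 * \<eta> * T^2 * Den z)"
        by (rule mult_mono[OF mult_left_mono[OF m] fd]) (use m0 in auto)
      finally show ?thesis .
    qed
    have d1: "4 * (b + 2) * ?t^2 * ?f^2 \<le> 12 * (\<eta>^2 * T^2) * ?f^2"
      using b t2 by (intro mult_right_mono mult_mono) auto
    have "?lhs = - ((nn + 1) * rad z * ?f^2) + - (2 * (snd z \<bullet> snd z - ?t^2) * ?f^2) + - (2 * rad z * ?f * d)
        + 4 * (b + 2) * ?t^2 * ?f^2" by (simp only: distrib_right minus_add_distrib)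
    also have "\<dots> \<le> (nn + 1) * (m0 * T^2) * ?f^2 + 2 * (\<eta>^2 * T^2) * ?f^2
        + 2 * (m0 * T^2) * (2 * \<eta> * T^2 * Den z) + 12 * (\<eta>^2 * T^2) * ?f^2"
      by (intro add_mono a b1 c d1)
    also have "\<dots> = ((nn + 1) * m0 + 14 * \<eta>^2) * T^2 * ?f^2 + 4 * \<eta> * m0 * (T^2 * T^2) * Den z"
      by (simp add: algebra_simps)
    also have "\<dots> \<le> ((nn + 1) * m0 + 14 * \<eta>^2) * T^2 * (T^2 * Den z) + 4 * \<eta> * m0 * (T^2 * T^2) * Den z"
      using Den_ge(3) m0 nn_ge by (intro add_right_mono mult_left_mono) auto
    also have "\<dots> = T ^ 4 * Den z * N0"
      by (simp add: N0_def power4_eq_xxxx power2_eq_square algebra_simps)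
    finally show ?rest .
  qed
  also have "\<dots> \<le> trd e z + Mb * (T ^ 4 * Den z * N0)"
    using G(4) Den_ge(4)[of z] m0 nn_ge \<eta>_bounds T unfolding N0_def
    by (intro add_left_mono mult_right_mono mult_nonneg_nonneg add_nonneg_nonneg) auto
  finally have fin: "(1 - \<sigma>) ^ 4 / 16 * T ^ 4 * (?G1 * ?f^2)
      \<le> trd e z + Mb * (T ^ 4 * Den z * N0)" .
  define c0 where "c0 = (1 - \<sigma>) ^ 4 / 16"
  have c0: "0 < c0" "0 < T ^ 4" using \<sigma> T by (simp_all add: c0_def)
  have tc: "trace_const = N0 / c0"
    unfolding trace_const_def N0_def m0_def c0_def by (simp add: algebra_simps power2_eq_square)
  have "?G1 * ?f^2 \<le> (trd e z + Mb * (T ^ 4 * Den z * N0)) / (c0 * T ^ 4)"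
    using fin c0 by (simp add: pos_le_divide_eq c0_def[symmetric] mult_ac)
  also have "\<dots> = trd e z / (c0 * T ^ 4) + trace_const * Mb * Den z"
  proof -
    have "(u + M * (F * D * N)) / (c * F) = u / (c * F) + N / c * M * D" if "0 < c" "0 < F" for u M F D N c :: real
      using that by (simp add: add_divide_distrib)
    then show ?thesis unfolding tc using c0 by blast
  qed
  finally show ?thesis using x by (simp add: z_def c0_def)
next
  case False
  have "0 \<le> trace_const" using nn_ge \<eta>_bounds \<sigma> by (simp add: trace_const_def)
  then have "0 \<le> trace_const * Mb * (indicator Sh x * Den (gr x))"
    using Den_ge(4) by (simp add: Mb_def)
  then show ?thesis using False by (simp add: wt1_def trd_def wt_def)
qed

lemma trace_bound:
  assumes e: "0 < e"
  shows "integrable lborel (\<lambda>x. wt1 b e (q (gr x)) * (\<phi> (gr x))^2)" (is "integrable lborel ?g")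
    and "(LINT x|lborel. wt1 b e (q (gr x)) * (\<phi> (gr x))^2) \<le> trace_const * Mb * (LINT x:Sh|lborel. Den (gr x))"
proof -
  let ?w = "\<lambda>z. wt1 b e (q z) * (\<phi> z)^2"
  have "set_integrable lborel Sh (\<lambda>x. ?w (gr x))"
    by (intro Sh_integrable blip_mult blip_power blip_wt[OF b e] blip_basic)
  moreover have "?w (gr x) = indicator Sh x * ?w (gr x)" for x
    by (rule vanishing_eq_Sh) (simp add: wt1_def)
  then have eq: "?g = (\<lambda>x. indicator Sh x *\<^sub>R ?w (gr x))" by auto
  ultimately show int: "integrable lborel ?g" unfolding set_integrable_def by (subst eq)
  have D: "integrable lborel (\<lambda>x. indicator Sh x * Den (gr x))"
    using Sh_integrable[OF blip_Den] by (simp add: set_integrable_def)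
  have "(LINT x|lborel. ?g x) \<le> (LINT x|lborel. trd e (gr x) / ((1 - \<sigma>) ^ 4 / 16 * T ^ 4) + trace_const * Mb * (indicator Sh x * Den (gr x)))"
    by (intro integral_mono trace_pointwise[OF e] int Bochner_Integration.integrable_add integrable_divide
        integrable_mult_right trace_identity(1)[OF e] D)
  also have "\<dots> = trace_const * Mb * (LINT x|lborel. indicator Sh x * Den (gr x))"
    using trace_identity[OF e] D by simp
  finally show "(LINT x|lborel. ?g x) \<le> trace_const * Mb * (LINT x:Sh|lborel. Den (gr x))"
    by (simp add: set_lebesgue_integral_def)
qed

end

section \<open>The interior estimate\<close>

text \<open>The bound on the gradient of \<open>V\<close> is tuned so that the scaling derivative of
  \<open>V\<close> is at most \<open>kap / (2 * C)\<close>, half of the lower bound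
  \<open>kap / C\<close> for \<open>kap * V\<close>.\<close>

locale wave_estimate = wave_field \<sigma> \<eta> T x0 S p b V \<phi>
  for \<sigma> \<eta> T :: real and x0 :: "real ^ 'n::finite" and S and p b :: real and V \<phi> +
  fixes C kap :: real
  assumes C: "1 < C" and V_bounds: "\<And>z. z \<in> S \<Longrightarrow> inverse C \<le> V z \<and> V z \<le> C"
    and kap_eq: "kap = (2 * b + nn + 1) * rr - cc" and kap: "0 < kap"
    and V_grad: "\<And>z. z \<in> S \<Longrightarrow> grad_norm S V z \<le> kap / (4 * (\<eta> + 1) * C) * inverse T"
begin

lemma rr: "0 < rr" "rr \<le> 1 / 2" "0 \<le> 1 - 2 * rr" "1 - 2 * rr \<le> 1"
  using p by (auto simp: rr_def field_simps)

lemma cc_nonneg: "0 \<le> cc" using nn_ge b by (simp add: cc_def)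

lemma V_derivative_bound:
  assumes z: "z \<in> S"
  shows "\<bar>tau z * dt S V z + xi z \<bullet> (\<chi> i. dx S i V z)\<bar> \<le> kap / (2 * C)"
proof -
  let ?v = "(\<chi> i. dx S i V z)" and ?g = "grad_norm S V z"
  have n: "?v \<bullet> ?v = (\<Sum>i\<in>UNIV. (dx S i V z)^2)" by (simp add: inner_vec_def power2_eq_square)
  have g: "\<bar>dt S V z\<bar> \<le> ?g" "norm ?v \<le> ?g"
    unfolding grad_norm_def n[symmetric] norm_eq_sqrt_inner
    by (auto intro!: real_le_rsqrt real_sqrt_le_mono)
  have "\<bar>tau z * dt S V z\<bar> \<le> ((\<eta> + 1) * T) * ?g"
    using tau_xi_bounds[OF z] g unfolding abs_mult by (intro mult_mono) auto
  moreover have "\<bar>xi z \<bullet> ?v\<bar> \<le> ((\<eta> + 1) * T) * ?g"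
    using tau_xi_bounds[OF z] g by (intro order_trans[OF Cauchy_Schwarz_ineq2] mult_mono) auto
  ultimately have "\<bar>tau z * dt S V z + xi z \<bullet> ?v\<bar> \<le> 2 * ((\<eta> + 1) * T) * ?g" by linarith
  also have "\<dots> \<le> 2 * ((\<eta> + 1) * T) * (kap / (4 * (\<eta> + 1) * C) * inverse T)"
    using V_grad[OF z] \<eta>_bounds T by (intro mult_left_mono) auto
  also have "\<dots> = kap / (2 * C)"
  proof -
    have "2 * (a * T) * (kap / (4 * a * C) * inverse T) = kap / (2 * C)" if "0 < a" for a
      using that T C by (simp add: field_simps)
    moreover have "0 < \<eta> + 1" using \<eta>_bounds by linarith
    ultimately show ?thesis by blast
  qed
  finally show ?thesis .
qed

text \<open>The square is nonnegative and is dropped. Half of \<open>V * kap\<close> pays for the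
  derivative of \<open>V\<close>; the other half is the coefficient that remains. The two defects
  are kept, to be removed in the limit.\<close>

lemma bulk_ge:
  assumes e: "0 < e" and z: "z \<in> S"
  shows "kap / (2 * C) * (wt b e (q z) * Phi z) - 2 * \<bar>wt_err1 b e (q z)\<bar> * \<bar>\<phi> z * (Zp z + cc * \<phi> z)\<bar>
    - C * wt_err b e (q z) * Phi z \<le> bulk e z"
proof -
  let ?G = "wt b e (q z)" and ?E = "wt_err1 b e (q z)" and ?E2 = "wt_err b e (q z)"
  define ZV where "ZV = tau z * dt S V z + xi z \<bullet> (\<chi> i. dx S i V z)"
  have nn: "0 \<le> ?G" "0 \<le> wt1 b e (q z)" "0 \<le> ?E2" using wt_nonneg[OF b e] by auto
  have V: "inverse C \<le> V z" "V z \<le> C" using V_bounds[OF z] by auto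
  have "\<bar>rr * ZV\<bar> \<le> 1 * (kap / (2 * C))"
    using V_derivative_bound[OF z] rr unfolding ZV_def[symmetric] abs_mult by (intro mult_mono) auto
  then have 1: "- (kap / (2 * C)) \<le> rr * ZV" by (simp add: abs_le_iff)
  have "inverse C * kap \<le> V z * kap" using V kap by (intro mult_right_mono) auto
  then have 2: "kap / (2 * C) + kap / (2 * C) \<le> V z * kap" using C by (simp add: field_simps)
  have 3: "V z * ?E2 * (1 - 2 * rr) \<le> C * ?E2"
  proof -
    have "V z * ?E2 * (1 - 2 * rr) \<le> C * ?E2 * 1"
      using V C nn rr by (intro mult_mono mult_nonneg_nonneg) auto
    then show ?thesis by simp
  qed
  have "kap / (2 * C) * ?G \<le> (V z * kap + rr * ZV) * ?G"
    using 1 2 nn by (intro mult_right_mono) auto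
  then have "kap / (2 * C) * ?G - C * ?E2 \<le> V z * ?G * kap - V z * ?E2 * (1 - 2 * rr) + rr * ?G * ZV"
    using 3 by (simp add: algebra_simps)
  then have "Phi z * (kap / (2 * C) * ?G - C * ?E2)
      \<le> Phi z * (V z * ?G * kap - V z * ?E2 * (1 - 2 * rr) + rr * ?G * ZV)"
    using Phi_nonneg by (intro mult_left_mono)
  moreover have "0 \<le> 2 * wt1 b e (q z) * (Zp z + cc * \<phi> z)^2" using nn by simp
  moreover have "- (2 * \<bar>u\<bar> * \<bar>v\<bar>) \<le> 2 * (u * v)" for u v :: real
    using abs_ge_minus_self[of "u * v"] by (simp add: abs_mult)
  then have "- (2 * \<bar>?E\<bar> * \<bar>\<phi> z * (Zp z + cc * \<phi> z)\<bar>) \<le> 2 * ?E * \<phi> z * (Zp z + cc * \<phi> z)"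
    unfolding mult.assoc[of 2 ?E] mult.assoc[of 2 "?E * \<phi> z"] mult.assoc[of ?E "\<phi> z"] by (simp only: mult.assoc)
  ultimately show ?thesis unfolding bulk_def kap_eq[symmetric] ZV_def[symmetric]
    by (simp add: algebra_simps)
qed

definition "flux_const = (1 / \<sigma> + 1) * (2 * (\<eta> + 1 + nn + 3) + (\<eta> + 1) + 2 * (\<eta> + 1) * C)"

text \<open>The only bare \<open>wt1\<close> sits in the \<open>cc\<close> term of
  \<open>A2\<close>. In \<open>A1\<close> it occurs multiplied by \<open>q\<close>, where it is no
  worse than \<open>wt\<close>; everything else is bounded by \<open>Den\<close>.\<close>

lemma flux_pointwise:
  assumes e: "0 < e"
  shows "(W e (gr x) \<bullet> sgn x) / \<sigma> - W0 e (gr x)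
    \<le> flux_const * Mb * T * (indicator Sh x * Den (gr x))
      + (1 / \<sigma> + 1) * 2 * (\<eta> + 1) * cc * T * (wt1 b e (q (gr x)) * (\<phi> (gr x))^2)"
proof (cases "0 < q (gr x)")
  case True
  define z where "z = gr x"
  have x: "x \<in> Sh" using q_Sh True by simp
  have zS: "z \<in> S" unfolding z_def using gr_S[OF x] .
  let ?G = "wt b e (q z)" and ?G1 = "wt1 b e (q z)" and ?f = "\<phi> z"
  define s where "s = \<bar>pt z\<bar> + norm (px z)"
  define R where "R = (\<eta> + 1) * T"
  define F0 where "F0 = 2 * (\<eta> + 1 + nn + 3) + (\<eta> + 1) + 2 * (\<eta> + 1) * C"
  have R: "0 \<le> R" using T \<eta>_bounds by (simp add: R_def)
  have G: "0 \<le> ?G" "0 \<le> ?G1" "q z * ?G1 \<le> (b + 2) * ?G" "?G \<le> Mb"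
    using wt_nonneg[OF b e] wt1_le[OF b e] wt_le_uniform[OF b e zS] by (auto simp: Mb_def)
  have tx: "\<bar>tau z\<bar> \<le> R" "norm (xi z) \<le> R" using tau_xi_bounds[OF zS] by (auto simp: R_def)
  have s0: "0 \<le> s" by (simp add: s_def)
  have Zp: "\<bar>Zp z\<bar> \<le> R * s"
  proof -
    have "\<bar>tau z * pt z\<bar> \<le> R * \<bar>pt z\<bar>" using tx unfolding abs_mult by (intro mult_right_mono) auto
    moreover have "\<bar>xi z \<bullet> px z\<bar> \<le> R * norm (px z)"
      using tx by (intro order_trans[OF Cauchy_Schwarz_ineq2] mult_right_mono) auto
    ultimately show ?thesis unfolding Zp_def s_def distrib_left by (intro order_trans[OF abs_triangle_ineq] add_mono)
  qed
  have QQ: "0 \<le> QQ e (q z)" "QQ e (q z) \<le> (nn + 3) * ?G"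
  proof -
    have "0 \<le> (nn - 1) / 2 * ?G" using nn_ge G by simp
    moreover have "0 \<le> q z * ?G1" using G True by (simp add: z_def)
    ultimately show "0 \<le> QQ e (q z)" by (simp add: QQ_def)
    have "(nn - 1) / 2 * ?G + q z * ?G1 \<le> (nn - 1) / 2 * ?G + (b + 2) * ?G" using G by simp
    also have "\<dots> = ((nn - 1) / 2 + (b + 2)) * ?G" by (simp add: distrib_right)
    also have "\<dots> \<le> (nn + 3) * ?G"
      using nn_ge b by (intro mult_right_mono[OF _ G(1)]) (simp add: field_simps)
    finally show "QQ e (q z) \<le> (nn + 3) * ?G" by (simp add: QQ_def)
  qed
  have A1: "\<bar>A1 e z\<bar> \<le> ?G * (R * s) + (nn + 3) * ?G * \<bar>?f\<bar>"
  proof -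
    have "\<bar>?G * Zp z\<bar> \<le> ?G * (R * s)" using Zp G by (simp add: abs_mult mult_left_mono)
    moreover have "\<bar>QQ e (q z) * ?f\<bar> \<le> (nn + 3) * ?G * \<bar>?f\<bar>"
      unfolding abs_mult using QQ by (intro mult_right_mono) auto
    ultimately show ?thesis unfolding A1_def by (intro order_trans[OF abs_triangle_ineq] add_mono)
  qed
  have NN: "\<bar>NN z\<bar> \<le> Den z"
  proof -
    have "0 \<le> px z \<bullet> px z" "0 \<le> (pt z)^2" by auto
    then show ?thesis using Den_ge(1)[of z] unfolding NN_def abs_le_iff by linarith
  qed
  have A2: "\<bar>A2 e z\<bar> \<le> ?G * Den z / 2 + cc * ?G1 * ?f^2 + ?G * C * Den z"
  proof -
    have "\<bar>- (?G * NN z) / 2\<bar> \<le> ?G * Den z / 2" using NN G by (simp add: abs_mult mult_left_mono)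
    moreover have "\<bar>cc * ?G1 * ?f^2\<bar> \<le> cc * ?G1 * ?f^2" using cc_nonneg G by (simp add: abs_mult)
    moreover have "\<bar>rr * (?G * V z * Phi z)\<bar> \<le> ?G * C * Den z"
    proof -
      have "\<bar>V z\<bar> \<le> C" using V_bounds[OF zS] C by (smt (verit) inverse_positive_iff_positive)
      then have "\<bar>?G * V z * Phi z\<bar> \<le> ?G * C * Den z"
        unfolding abs_mult using G Den_ge[of z] Phi_nonneg[of z] C by (intro mult_mono) auto
      then have "\<bar>rr\<bar> * \<bar>?G * V z * Phi z\<bar> \<le> 1 * (?G * C * Den z)"
        using rr by (intro mult_mono) auto
      then show ?thesis by (simp add: abs_mult)
    qed
    ultimately show ?thesis unfolding A2_def
      by (intro order_trans[OF abs_triangle_ineq] add_mono order_trans[OF abs_triangle_ineq[of "- (?G * NN z) / 2"]])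
  qed
  have W0: "\<bar>W0 e z\<bar> \<le> \<bar>A1 e z\<bar> * s + \<bar>A2 e z\<bar> * R"
  proof -
    have "\<bar>- pt z * A1 e z\<bar> \<le> \<bar>A1 e z\<bar> * s" using mult_left_mono[of "\<bar>pt z\<bar>" s "\<bar>A1 e z\<bar>"] by (simp add: s_def abs_mult mult.commute)
    moreover have "\<bar>tau z * A2 e z\<bar> \<le> \<bar>A2 e z\<bar> * R" using mult_left_mono[OF tx(1), of "\<bar>A2 e z\<bar>"] by (simp add: abs_mult mult.commute)
    ultimately show ?thesis unfolding W0_def by (intro order_trans[OF abs_triangle_ineq] add_mono)
  qed
  have W: "norm (W e z) \<le> \<bar>A1 e z\<bar> * s + \<bar>A2 e z\<bar> * R"
    unfolding W_def using tx(2) by (intro order_trans[OF norm_triangle_ineq] add_mono) (auto simp: s_def mult_left_mono)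
  have A: "\<bar>A1 e z\<bar> * s + \<bar>A2 e z\<bar> * R
    \<le> ?G * (T * Den z) * F0 + 2 * R * cc * (?G1 * ?f^2)"
  proof -
    have "\<bar>A1 e z\<bar> * s \<le> (?G * (R * s) + (nn + 3) * ?G * \<bar>?f\<bar>) * s" using A1 s0 by (rule mult_right_mono)
    also have "\<dots> = ?G * (R * s^2 + (nn + 3) * (\<bar>?f\<bar> * s))" by (simp add: algebra_simps power2_eq_square)
    also have "\<dots> \<le> ?G * (R * (2 * Den z) + (nn + 3) * (2 * (T * Den z)))"
      using grad_sum_le[of z] R nn_ge G unfolding s_def by (intro mult_left_mono add_mono) auto
    also have "\<dots> = ?G * (T * Den z) * (2 * (\<eta> + 1 + nn + 3))" by (simp add: R_def algebra_simps)
    finally have 1: "\<bar>A1 e z\<bar> * s \<le> ?G * (T * Den z) * (2 * (\<eta> + 1 + nn + 3))" .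
    have "\<bar>A2 e z\<bar> * R \<le> (?G * Den z / 2 + cc * ?G1 * ?f^2 + ?G * C * Den z) * R" using A2 R by (rule mult_right_mono)
    also have "\<dots> \<le> 2 * ((?G * Den z / 2 + cc * ?G1 * ?f^2 + ?G * C * Den z) * R)"
    proof -
      have "0 \<le> (?G * Den z / 2 + cc * ?G1 * ?f^2 + ?G * C * Den z) * R"
        using G Den_ge(4)[of z] cc_nonneg C R by (intro mult_nonneg_nonneg add_nonneg_nonneg divide_nonneg_nonneg) auto
      then show ?thesis by linarith
    qed
    also have "\<dots> = ?G * (T * Den z) * ((\<eta> + 1) + 2 * (\<eta> + 1) * C) + 2 * R * cc * (?G1 * ?f^2)"
      by (simp add: R_def algebra_simps)
    finally show ?thesis using 1 unfolding F0_def distrib_left[of "?G * (T * Den z)"] by linarith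
  qed
  have "(W e z \<bullet> sgn x) / \<sigma> - W0 e z \<le> (1 / \<sigma>) * norm (W e z) + \<bar>W0 e z\<bar>"
  proof -
    have "W e z \<bullet> sgn x \<le> norm (W e z) * norm (sgn x)" by (rule norm_cauchy_schwarz)
    also have "\<dots> \<le> norm (W e z) * 1" by (intro mult_left_mono) (auto simp: norm_sgn)
    finally have "(W e z \<bullet> sgn x) / \<sigma> \<le> norm (W e z) / \<sigma>" using \<sigma> by (simp add: divide_right_mono)
    then show ?thesis by simp
  qed
  also have "\<dots> \<le> (1 / \<sigma>) * (\<bar>A1 e z\<bar> * s + \<bar>A2 e z\<bar> * R) + (\<bar>A1 e z\<bar> * s + \<bar>A2 e z\<bar> * R)"
    using W W0 \<sigma> by (intro add_mono mult_left_mono) auto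
  also have "\<dots> = (1 / \<sigma> + 1) * (\<bar>A1 e z\<bar> * s + \<bar>A2 e z\<bar> * R)" by (simp add: distrib_right)
  also have "\<dots> \<le> (1 / \<sigma> + 1) * (?G * (T * Den z) * F0 + 2 * R * cc * (?G1 * ?f^2))"
    using A \<sigma> by (intro mult_left_mono) auto
  also have "\<dots> \<le> (1 / \<sigma> + 1) * (Mb * (T * Den z) * F0 + 2 * R * cc * (?G1 * ?f^2))"
    using G(4) Den_ge(4)[of z] T \<sigma> \<eta>_bounds nn_ge C unfolding F0_def
    by (intro mult_left_mono add_right_mono mult_right_mono mult_nonneg_nonneg add_nonneg_nonneg) auto
  also have "\<dots> = flux_const * Mb * T * Den z + (1 / \<sigma> + 1) * 2 * (\<eta> + 1) * cc * T * (?G1 * ?f^2)"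
  proof -
    have "f * (M * (T * D) * k + 2 * (h * T) * c * X) = f * k * M * T * D + f * 2 * h * c * T * X"
      for f M D k h c X :: real by (simp add: algebra_simps)
    then show ?thesis unfolding flux_const_def R_def F0_def .
  qed
  finally show ?thesis using x by (simp add: z_def)
next
  case False
  have "0 \<le> flux_const" using \<eta>_bounds nn_ge \<sigma> C unfolding flux_const_def by (intro mult_nonneg_nonneg add_nonneg_nonneg) auto
  then have "0 \<le> flux_const * Mb * T * (indicator Sh x * Den (gr x))"
    using Den_ge(4) T by (simp add: Mb_def)
  moreover have "W e (gr x) = 0" "W0 e (gr x) = 0" "wt1 b e (q (gr x)) = 0"
    using W_zero[of "gr x" e] False by (auto simp: wt1_def)
  ultimately show ?thesis by simp
qed

definition "bdry_const = flux_const + (1 / \<sigma> + 1) * 2 * (\<eta> + 1) * cc * trace_const"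

lemma bulk_integral_le:
  assumes e: "0 < e"
  shows "(LINT z:U|lborel. bulk e z) \<le> bdry_const * Mb * T * (LINT x:Sh|lborel. Den (gr x))"
proof -
  let ?I = "LINT x:Sh|lborel. Den (gr x)"
  define k where "k = (1 / \<sigma> + 1) * 2 * (\<eta> + 1) * cc * T"
  have k: "0 \<le> k" using \<sigma> \<eta>_bounds cc_nonneg T by (simp add: k_def)
  have D: "integrable lborel (\<lambda>x. indicator Sh x * Den (gr x))"
    using Sh_integrable[OF blip_Den] by (simp add: set_integrable_def)
  note tb = trace_bound[OF e]
  have "(LINT z:U|lborel. bulk e z) = (LINT x|lborel. (W e (gr x) \<bullet> sgn x) / \<sigma> - W0 e (gr x))"
    using bulk_integral(2)[OF e] by (simp add: gr_def)
  also have "\<dots> \<le> (LINT x|lborel. flux_const * Mb * T * (indicator Sh x * Den (gr x)) + k * (wt1 b e (q (gr x)) * (\<phi> (gr x))^2))"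
  proof (rule integral_mono')
    show "integrable lborel (\<lambda>x. flux_const * Mb * T * (indicator Sh x * Den (gr x)) + k * (wt1 b e (q (gr x)) * (\<phi> (gr x))^2))"
      by (intro Bochner_Integration.integrable_add integrable_mult_right D tb(1))
    show "0 \<le> flux_const * Mb * T * (indicator Sh x * Den (gr x)) + k * (wt1 b e (q (gr x)) * (\<phi> (gr x))^2)" for x
    proof -
      have "0 \<le> flux_const" using \<eta>_bounds nn_ge \<sigma> C unfolding flux_const_def by (intro mult_nonneg_nonneg add_nonneg_nonneg) auto
      then show ?thesis using Den_ge(4) T k wt_nonneg(2)[OF b e]
        by (intro add_nonneg_nonneg mult_nonneg_nonneg) (auto simp: Mb_def)
    qed
  qed (use flux_pointwise[OF e] in \<open>simp add: k_def\<close>)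
  also have "\<dots> = flux_const * Mb * T * ?I + k * (LINT x|lborel. wt1 b e (q (gr x)) * (\<phi> (gr x))^2)"
    using D tb(1) by (simp add: set_lebesgue_integral_def)
  also have "\<dots> \<le> flux_const * Mb * T * ?I + k * (trace_const * Mb * ?I)"
    using tb(2) k by (intro add_left_mono mult_left_mono)
  also have "\<dots> = bdry_const * Mb * T * ?I" unfolding bdry_const_def k_def by (simp add: algebra_simps)
  finally show ?thesis .
qed

text \<open>As \<open>e\<close> tends to 0, \<open>wt1\<close> approaches a multiple of
  \<open>q powr (h - 1)\<close>, which may be unbounded but is integrable. The divergence of the
  spatial field \<open>wt * xi\<close> is at least \<open>2 * wt1\<close> times the square of
  \<open>norm xi\<close>, which is bounded below where \<open>q \<ge> 0\<close>, and the flux of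
  that field is bounded uniformly in \<open>e\<close>.\<close>

lemma wt1_integral_bounded:
  assumes h: "0 < h" "h \<le> 1"
  shows "\<exists>B. \<forall>e>0. (LINT z:U|lborel. wt1 h e (q z)) \<le> B"
proof -
  define M where "M = (((\<eta> + 1) * T)^2) powr h"
  define r where "r = (1 - \<sigma>) / 4 * T"
  have r: "0 < r" using \<sigma> T by (simp add: r_def)
  define J where "J = (LINT x|lborel. indicator Sh x * (M * ((\<eta> + 1) * T) / \<sigma>))"
  have "(LINT z:U|lborel. wt1 h e (q z)) \<le> J / (2 * r^2)" if e: "0 < e" for e
  proof -
    define X where "X z = wt h e (q z) *\<^sub>R xi z" for z
    define dv where "dv z = nn * wt h e (q z) + 2 * wt1 h e (q z) * (xi z \<bullet> xi z)" for z
    define D1 where "D1 z v = ((2 * (xi z \<bullet> snd v) - 2 * (tau z * fst v)) * wt1 h e (q z)) *\<^sub>R xi z + wt h e (q z) *\<^sub>R snd v"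
      for z v :: "real \<times> (real ^ 'n)"
    have b0: "blip S (\<lambda>z. 0::real)" by (rule blip_const)
    have b1: "blip S X" unfolding X_def by (intro blip_scaleR blip_wt[OF h e] blip_xi)
    have dX: "(X has_derivative D1 z) (at z)" for z
    proof -
      have hG: "((\<lambda>z. wt h e (q z)) has_derivative (\<lambda>v. (2 * (xi z \<bullet> snd v) - 2 * (tau z * fst v)) * wt1 h e (q z))) (at z)"
        by (rule DERIV_compose_FDERIV[OF wt_deriv[OF h e] q_has_derivative])
      have hx: "(xi has_derivative snd) (at z)" unfolding xi_def by (auto intro!: derivative_eq_intros)
      show ?thesis unfolding X_def
        by (rule derivative_eq_intros hG hx refl)+ (simp add: D1_def fun_eq_iff algebra_simps)
    qed
    have dvD: "dv z = 0 + (\<Sum>i\<in>UNIV. D1 z (0, axis i 1) $ i)" for z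
    proof -
      have "(\<Sum>i\<in>UNIV. D1 z (0, axis i 1) $ i) = (\<Sum>i\<in>UNIV. 2 * wt1 h e (q z) * (xi z $ i * xi z $ i) + wt h e (q z))"
        by (simp add: D1_def inner_axis mult_ac)
      also have "\<dots> = 2 * wt1 h e (q z) * (xi z \<bullet> xi z) + nn * wt h e (q z)"
        by (simp add: sum.distrib sum_distrib_left inner_vec_def nn_def)
      finally show ?thesis by (simp add: dv_def)
    qed
    have van: "(0::real) = 0 \<and> X z = 0" if "q z \<le> 0" for z using that by (simp add: X_def wt_def)
    note main = divergence_supported[OF b0 b1 van has_derivative_const dX dvD]
    have "2 * r^2 * wt1 h e (q z) \<le> dv z" if z: "z \<in> U" for z
    proof (cases "0 < q z")
      case True
      have "z \<in> K" using z by (auto simp: U_def K_def)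
      then have "r^2 \<le> (norm (xi z))^2" using time_bounds(3)[of z] True r by (intro power_mono) (auto simp: r_def)
      then have "2 * wt1 h e (q z) * r^2 \<le> 2 * wt1 h e (q z) * (xi z \<bullet> xi z)"
        using wt_nonneg[OF h e] by (intro mult_left_mono) (auto simp: power2_norm_eq_inner)
      moreover have "0 \<le> nn * wt h e (q z)" using nn_ge wt_nonneg[OF h e] by simp
      ultimately show ?thesis unfolding dv_def by (simp add: mult.commute mult.left_commute)
    qed (simp add: dv_def wt1_def wt_def)
    moreover have wi: "set_integrable lborel U (\<lambda>z. wt1 h e (q z))" by (rule U_integrable[OF blip_wt(2)[OF h e]])
    ultimately have "(LINT z:U|lborel. 2 * r^2 * wt1 h e (q z)) \<le> (LINT z:U|lborel. dv z)"
      by (intro set_integral_mono main(1) set_integrable_mult_right) auto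
    also have "\<dots> = (LINT x|lborel. (X (gr x) \<bullet> sgn x) / \<sigma>)" using main(2) by (simp add: gr_def)
    also have "\<dots> \<le> J" unfolding J_def
    proof (rule integral_mono')
      show "integrable lborel (\<lambda>x. indicator Sh x * (M * ((\<eta> + 1) * T) / \<sigma>))"
        using Sh_integrable[OF blip_const[of S "M * ((\<eta> + 1) * T) / \<sigma>"]] by (simp add: set_integrable_def)
      have M0: "0 \<le> M * ((\<eta> + 1) * T) / \<sigma>" using \<sigma> T \<eta>_bounds by (simp add: M_def)
      show "0 \<le> indicator Sh x * (M * ((\<eta> + 1) * T) / \<sigma>)" for x
        by (rule mult_nonneg_nonneg[OF _ M0]) simp
      show "(X (gr x) \<bullet> sgn x) / \<sigma> \<le> indicator Sh x * (M * ((\<eta> + 1) * T) / \<sigma>)" for x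
      proof (cases "x \<in> Sh")
        case True
        have zS: "gr x \<in> S" by (rule gr_S[OF True])
        have "X (gr x) \<bullet> sgn x \<le> norm (X (gr x)) * norm (sgn x)" by (rule norm_cauchy_schwarz)
        also have "\<dots> \<le> norm (X (gr x)) * 1" by (intro mult_left_mono) (auto simp: norm_sgn)
        also have "\<dots> \<le> M * ((\<eta> + 1) * T)"
          using wt_le_uniform[OF h e zS] tau_xi_bounds(2)[OF zS] wt_nonneg(1)[OF h e]
          unfolding X_def M_def by (simp add: mult_mono)
        finally show ?thesis using True \<sigma> by (simp add: divide_right_mono)
      next
        case False
        then have "q (gr x) \<le> 0" using q_Sh[of x] by (meson linear)
        then show ?thesis using False van[of "gr x"] by simp
      qed
    qed
    finally have "2 * r^2 * (LINT z:U|lborel. wt1 h e (q z)) \<le> J" using wi by simp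
    then show ?thesis using r by (simp add: field_simps)
  qed
  then show ?thesis by blast
qed

text \<open>On \<open>A\<close> the weight has a positive lower bound that is uniform for small
  \<open>e\<close>. The bounds \<open>B1\<close> and \<open>B2\<close> on the factors of the defects
  depend on the individual solution; this is harmless, as they enter only \<open>err\<close>, which
  tends to 0 for a fixed solution.\<close>

lemma interior_estimate:
  assumes A: "A \<in> sets lborel" "A \<subseteq> U" and q0: "0 < q0" "\<And>z. z \<in> A \<Longrightarrow> q0 \<le> q z"
  shows "kap / (8 * C) * q0 powr b * (LINT z:A|lborel. Phi z) \<le> bdry_const * Mb * T * (LINT x:Sh|lborel. Den (gr x))"
proof -
  let ?R = "bdry_const * Mb * T * (LINT x:Sh|lborel. Den (gr x))"
  let ?L = "kap / (8 * C) * q0 powr b * (LINT z:A|lborel. Phi z)"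
  have "blip S (\<lambda>z. \<phi> z * (Zp z + cc * \<phi> z))" by (intro blip_mult blip_add blip_const blip_basic)
  then obtain B1 where B1: "0 \<le> B1" "\<And>z. z \<in> S \<Longrightarrow> \<bar>\<phi> z * (Zp z + cc * \<phi> z)\<bar> \<le> B1"
    by (rule blipE) auto
  obtain B2 where B2: "0 \<le> B2" "\<And>z. z \<in> S \<Longrightarrow> \<bar>Phi z\<bar> \<le> B2" using blip_basic(5) by (rule blipE) auto
  have b2: "0 < b / 2" "b / 2 \<le> 1" using b by auto
  obtain B3 where B3: "\<And>e. 0 < e \<Longrightarrow> (LINT z:U|lborel. wt1 (b / 2) e (q z)) \<le> B3"
    using wt1_integral_bounded[OF b2] by blast
  define m where "m = (LINT z:U|lborel. (1::real))"
  define err where "err e = 24 / b * B1 * B3 * e powr (b / 2) + 2 * C * B2 * m * e powr b" for e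
  have PhiU: "set_integrable lborel U Phi" by (rule U_integrable[OF blip_basic(5)])
  have PhiA: "set_integrable lborel A Phi" using set_integrable_subset[OF PhiU A] .
  have one: "set_integrable lborel U (\<lambda>z. 1::real)" by (rule U_integrable[OF blip_const])
  \<comment> \<open>With \<open>e < q0\<close> the regularised weight is still at least a quarter of
    the true one on \<open>A\<close>.\<close>
  have est: "?L \<le> ?R + err e"
    if e: "0 < e" "e < q0" for e
  proof -
    let ?w = "\<lambda>z. wt b e (q z) * Phi z"
    have wU: "set_integrable lborel U ?w" by (intro U_integrable blip_mult blip_wt[OF b e(1)] blip_basic)
    have wA: "set_integrable lborel A ?w" using set_integrable_subset[OF wU A] .
    have "q0 powr b / 4 * (LINT z:A|lborel. Phi z) = (LINT z:A|lborel. q0 powr b / 4 * Phi z)" by simp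
    also have "\<dots> \<le> (LINT z:A|lborel. ?w z)"
    proof (rule set_integral_mono)
      fix z assume z: "z \<in> A"
      have "q0 powr b / 4 \<le> q z powr b / 4" using q0(1) q0(2)[OF z] b by (intro divide_right_mono powr_mono2) auto
      also have "\<dots> \<le> wt b e (q z)" using q0(2)[OF z] e by (intro wt_ge[OF b e(1)]) auto
      finally show "q0 powr b / 4 * Phi z \<le> ?w z" using Phi_nonneg by (intro mult_right_mono)
    qed (use PhiA wA in auto)
    also have "\<dots> \<le> (LINT z:U|lborel. ?w z)"
      unfolding set_lebesgue_integral_def
    proof (rule integral_mono)
      fix z show "indicator A z *\<^sub>R ?w z \<le> indicator U z *\<^sub>R ?w z"
        using A(2) wt_nonneg(1)[OF b e(1)] Phi_nonneg by (auto simp: indicator_def)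
    qed (use wA wU in \<open>auto simp: set_integrable_def\<close>)
    finally have 1: "q0 powr b / 4 * (LINT z:A|lborel. Phi z) \<le> (LINT z:U|lborel. ?w z)" .
    let ?h = "\<lambda>z. 24 / b * B1 * e powr (b / 2) * wt1 (b / 2) e (q z) + 2 * C * B2 * e powr b * 1"
    have hU: "set_integrable lborel U ?h"
      by (intro set_integral_add(1) set_integrable_mult_right one U_integrable blip_wt(2)[OF b2 e(1)])
    have "(LINT z:U|lborel. kap / (2 * C) * ?w z - ?h z) \<le> (LINT z:U|lborel. bulk e z)"
    proof (rule set_integral_mono)
      show "set_integrable lborel U (\<lambda>z. kap / (2 * C) * ?w z - ?h z)"
        by (intro set_integral_diff(1) hU set_integrable_mult_right wU)
      fix z assume "z \<in> U"
      then have z: "z \<in> S" using U_S by auto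
      have "\<bar>wt_err1 b e (q z)\<bar> * \<bar>\<phi> z * (Zp z + cc * \<phi> z)\<bar> \<le> (12 / b * e powr (b / 2) * wt1 (b / 2) e (q z)) * B1"
        using wt_err1_le_wt1[OF b e(1)] B1(2)[OF z] by (intro mult_mono order_trans[OF abs_ge_zero]) auto
      moreover have "C * wt_err b e (q z) * Phi z \<le> C * (2 * e powr b) * B2"
        using wt_err_le[OF b e(1)] wt_nonneg(3)[OF b e(1)] B2(2)[OF z] C Phi_nonneg[of z]
        by (intro mult_mono mult_left_mono) auto
      ultimately show "kap / (2 * C) * ?w z - ?h z \<le> bulk e z"
        using bulk_ge[OF e(1) z] by (simp add: algebra_simps)
    qed (rule bulk_integral(1)[OF e(1)])
    also have "\<dots> \<le> ?R" by (rule bulk_integral_le[OF e(1)])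
    finally have f1: "kap / (2 * C) * (LINT z:U|lborel. ?w z) - (LINT z:U|lborel. ?h z) \<le> ?R"
      using wU hU by (simp add: set_integral_diff(2))
    have f2: "(LINT z:U|lborel. ?h z) \<le> err e"
    proof -
      have w1: "set_integrable lborel U (\<lambda>z. wt1 (b / 2) e (q z))" by (rule U_integrable[OF blip_wt(2)[OF b2 e(1)]])
      have "(LINT z:U|lborel. ?h z) = 24 / b * B1 * e powr (b / 2) * (LINT z:U|lborel. wt1 (b / 2) e (q z)) + 2 * C * B2 * e powr b * m"
        unfolding m_def set_integral_mult_right[symmetric]
        by (intro set_integral_add(2) set_integrable_mult_right w1 one)
      also have "\<dots> \<le> 24 / b * B1 * e powr (b / 2) * B3 + 2 * C * B2 * e powr b * m"
        using B3[OF e(1)] B1(1) b by (intro add_right_mono mult_left_mono) auto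
      finally show ?thesis by (simp add: err_def mult_ac)
    qed
    have f3: "?L = kap / (2 * C) * (q0 powr b / 4 * (LINT z:A|lborel. Phi z))" by simp
    have f4: "kap / (2 * C) * (q0 powr b / 4 * (LINT z:A|lborel. Phi z)) \<le> kap / (2 * C) * (LINT z:U|lborel. ?w z)"
      using 1 kap C by (intro mult_left_mono) auto
    have "l \<le> r + y" if "u - v \<le> r" "v \<le> y" "l = s" "s \<le> u" for l r u v y s :: real
      using that by linarith
    from this[OF f1 f2 f3 f4] show ?thesis .
  qed
  have lim: "((\<lambda>e. ?R + err e) \<longlongrightarrow> ?R + (24 / b * B1 * B3 * 0 + 2 * C * B2 * m * 0)) (at_right 0)"
  proof -
    have "((\<lambda>e::real. e powr a) \<longlongrightarrow> 0) (at_right 0)" if "0 < a" for a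
      using that by (intro tendsto_zero_powrI[where b = a] tendsto_ident_at tendsto_const)
        (auto simp: eventually_at_right_less intro: eventually_mono[OF eventually_at_right_less])
    then show ?thesis unfolding err_def using b by (intro tendsto_intros) auto
  qed
  have "\<forall>\<^sub>F e in at_right 0. ?L \<le> ?R + err e"
    using q0(1) est by (auto simp: eventually_at_right_field intro!: exI[of _ q0])
  from tendsto_lowerbound[OF lim this] show ?thesis by simp
qed

lemma bdry_const_eq:
  "bdry_const = (1 / \<sigma> + 1) * (2 * (\<eta> + 1 + nn + 3) + (\<eta> + 1) + 2 * (\<eta> + 1) * C)
    + (1 / \<sigma> + 1) * 2 * (\<eta> + 1) * ((nn - 1) / 2 + b)
      * ((4 * \<eta> * (\<eta> + 1) * (nn + 1) + 14 * \<eta>^2 + 16 * \<eta>^2 * (\<eta> + 1)) / ((1 - \<sigma>) ^ 4 / 16))"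
  unfolding bdry_const_def flux_const_def cc_def trace_const_def ..

lemma cone_region_subset_U:
  assumes g: "1 < g" "g < \<eta>"
  shows "cone_region \<sigma> g T \<subseteq> U"
proof -
  have "inverse \<eta> < inverse g" by (rule less_imp_inverse_less[OF g(2)]) (use g in simp)
  then have "inverse \<eta> * T < inverse g * T" using T by (rule mult_strict_right_mono)
  then have 1: "T / \<eta> < inverse g * T" by (simp only: divide_inverse mult.commute)
  have 2: "g * T < \<eta> * T" using g(2) T by (rule mult_strict_right_mono)
  show ?thesis unfolding cone_region_def cone_def U_def using 1 2 by (auto dest: less_trans)
qed

lemma region_estimate:
  shows "(LINT z:cone_region \<sigma> (1 + (1 - \<sigma>) / 8) T|lborel. Phi z)
    \<le> (\<bar>bdry_const\<bar> + 1) * ((\<eta> + 1)^2) powr b / (kap / (8 * C) * ((1 - \<sigma>)^2 / 8) powr b)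
      * T * (LINT x:Sh|lborel. Den (gr x))"
proof -
  let ?g = "1 + (1 - \<sigma>) / 8" and ?I = "LINT x:Sh|lborel. Den (gr x)"
  let ?A = "cone_region \<sigma> ?g T :: (real \<times> (real ^ 'n)) set"
  have g: "1 < ?g" using \<sigma> by simp
  have "0 \<le> \<eta> * \<sigma>" using \<sigma> \<eta>_bounds by simp
  moreover have "\<eta> * (1 - \<sigma>) = \<eta> - \<eta> * \<sigma>" by (simp add: right_diff_distrib)
  ultimately have "2 < \<eta>" using \<eta>_bounds(1) \<sigma> by linarith
  have "?g \<le> 2" using \<sigma> by simp
  then have g2: "?g < \<eta>" using \<open>2 < \<eta>\<close> by (rule order.strict_trans1)
  have AU: "?A \<subseteq> U" by (rule cone_region_subset_U[OF g g2])
  have "open ?A" unfolding cone_region_def cone_def case_prod_beta'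
    by (intro open_Int open_Collect_conj open_Collect_less continuous_intros)
  then have A: "?A \<in> sets lborel" by simp
  define q0 where "q0 = (1 - \<sigma>)^2 / 8 * T^2"
  have q0: "0 < q0" using \<sigma> T by (simp add: q0_def)
  have main: "kap / (8 * C) * q0 powr b * (LINT z:?A|lborel. Phi z) \<le> bdry_const * Mb * T * ?I"
    by (rule interior_estimate[OF A AU q0]) (unfold q0_def, rule q_ge_near)
  have I: "0 \<le> ?I" unfolding set_lebesgue_integral_def using Den_ge(4) by (intro integral_nonneg_AE) auto
  \<comment> \<open>The lower bound for the weight and the upper bound \<open>Mb\<close> carry the
    same power \<open>(T^2) powr b\<close>. It cancels, which makes the constant independent of
    \<open>T\<close>.\<close>
  have q: "q0 powr b = ((1 - \<sigma>)^2 / 8) powr b * (T^2) powr b" unfolding q0_def by (rule powr_mult)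
  have M: "Mb = ((\<eta> + 1)^2) powr b * (T^2) powr b" unfolding Mb_def power_mult_distrib by (rule powr_mult)
  define k where "k = kap / (8 * C) * ((1 - \<sigma>)^2 / 8) powr b"
  define t where "t = (T^2) powr b"
  have k: "0 < k" using kap C \<sigma> by (simp add: k_def)
  have t: "0 < t" using T by (simp add: t_def)
  have "bdry_const * Mb * T * ?I \<le> (\<bar>bdry_const\<bar> + 1) * Mb * T * ?I"
    using I T by (intro mult_right_mono) (auto simp: Mb_def)
  with main have "(k * (LINT z:?A|lborel. Phi z)) * t \<le> ((\<bar>bdry_const\<bar> + 1) * ((\<eta> + 1)^2) powr b * T * ?I) * t"
    unfolding q M k_def t_def by (simp add: mult_ac)
  then have "k * (LINT z:?A|lborel. Phi z) \<le> (\<bar>bdry_const\<bar> + 1) * ((\<eta> + 1)^2) powr b * T * ?I"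
    using t by (rule mult_right_le_imp_le)
  then show ?thesis using k unfolding k_def[symmetric] by (simp add: pos_le_divide_eq mult_ac)
qed

end

section \<open>The induced measure on the cone\<close>

text \<open>An orthogonal map taking an axis vector to \<open>v\<close> diagonalises the matrix,
  with one eigenvalue \<open>1 - s\<close> and all others 1.\<close>

lemma det_rank_one_perturbation:
  fixes v :: "real ^ 'n::finite"
  assumes v: "norm v = 1"
  shows "det (\<chi> i j. (if i = j then 1 else 0) - s * (v $ i * v $ j)) = 1 - s"
proof -
  fix k :: 'n
  let ?M = "\<chi> i j. (if i = j then 1 else 0) - s * (v $ i * v $ j) :: real ^ 'n ^ 'n"
  obtain f :: "real ^ 'n \<Rightarrow> real ^ 'n" where f: "orthogonal_transformation f" "f (axis k 1) = v"
    by (rule orthogonal_transformation_exists_1[of "axis k 1 :: real ^ 'n" v]) (auto simp: norm_axis_1 v)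
  define Q where "Q = matrix f"
  have Q: "Q *v w = f w" for w
    unfolding Q_def using f(1) by (simp add: orthogonal_transformation_linear matrix_works)
  have oQ: "orthogonal_matrix Q" unfolding Q_def using f(1) by (simp add: orthogonal_transformation_matrix)
  have M: "?M *v w = w - (s * (v \<bullet> w)) *\<^sub>R v" for w
  proof (rule vec_eq_iff[THEN iffD2], rule allI)
    fix i
    have "(?M *v w) $ i = (\<Sum>j\<in>UNIV. (if i = j then w $ j else 0) - s * v $ i * (v $ j * w $ j))"
      by (auto simp: matrix_vector_mult_def algebra_simps intro!: sum.cong)
    also have "\<dots> = w $ i - s * v $ i * (\<Sum>j\<in>UNIV. v $ j * w $ j)"
      by (simp add: sum_subtractf sum_distrib_left)
    finally show "(?M *v w) $ i = (w - (s * (v \<bullet> w)) *\<^sub>R v) $ i"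
      by (simp add: inner_vec_def mult_ac)
  qed
  have ent: "(transpose Q ** ?M ** Q) $ i $ j = (if i = j then (if i = k then 1 - s else 1) else 0)" for i j
  proof -
    have "(transpose Q ** ?M ** Q) $ i $ j = ((transpose Q ** ?M ** Q) *v axis j 1) \<bullet> axis i 1"
      by (simp add: matrix_vector_mul_component inner_axis matrix_vector_mult_basis column_def)
    also have "\<dots> = (transpose Q *v (?M *v f (axis j 1))) \<bullet> axis i 1"
      by (simp add: matrix_vector_mul_assoc[symmetric] Q)
    also have "\<dots> = (?M *v f (axis j 1)) \<bullet> f (axis i 1)"
      by (simp add: transpose_matrix_vector dot_lmul_matrix Q)
    also have "\<dots> = f (axis j 1) \<bullet> f (axis i 1) - s * (f (axis k 1) \<bullet> f (axis j 1)) * (f (axis k 1) \<bullet> f (axis i 1))"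
      by (simp only: M inner_diff_left inner_scaleR_left f(2))
    also have "\<dots> = axis j 1 \<bullet> (axis i 1 :: real ^ 'n) - s * (axis k 1 \<bullet> (axis j 1 :: real ^ 'n)) * (axis k 1 \<bullet> (axis i 1 :: real ^ 'n))"
      using f(1) by (simp only: orthogonal_transformation_def)
    also have "\<dots> = (if i = j then (if i = k then 1 - s else 1) else 0)"
      by (simp add: inner_axis_axis)
    finally show ?thesis .
  qed
  have "det (transpose Q) * det Q = 1"
    using oQ by (metis det_I det_mul orthogonal_matrix_def)
  then have "det ?M = det (transpose Q ** ?M ** Q)" by (simp add: det_mul mult_ac)
  also have "\<dots> = (\<Prod>i\<in>UNIV. (transpose Q ** ?M ** Q) $ i $ i)" by (rule det_diagonal) (simp add: ent)
  also have "\<dots> = (\<Prod>i\<in>UNIV. if i = k then 1 - s else 1)" by (simp add: ent)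
  also have "\<dots> = 1 - s" by (simp add: prod.If_cases)
  finally show ?thesis .
qed

text \<open>The derivative of \<open>norm x / \<sigma>\<close> is the covector
  \<open>sgn x / \<sigma>\<close>, so the metric is the identity minus a rank one matrix. For
  \<sigma> < 1 the determinant is negative, the boundary being timelike, and it does not depend on
  \<open>x\<close>: the induced measure is a constant multiple of Lebesgue measure in the
  parameter.\<close>

lemma cone_graph_metric_det:
  fixes x :: "real ^ 'n::finite"
  assumes "0 < \<sigma>" "x \<noteq> 0"
  shows "det (induced_metric (\<lambda>x. (norm x / \<sigma>, x)) x) = 1 - 1 / \<sigma>^2"
proof -
  have "((\<lambda>x. (norm x / \<sigma>, x)) has_derivative (\<lambda>h. (h \<bullet> sgn x / \<sigma>, h))) (at x)"
    using assms(1) by (auto intro!: derivative_eq_intros norm_has_derivative_sgn[OF assms(2)])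
  then have fd: "frechet_derivative (\<lambda>x. (norm x / \<sigma>, x)) (at x) = (\<lambda>h. (h \<bullet> sgn x / \<sigma>, h))"
    by (rule frechet_derivative_at[symmetric])
  have "induced_metric (\<lambda>x. (norm x / \<sigma>, x)) x
      = (\<chi> i j. (if i = j then 1 else 0) - (1 / \<sigma>^2) * (sgn x $ i * sgn x $ j))"
  proof -
    have "axis i 1 \<bullet> sgn x = sgn x $ i" for i by (simp add: inner_axis')
    moreover have "axis i 1 \<bullet> (axis j 1 :: real ^ 'n) = (if i = j then 1 else 0)" for i j by (simp add: inner_axis_axis)
    ultimately show ?thesis
      unfolding induced_metric_def fd minkowski_def fst_conv snd_conv
      by (simp only:) (simp add: vec_eq_iff power2_eq_square)
  qed
  then show ?thesis using det_rank_one_perturbation[of "sgn x" "1 / \<sigma>^2"] assms by (simp add: norm_sgn)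
qed

lemma cone_measure_integral:
  fixes f :: "real \<times> (real ^ 'n::finite) \<Rightarrow> real"
  assumes \<sigma>: "0 < \<sigma>" "\<sigma> < 1" and \<eta>: "0 < \<eta>" and T: "0 < T"
    and f: "continuous_on (cone_shell \<sigma> \<eta> T) f"
  shows "(LINT z:cone_shell \<sigma> \<eta> T|cone_measure \<sigma>. f z)
    = sqrt (1 / \<sigma>^2 - 1) * (LINT x:{x. T / \<eta> < norm x / \<sigma> \<and> norm x / \<sigma> < \<eta> * T}|lborel. f (norm x / \<sigma>, x))"
proof -
  let ?F = "\<lambda>x::real ^ 'n. (norm x / \<sigma>, x)"
  define c where "c = sqrt (1 / \<sigma>^2 - 1)"
  have "1 \<le> 1 / \<sigma>^2" using \<sigma> by (simp add: power_le_one)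
  then have c: "sqrt \<bar>1 - 1 / \<sigma>^2\<bar> = c" "0 \<le> c" by (simp_all add: c_def)
  have Fm: "?F \<in> borel_measurable borel"
    using \<sigma> by (intro borel_measurable_continuous_onI continuous_intros) auto
  have dens: "(\<lambda>x. ennreal (sqrt \<bar>det (induced_metric ?F x)\<bar>) * indicator (- {0}) x) = (\<lambda>x. ennreal (c * indicator (- {0}) x))"
    using c by (auto simp: fun_eq_iff indicator_def cone_graph_metric_det[OF \<sigma>(1)])
  have sh: "cone_shell \<sigma> \<eta> T \<in> sets borel"
  proof -
    have eq: "cone_shell \<sigma> \<eta> T = {z. norm (snd z) = \<sigma> * fst z} \<inter> {z. inverse \<eta> * T < fst z \<and> fst z < \<eta> * T}"
      by (auto simp: cone_shell_def cone_boundary_def)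
    show ?thesis unfolding eq
      by (intro sets.Int borel_closed borel_open closed_Collect_eq open_Collect_conj open_Collect_less continuous_intros)
  qed
  have fm: "(\<lambda>z. indicator (cone_shell \<sigma> \<eta> T) z *\<^sub>R f z) \<in> borel_measurable borel"
    using sh f by (rule borel_measurable_continuous_on_indicator)
  have "(LINT z:cone_shell \<sigma> \<eta> T|cone_measure \<sigma>. f z)
    = (LINT x|density lborel (\<lambda>x. ennreal (c * indicator (- {0}) x)). indicator (cone_shell \<sigma> \<eta> T) (?F x) *\<^sub>R f (?F x))"
    unfolding set_lebesgue_integral_def cone_measure_def induced_measure_def dens
    by (rule integral_distr[OF _ fm]) (use Fm in simp)
  also have "\<dots> = (LINT x|lborel. (c * indicator (- {0}) x) *\<^sub>R (indicator (cone_shell \<sigma> \<eta> T) (?F x) *\<^sub>R f (?F x)))"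
    by (rule integral_density) (use c measurable_compose[OF Fm fm] in auto)
  also have "\<dots> = (LINT x|lborel. c *\<^sub>R (indicator {x. T / \<eta> < norm x / \<sigma> \<and> norm x / \<sigma> < \<eta> * T} x *\<^sub>R f (?F x)))"
  proof (rule Bochner_Integration.integral_cong[OF refl])
    fix x :: "real ^ 'n"
    \<comment> \<open>Hence the shell avoids the vertex, and puncturing the parameter space at 0
      changes nothing.\<close>
    have "0 < T / \<eta>" using \<eta> T by simp
    then show "(c * indicator (- {0}) x) *\<^sub>R (indicator (cone_shell \<sigma> \<eta> T) (?F x) *\<^sub>R f (?F x))
      = c *\<^sub>R (indicator {x. T / \<eta> < norm x / \<sigma> \<and> norm x / \<sigma> < \<eta> * T} x *\<^sub>R f (?F x))"
      using \<sigma> by (auto simp: indicator_def cone_shell_def cone_boundary_def divide_inverse mult.commute)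
  qed
  finally show ?thesis by (simp add: set_lebesgue_integral_def c_def)
qed

section \<open>The exponent condition and the choice of the constants\<close>

text \<open>The gap is the value of \<open>\<kappa>\<close> at \<open>b = 0\<close>. For
  \<open>n = 1\<close> it is \<open>2 / (p + 1)\<close>; for \<open>n \<ge> 3\<close> the range of
  \<open>p\<close> lies below \<open>1 + 4 / (n - 1)\<close>, as
  \<open>n * (n - 1) \<le> n^2 + n - 4\<close>.\<close>

lemma subconformal_gap:
  assumes p: "1 \<le> p" and n: "0 < n" and lt: "ereal p < max_exponent n"
  shows "0 < (real n + 1) / (p + 1) - (real n - 1) / 2"
proof (cases "n = 1")
  case False
  then have n2: "2 \<le> n" using n by simp
  let ?n = "real n"
  have r: "2 \<le> ?n" using n2 by simp
  have "p < 1 + 4 / (?n - 1)"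
  proof (cases "n = 2")
    case True
    then show ?thesis using lt by (simp add: max_exponent_def)
  next
    case False
    have "p < 1 + 4 * ?n / (?n^2 + ?n - 4)" using lt False \<open>n \<noteq> 1\<close> by (simp add: max_exponent_def)
    also have "\<dots> \<le> 1 + 4 / (?n - 1)"
    proof -
      have "3 \<le> ?n" using n2 False by simp
      then have sq: "3 * ?n \<le> ?n^2" by (simp add: power2_eq_square)
      then have "0 < ?n^2 + ?n - 4" using \<open>3 \<le> ?n\<close> by linarith
      moreover have "4 * ?n * (?n - 1) \<le> 4 * (?n^2 + ?n - 4)"
        using r by (simp add: algebra_simps power2_eq_square)
      ultimately have "4 * ?n / (?n^2 + ?n - 4) \<le> 4 / (?n - 1)"
        using r by (simp add: frac_le_eq divide_le_0_iff pos_divide_le_eq pos_le_divide_eq mult_ac)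
      then show ?thesis by simp
    qed
    finally show ?thesis .
  qed
  then have "p - 1 < 4 / (?n - 1)" by simp
  then have "(p - 1) * (?n - 1) < 4" using pos_less_divide_eq[of "?n - 1" "p - 1" 4] r by simp
  then have "(?n - 1) * (p + 1) < 2 * (?n + 1)" by (simp add: algebra_simps)
  then show ?thesis using p by (simp add: field_simps)
qed (use p in simp)

theorem theorem1p9:
  fixes \<sigma> p :: real
  assumes "0 < \<sigma>" and "\<sigma> < 1"
    and "1 \<le> p" and "ereal p < max_exponent CARD('n::finite)"
  shows "\<exists>\<eta>\<^sub>0>1. \<forall>\<eta>\<ge>\<eta>\<^sub>0. \<forall>C>1. \<exists>\<alpha>\<^sub>0>0. \<exists>\<gamma>. 1 < \<gamma> \<and> \<gamma> < \<eta> \<and> (\<exists>K>0.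
    \<forall>tstar>0. \<forall>\<alpha>. 0 < \<alpha> \<and> \<alpha> \<le> \<alpha>\<^sub>0 \<longrightarrow>
    (\<forall>(V :: real \<times> (real ^ 'n) \<Rightarrow> real) (\<phi> :: real \<times> (real ^ 'n) \<Rightarrow> real) S.
      S = closure (cone_region \<sigma> \<eta> tstar) \<longrightarrow>
      C1_on S V \<longrightarrow>
      (\<forall>z\<in>S. inverse C \<le> V z \<and> V z \<le> C \<and> grad_norm S V z \<le> \<alpha> * inverse tstar) \<longrightarrow>
      C2_on S \<phi> \<longrightarrow>
      (\<forall>z\<in>S. wave_op S \<phi> z + V z * \<bar>\<phi> z\<bar> powr (p - 1) * \<phi> z = 0) \<longrightarrow>
      (LINT z:cone_region \<sigma> \<gamma> tstar|lborel. \<bar>\<phi> z\<bar> powr (p + 1))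
        \<le> K * tstar * (LINT z:cone_shell \<sigma> \<eta> tstar|cone_measure \<sigma>.
            (grad_norm S \<phi> z)\<^sup>2 + \<bar>\<phi> z\<bar> powr (p + 1) + (inverse tstar)\<^sup>2 * \<bar>\<phi> z\<bar>\<^sup>2)))"
proof -
  let ?n = "real CARD('n)"
  define g where "g = (?n + 1) / (p + 1) - (?n - 1) / 2"
  have g: "0 < g" unfolding g_def by (rule subconformal_gap) (use assms in auto)
  \<comment> \<open>Raising \<open>b\<close> from 0 lowers the gap by less than \<open>b\<close>, so
    \<open>b \<le> g / 2\<close> keeps \<open>kap\<close> positive; the cap at 1 is what the
    estimates for \<open>wt\<close> require.\<close>
  define b where "b = min 1 (g / 2)"
  have b: "0 < b" "b \<le> 1" using g by (auto simp: b_def)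
  define kap where "kap = (2 * b + ?n + 1) * (1 / (p + 1)) - ((?n - 1) / 2 + b)"
  have kap: "0 < kap"
  proof -
    have "kap = g + 2 * b / (p + 1) - b" unfolding kap_def g_def by (simp add: add_divide_distrib)
    moreover have "0 < 2 * b / (p + 1)" using b assms(3) by simp
    moreover have "2 * b \<le> g" by (simp add: b_def)
    ultimately show ?thesis using b by linarith
  qed
  have big: "1 < 1 + 4 / (1 - \<sigma>)" using assms(2) by simp
  show ?thesis
  proof (rule exI[of _ "1 + 4 / (1 - \<sigma>)"], intro conjI big allI impI, goal_cases)
    case (1 \<eta> C)
    then have \<eta>: "1 + 4 / (1 - \<sigma>) \<le> \<eta>" and C: "1 < C" by auto
    have \<eta>1: "1 < \<eta>" using \<eta> big by linarith
    \<comment> \<open>The value of \<open>bdry_const\<close>, written out because it must be fixed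
      before \<open>T\<close>, \<open>V\<close> and \<phi> are given, while the locale constant
      exists only afterwards.\<close>
    define B where "B = (1 / \<sigma> + 1) * (2 * (\<eta> + 1 + ?n + 3) + (\<eta> + 1) + 2 * (\<eta> + 1) * C)
      + (1 / \<sigma> + 1) * 2 * (\<eta> + 1) * ((?n - 1) / 2 + b)
        * ((4 * \<eta> * (\<eta> + 1) * (?n + 1) + 14 * \<eta>\<^sup>2 + 16 * \<eta>\<^sup>2 * (\<eta> + 1)) / ((1 - \<sigma>) ^ 4 / 16))"
    define c where "c = sqrt (1 / \<sigma>\<^sup>2 - 1)"
    have "\<sigma>\<^sup>2 < 1" using assms(1,2) by (simp add: power_less_one_iff)
    then have c: "0 < c" using assms(1) by (simp add: c_def)
    define K where "K = (\<bar>B\<bar> + 1) * ((\<eta> + 1)\<^sup>2) powr b / (kap / (8 * C) * ((1 - \<sigma>)\<^sup>2 / 8) powr b)"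
    have K: "0 < K"
      unfolding K_def using \<eta>1 kap C assms(2) by (intro divide_pos_pos mult_pos_pos) auto
    define \<alpha>0 where "\<alpha>0 = kap / (4 * (\<eta> + 1) * C)"
    have \<alpha>0: "0 < \<alpha>0" unfolding \<alpha>0_def using kap \<eta>1 C by (intro divide_pos_pos mult_pos_pos) auto
    have "4 < 4 / (1 - \<sigma>)" using assms(1,2) by (simp add: pos_less_divide_eq)
    then have "2 < \<eta>" using \<eta> by linarith
    have "1 + (1 - \<sigma>) / 8 \<le> 2" using assms(1) by simp
    then have \<gamma>2: "1 + (1 - \<sigma>) / 8 < \<eta>" using \<open>2 < \<eta>\<close> by (rule order.strict_trans1)
    have \<gamma>: "1 < 1 + (1 - \<sigma>) / 8" using assms(2) by simp
    have main: "(LINT z:cone_region \<sigma> (1 + (1 - \<sigma>) / 8) T|lborel. \<bar>\<phi> z\<bar> powr (p + 1))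
        \<le> K / c * T * (LINT z:cone_shell \<sigma> \<eta> T|cone_measure \<sigma>.
            (grad_norm S \<phi> z)\<^sup>2 + \<bar>\<phi> z\<bar> powr (p + 1) + (inverse T)\<^sup>2 * \<bar>\<phi> z\<bar>\<^sup>2)"
      if T: "0 < T" and \<alpha>: "\<alpha> \<le> \<alpha>0" and S: "S = closure (cone_region \<sigma> \<eta> T)" and V: "C1_on S V"
        and Vb: "\<forall>z\<in>S. inverse C \<le> V z \<and> V z \<le> C \<and> grad_norm S V z \<le> \<alpha> * inverse T"
        and \<phi>: "C2_on S \<phi>" and eq: "\<forall>z\<in>S. wave_op S \<phi> z + V z * \<bar>\<phi> z\<bar> powr (p - 1) * \<phi> z = 0"
      for T \<alpha> S and V \<phi> :: "real \<times> (real ^ 'n) \<Rightarrow> real"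
    proof -
      fix k :: 'n
      \<comment> \<open>Any direction would do; the length is midway between
        \<open>\<sigma> * T\<close> and \<open>T\<close>.\<close>
      define x0 where "x0 = ((1 + \<sigma>) / 2 * T) *\<^sub>R (axis k 1 :: real ^ 'n)"
      have nx0: "norm x0 = (1 + \<sigma>) / 2 * T" using assms(1) T by (simp add: x0_def norm_axis_1)
      interpret G: cone_geometry \<sigma> \<eta> T x0 S
        using assms(1,2) \<eta> T nx0 S by unfold_locales auto
      interpret F: wave_field \<sigma> \<eta> T x0 S p b V \<phi>
        using assms(3) b V \<phi> eq by unfold_locales auto
      have nn: "F.nn = ?n" by (rule F.nn_def)
      interpret E: wave_estimate \<sigma> \<eta> T x0 S p b V \<phi> C kap
      proof unfold_locales
        show "kap = (2 * b + F.nn + 1) * F.rr - F.cc" unfolding kap_def F.rr_def F.cc_def nn ..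
        fix z assume "z \<in> S"
        then have "grad_norm S V z \<le> \<alpha> * inverse T" using Vb by blast
        also have "\<dots> \<le> \<alpha>0 * inverse T" using \<alpha> T by (intro mult_right_mono) auto
        finally show "grad_norm S V z \<le> kap / (4 * (\<eta> + 1) * C) * inverse T" unfolding \<alpha>0_def .
      qed (use C Vb kap in auto)
      have B: "E.bdry_const = B" unfolding E.bdry_const_eq B_def nn ..
      have den: "(grad_norm S \<phi> z)\<^sup>2 + \<bar>\<phi> z\<bar> powr (p + 1) + (inverse T)\<^sup>2 * \<bar>\<phi> z\<bar>\<^sup>2 = F.Den z" for z
      proof -
        have "(grad_norm S \<phi> z)\<^sup>2 = (F.pt z)\<^sup>2 + F.px z \<bullet> F.px z"
          unfolding grad_norm_def F.pt_def F.px_def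
          by (subst real_sqrt_pow2) (auto simp: inner_vec_def power2_eq_square intro!: add_nonneg_nonneg sum_nonneg)
        then show ?thesis by (simp add: F.Den_def F.Phi_def)
      qed
      have "cone_shell \<sigma> \<eta> T \<subseteq> S"
      proof
        fix z :: "real \<times> (real ^ 'n)" assume "z \<in> cone_shell \<sigma> \<eta> T"
        then show "z \<in> S"
          by (intro G.in_S) (auto simp: cone_shell_def cone_boundary_def G.K_def divide_inverse mult.commute)
      qed
      moreover obtain L where "L-lipschitz_on S F.Den" using F.blip_Den by (auto simp: blip_def)
      ultimately have cont: "continuous_on (cone_shell \<sigma> \<eta> T) F.Den"
        by (meson continuous_on_subset lipschitz_on_continuous_on)
      \<comment> \<open>The constant density \<open>c\<close> of the cone measure is the reason for
        dividing \<open>K\<close> by \<open>c\<close> in the final constant.\<close>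
      have meas: "(LINT z:cone_shell \<sigma> \<eta> T|cone_measure \<sigma>. F.Den z) = c * (LINT x:G.Sh|lborel. F.Den (G.gr x))"
        using cone_measure_integral[OF assms(1,2) G.\<eta>_bounds(3) T cont] by (simp add: c_def G.Sh_def G.gr_def)
      have "(LINT z:cone_region \<sigma> (1 + (1 - \<sigma>) / 8) T|lborel. F.Phi z) \<le> K * T * (LINT x:G.Sh|lborel. F.Den (G.gr x))"
        using E.region_estimate unfolding B K_def .
      also have "\<dots> = K / c * T * (LINT z:cone_shell \<sigma> \<eta> T|cone_measure \<sigma>. F.Den z)"
        unfolding meas using c by simp
      finally show ?thesis unfolding den F.Phi_def .
    qed
    show ?case
      by (rule exI[of _ \<alpha>0], intro conjI \<alpha>0, rule exI[of _ "1 + (1 - \<sigma>) / 8"], intro conjI \<gamma> \<gamma>2,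
          rule exI[of _ "K / c"], intro conjI divide_pos_pos K c allI impI, elim conjE, rule main)
  qed
qed

end
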